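(* Let $\mathcal{H}$ be a separable complex Hilbert space and let $\mathcal{D}$ be a masa in $\mathcal{B}(\mathcal{H})$. Suppose that $T \in \mathcal{B}(\mathcal{H})$ has the property that the range of every projection in $\mathcal{D}$ is almost-invariant for $T$. Then there exist $F \in \mathcal{F}(\mathcal{H})$ and $D \in \mathcal{D}$ such that $T = D + F$. Furthermore, if $\kappa = \sup\{\mathrm{rank}\,(I-P)TP : P \in \mathcal{P}(\mathcal{D})\}$, then $\kappa < \infty$ and: (a) if $\mathcal{D}$ is an atomic masa, then $F$ may be chosen so that $\mathrm{rank}\, F \le 3\kappa$; (b) if $\mathcal{D}$ is a continuous masa, then $F$ is uniquely determined (among finite-rank operators $F$ with $T - F \in \mathcal{D}$) and $\mathrm{rank}\, F \le \kappa$; (c) for $\mathcal{D}$ a general masa, $F$ may be chosen so that $\mathrm{rank}\, F \le 6\kappa$.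
   Context: $\mathcal{B}(\mathcal{H})$ denotes the bounded linear operators on $\mathcal{H}$ and $\mathcal{F}(\mathcal{H})$ the finite-rank operators in $\mathcal{B}(\mathcal{H})$. A projection is an operator $P$ with $P = P^2 = P^*$. A masa is a maximal abelian self-adjoint subalgebra of $\mathcal{B}(\mathcal{H})$; $\mathcal{P}(\mathcal{D})$ denotes the set of (orthogonal) projections in $\mathcal{D}$. Every masa on a separable space is unitarily equivalent to $\{M_f : f \in L^\infty(X,\mu)\}$ acting on $L^2(X,\mu)$ by multiplication, for some $\sigma$-finite measure space $(X,\mu)$; the masa is called atomic (discrete) if $\mu$ is purely atomic and continuous if $\mu$ is atomless. A closed subspace $\mathcal{Y}$ of $\mathcal{H}$ is almost-invariant for $T$ if there is a finite-dimensional subspace $\mathcal{M}$ with $T\mathcal{Y} \subseteq \mathcal{Y} + \mathcal{M}$; if $\mathcal{Y}$ is the range of a projection $P$ this is equivalent to $(I-P)TP$ having finite rank. *)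

theory Defs
  imports "HOL-Analysis.Analysis" "HOL-Library.Extended_Nat"
begin

text \<open>Complex Hilbert spaces. The inner product is linear in its first argument. The real
  structure inherited from the library is the underlying one: real scalars act through
  \<open>complex_of_real\<close> and the real inner product is the real part of the complex one, so that
  \<open>(norm x)\<^sup>2 = cinner x x\<close>. The zero space is included.\<close>

class chilbert_space = real_inner + banach +
  fixes scaleC :: "complex \<Rightarrow> 'a \<Rightarrow> 'a"  (infixr \<open>*\<^sub>C\<close> 75)
    and cinner :: "'a \<Rightarrow> 'a \<Rightarrow> complex"
  assumes scaleC_add_right: "c *\<^sub>C (x + y) = c *\<^sub>C x + c *\<^sub>C y"
    and scaleC_add_left: "(c + d) *\<^sub>C x = c *\<^sub>C x + d *\<^sub>C x"
    and scaleC_scaleC: "c *\<^sub>C (d *\<^sub>C x) = (c * d) *\<^sub>C x"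
    and scaleR_scaleC: "r *\<^sub>R x = complex_of_real r *\<^sub>C x"
    and cinner_commute: "cinner x y = cnj (cinner y x)"
    and cinner_add_left: "cinner (x + y) z = cinner x z + cinner y z"
    and cinner_scaleC_left: "cinner (c *\<^sub>C x) y = c * cinner x y"
    and inner_eq_Re_cinner: "inner x y = Re (cinner x y)"

global_interpretation complex_vector: vector_space "scaleC :: complex \<Rightarrow> 'a \<Rightarrow> 'a::chilbert_space"
proof
  show "1 *\<^sub>C x = x" for x :: 'a
    using scaleR_scaleC[of 1 x] by simp
qed (simp_all add: scaleC_add_right scaleC_add_left scaleC_scaleC)

text \<open>The library type \<open>'a \<Rightarrow>\<^sub>L 'a\<close> consists of the bounded real-linear operators; \<open>BH\<close> selects
  the complex-linear ones.\<close>

definition BH :: "('a::chilbert_space \<Rightarrow>\<^sub>L 'a) set"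
  where "BH = {T. \<forall>c x. blinfun_apply T (c *\<^sub>C x) = c *\<^sub>C blinfun_apply T x}"

definition complex_finite_dim :: "'a::chilbert_space set \<Rightarrow> bool"
  where "complex_finite_dim V \<longleftrightarrow> (\<exists>B. finite B \<and> V \<subseteq> complex_vector.span B)"

definition FH :: "('a::chilbert_space \<Rightarrow>\<^sub>L 'a) set"
  where "FH = {T \<in> BH. complex_finite_dim (range (blinfun_apply T))}"

text \<open>The case distinction is needed because the library's \<open>dim\<close> of an infinite-dimensional
  space is \<open>0\<close>.\<close>

definition rank_op :: "('a::chilbert_space \<Rightarrow>\<^sub>L 'a) \<Rightarrow> enat"
  where "rank_op T =
    (if complex_finite_dim (range (blinfun_apply T))
     then enat (complex_vector.dim (range (blinfun_apply T))) else \<infinity>)"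

definition is_adjoint :: "('a::chilbert_space \<Rightarrow>\<^sub>L 'a) \<Rightarrow> ('a \<Rightarrow>\<^sub>L 'a) \<Rightarrow> bool"
  where "is_adjoint S T \<longleftrightarrow>
    (\<forall>x y. cinner (blinfun_apply T x) y = cinner x (blinfun_apply S y))"

definition abelian_sa_subalgebra :: "('a::chilbert_space \<Rightarrow>\<^sub>L 'a) set \<Rightarrow> bool"
  where "abelian_sa_subalgebra A \<longleftrightarrow>
    A \<subseteq> BH \<and> 0 \<in> A \<and>
    (\<forall>S\<in>A. \<forall>T\<in>A. S + T \<in> A) \<and>
    (\<forall>c. \<forall>S\<in>A. \<forall>T\<in>BH.
       (\<forall>x. blinfun_apply T x = c *\<^sub>C blinfun_apply S x) \<longrightarrow> T \<in> A) \<and>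
    (\<forall>S\<in>A. \<forall>T\<in>A. S o\<^sub>L T \<in> A) \<and>
    (\<forall>S\<in>A. \<forall>T\<in>A. S o\<^sub>L T = T o\<^sub>L S) \<and>
    (\<forall>T\<in>A. \<exists>S\<in>A. is_adjoint S T)"

definition masa :: "('a::chilbert_space \<Rightarrow>\<^sub>L 'a) set \<Rightarrow> bool"
  where "masa \<D> \<longleftrightarrow> abelian_sa_subalgebra \<D> \<and>
    (\<forall>\<E>. abelian_sa_subalgebra \<E> \<and> \<D> \<subseteq> \<E> \<longrightarrow> \<E> = \<D>)"

definition projections_in :: "('a::chilbert_space \<Rightarrow>\<^sub>L 'a) set \<Rightarrow> ('a \<Rightarrow>\<^sub>L 'a) set"
  where "projections_in \<D> = {P \<in> \<D>. P o\<^sub>L P = P \<and> is_adjoint P P}"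

definition almost_invariant :: "('a::chilbert_space \<Rightarrow>\<^sub>L 'a) \<Rightarrow> 'a set \<Rightarrow> bool"
  where "almost_invariant T Y \<longleftrightarrow>
    (\<exists>M. complex_vector.subspace M \<and> complex_finite_dim M \<and>
         blinfun_apply T ` Y \<subseteq> {y + m | y m. y \<in> Y \<and> m \<in> M})"

text \<open>Elements of \<open>L\<^sup>2\<close> and \<open>L\<^sup>\<infinity>\<close> are represented by functions, not by classes modulo
  almost-everywhere equality.\<close>

definition L2_fun :: "'x measure \<Rightarrow> ('x \<Rightarrow> complex) set"
  where "L2_fun \<mu> = {f \<in> borel_measurable \<mu>. integrable \<mu> (\<lambda>x. (norm (f x))\<^sup>2)}"

definition Linf_fun :: "'x measure \<Rightarrow> ('x \<Rightarrow> complex) set"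
  where "Linf_fun \<mu> = {f \<in> borel_measurable \<mu>. \<exists>C. AE x in \<mu>. norm (f x) \<le> C}"

text \<open>A unitary operator from \<open>L\<^sup>2(X,\<mu>)\<close> onto the Hilbert space, as a map on representatives:
  functions that agree almost everywhere have the same image, since preservation of the inner
  product gives \<open>norm (U f - U g) = 0\<close>.\<close>

definition unitary_from_L2 :: "'x measure \<Rightarrow> (('x \<Rightarrow> complex) \<Rightarrow> 'a::chilbert_space) \<Rightarrow> bool"
  where "unitary_from_L2 \<mu> U \<longleftrightarrow>
    (\<forall>f\<in>L2_fun \<mu>. \<forall>g\<in>L2_fun \<mu>. U (\<lambda>x. f x + g x) = U f + U g) \<and>
    (\<forall>c. \<forall>f\<in>L2_fun \<mu>. U (\<lambda>x. c * f x) = c *\<^sub>C U f) \<and>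
    (\<forall>f\<in>L2_fun \<mu>. \<forall>g\<in>L2_fun \<mu>. cinner (U f) (U g) = (\<integral>x. f x * cnj (g x) \<partial>\<mu>)) \<and>
    U ` L2_fun \<mu> = UNIV"

text \<open>\<open>\<D>\<close> is the image under conjugation by a unitary of the algebra of multiplication operators
  \<open>M\<^sub>f\<close>, \<open>f \<in> L\<^sup>\<infinity>(X,\<mu>)\<close>: \<open>T = U M\<^sub>f U\<^sup>*\<close> says that \<open>T (U g) = U (f g)\<close> for all \<open>g\<close> in \<open>L\<^sup>2\<close>.\<close>

definition unitarily_equiv_mult_algebra ::
    "('a::chilbert_space \<Rightarrow>\<^sub>L 'a) set \<Rightarrow> 'x measure \<Rightarrow> bool"
  where "unitarily_equiv_mult_algebra \<D> \<mu> \<longleftrightarrow>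
    (\<exists>U. unitary_from_L2 \<mu> U \<and>
      \<D> = {T \<in> BH. \<exists>f\<in>Linf_fun \<mu>. \<forall>g\<in>L2_fun \<mu>. blinfun_apply T (U g) = U (\<lambda>x. f x * g x)})"

definition measure_atom :: "'x measure \<Rightarrow> 'x set \<Rightarrow> bool"
  where "measure_atom \<mu> A \<longleftrightarrow> A \<in> sets \<mu> \<and> emeasure \<mu> A > 0 \<and>
    (\<forall>B\<in>sets \<mu>. B \<subseteq> A \<longrightarrow> emeasure \<mu> B = 0 \<or> emeasure \<mu> (A - B) = 0)"

definition purely_atomic :: "'x measure \<Rightarrow> bool"
  where "purely_atomic \<mu> \<longleftrightarrow>
    (\<forall>A\<in>sets \<mu>. emeasure \<mu> A > 0 \<longrightarrow> (\<exists>B. B \<subseteq> A \<and> measure_atom \<mu> B))"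

definition atomless :: "'x measure \<Rightarrow> bool"
  where "atomless \<mu> \<longleftrightarrow> (\<nexists>A. measure_atom \<mu> A)"

text \<open>A definition cannot quantify over all types of points of the measure space \<open>X\<close>, so that type
  is a parameter. In a theorem with these predicates as hypotheses and \<open>'x\<close> a type variable,
  measure spaces over every type are covered.\<close>

definition atomic_masa :: "'x itself \<Rightarrow> ('a::chilbert_space \<Rightarrow>\<^sub>L 'a) set \<Rightarrow> bool"
  where "atomic_masa _ \<D> \<longleftrightarrow> masa \<D> \<and>
    (\<exists>\<mu> :: 'x measure. sigma_finite_measure \<mu> \<and> purely_atomic \<mu> \<and>
       unitarily_equiv_mult_algebra \<D> \<mu>)"

definition continuous_masa :: "'x itself \<Rightarrow> ('a::chilbert_space \<Rightarrow>\<^sub>L 'a) set \<Rightarrow> bool"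
  where "continuous_masa _ \<D> \<longleftrightarrow> masa \<D> \<and>
    (\<exists>\<mu> :: 'x measure. sigma_finite_measure \<mu> \<and> atomless \<mu> \<and>
       unitarily_equiv_mult_algebra \<D> \<mu>)"

end

theory Submission
  imports Defs
begin

text \<open>A masa is generated by its projections, so \<open>X\<close> lies in \<open>\<D>\<close> as soon as it commutes with them,
  that is, as soon as \<open>E X G = 0\<close> for all orthogonal projections \<open>E\<close>, \<open>G\<close> in \<open>\<D>\<close>. If the rank \<open>k\<close> of
  the blocks \<open>Q T P\<close> with \<open>Q P = 0\<close> is maximal at \<open>(P, Q)\<close>, then bordering this block does not raise its
  rank, and so \<open>T\<close> agrees on all disjoint pairs outside \<open>P + Q\<close> with one operator \<open>K\<close> of rank \<open>k\<close>.
  Hence \<open>T - K\<close> compressed to the complement of \<open>P + Q\<close> is in \<open>\<D>\<close>.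

  Every projection is a finite sum of pieces that have rank one or are small on prescribed vectors, and
  \<open>k\<close> pieces on either side suffice to carry the rank \<open>k\<close>. So \<open>P\<close> and \<open>Q\<close> may be taken to be a part of
  rank at most \<open>k\<close> plus a small part; removing the small parts \<open>S\<close> from the original pair
  leaves another maximal pair, whose complement is \<open>S\<close>. The two corners and the two
  off-diagonal blocks give \<open>3k + k + k + k = 6k\<close>. In the atomic case \<open>S = 0\<close>; in the continuous case
  only small parts occur and \<open>S\<close> can be shrunk to zero. That \<open>k\<close> is finite is a gliding hump argument.\<close>

subsection \<open>Complex inner products\<close>

text \<open>The maximal block acts through a Schur complement. If \<open>E\<close>, \<open>G\<close>
  are disjoint, \<open>E P = 0\<close> and \<open>G Q = 0\<close>, then the joins of
  \<open>Q\<close> with \<open>E\<close> and of \<open>P\<close> with \<open>G\<close> are disjoint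
  as well, so the bordered block has rank at most \<open>k\<close>. As \<open>Q T P\<close> already
  uses up this rank, the Schur complement vanishes, which is a formula for \<open>E T G\<close>.
  After the corner of \<open>T - K\<close> is split off, the remainder has the form
  \<open>P X + (I - P) X Q\<close>. Its rank is controlled only by the ranks of \<open>P\<close> and
  \<open>Q\<close>, which may be infinite: this is why the maximal pair has to be thinned out.
  Thinning is possible because rank at least \<open>k\<close> is certified by finitely many vectors,
  hence stable under changes of the projections that are small on these vectors. The spectral
  theorem is replaced by bisection with spectral projections obtained from a square root, and the
  measure space enters only in translating atomic and continuous masas into statements about
  projections.\<close>

lemma cinner_add_right: "cinner x (y + z) = cinner x y + cinner x z"
  by (metis cinner_add_left cinner_commute complex_cnj_add)

lemma cinner_scaleC_right: "cinner x (c *\<^sub>C y) = cnj c * cinner x y"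
  by (metis cinner_commute cinner_scaleC_left complex_cnj_mult)

lemma scaleC_minus1: "(-1) *\<^sub>C x = - x"
  using scaleR_scaleC[of "-1" x] by simp

lemma cinner_minus_left: "cinner (- x) y = - cinner x y"
  using cinner_scaleC_left[of "-1" x y] by (simp add: scaleC_minus1)

lemma cinner_minus_right: "cinner x (- y) = - cinner x y"
  using cinner_scaleC_right[of x "-1" y] by (simp add: scaleC_minus1)

lemma cinner_diff_left: "cinner (x - y) z = cinner x z - cinner y z"
  using cinner_add_left[of x "-y" z] by (simp add: cinner_minus_left)

lemma cinner_diff_right: "cinner x (y - z) = cinner x y - cinner x z"
  using cinner_add_right[of x y "-z"] by (simp add: cinner_minus_right)

lemma cinner_zero_left [simp]: "cinner 0 y = 0"
  using cinner_diff_left[of 0 0 y] by simp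

lemma cinner_zero_right [simp]: "cinner y 0 = 0"
  using cinner_diff_right[of y 0 0] by simp

lemma cinner_sum_left: "cinner (\<Sum>i\<in>A. f i) y = (\<Sum>i\<in>A. cinner (f i) y)"
  by (induction A rule: infinite_finite_induct) (auto simp: cinner_add_left)

lemma inner_imaginary_right: "inner x (\<i> *\<^sub>C y) = Im (cinner x y)"
  by (simp add: inner_eq_Re_cinner cinner_scaleC_right)

lemma inner_imaginary_left: "inner (\<i> *\<^sub>C x) y = - Im (cinner x y)"
  by (simp add: inner_eq_Re_cinner cinner_scaleC_left)

lemma cinner_self: "cinner x x = complex_of_real ((norm x)\<^sup>2)"
proof -
  have "Im (cinner x x) = 0"
    using arg_cong[OF cinner_commute[of x x], of Im] by simp
  moreover have "Re (cinner x x) = (norm x)\<^sup>2"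
    by (simp flip: inner_eq_Re_cinner add: power2_norm_eq_inner)
  ultimately show ?thesis by (simp add: complex_eq_iff)
qed

lemma cinner_self_eq_0 [simp]: "cinner x x = 0 \<longleftrightarrow> x = 0"
  by (simp add: cinner_self)

lemma norm_scaleC: "norm (c *\<^sub>C x) = cmod c * norm x"
proof -
  have "complex_of_real ((norm (c *\<^sub>C x))\<^sup>2) = c * cnj c * of_real ((norm x)\<^sup>2)"
    by (simp only: cinner_self[symmetric] cinner_scaleC_left cinner_scaleC_right mult_ac)
  also have "\<dots> = of_real ((cmod c * norm x)\<^sup>2)"
    by (simp only: complex_norm_square[symmetric] power_mult_distrib of_real_mult)
  finally have "(norm (c *\<^sub>C x))\<^sup>2 = (cmod c * norm x)\<^sup>2"
    unfolding of_real_eq_iff .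
  then show ?thesis by simp
qed

text \<open>A unimodular factor turns the complex inner product into its modulus, which reduces the
  claim to the real Cauchy-Schwarz inequality.\<close>

lemma norm_cinner_le: "cmod (cinner x y) \<le> norm x * norm y"
proof -
  define c where "c = (if cinner x y = 0 then 1 else cnj (sgn (cinner x y)))"
  have c: "cmod c = 1" by (simp add: c_def norm_sgn)
  have "c * cinner x y = of_real (cmod (cinner x y))"
    by (auto simp: c_def sgn_eq mult.commute complex_norm_square[symmetric] power2_eq_square field_simps)
  then have "cmod (cinner x y) = inner (c *\<^sub>C x) y"
    by (simp add: inner_eq_Re_cinner cinner_scaleC_left)
  also have "\<dots> \<le> norm (c *\<^sub>C x) * norm y" by (rule norm_cauchy_schwarz)
  finally show ?thesis by (simp add: norm_scaleC c)
qed

lemma bounded_linear_scaleC: "bounded_linear ((*\<^sub>C) c)"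
  by (rule bounded_linear_intro[where K = "cmod c"])
    (simp_all add: scaleC_add_right scaleR_scaleC scaleC_scaleC norm_scaleC mult_ac)

lemma complex_subspace_imp_subspace: "complex_vector.subspace V \<Longrightarrow> subspace V"
  by (auto simp: subspace_def complex_vector.subspace_def scaleR_scaleC)

section \<open>Complex-linear operators\<close>

lemma BH_linear: "A \<in> BH \<Longrightarrow> Vector_Spaces.linear (*\<^sub>C) (*\<^sub>C) (blinfun_apply A)"
  by unfold_locales (auto simp: BH_def blinfun.add_right)

lemma BH_scaleC: "A \<in> BH \<Longrightarrow> blinfun_apply A (c *\<^sub>C x) = c *\<^sub>C blinfun_apply A x"
  by (simp add: BH_def)

lemma BH_compose: "A \<in> BH \<Longrightarrow> B \<in> BH \<Longrightarrow> A o\<^sub>L B \<in> BH"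
  by (simp add: BH_def)

lemma BH_add: "A \<in> BH \<Longrightarrow> B \<in> BH \<Longrightarrow> A + B \<in> BH"
  by (simp add: BH_def blinfun.add_left scaleC_add_right)

lemma BH_diff: "A \<in> BH \<Longrightarrow> B \<in> BH \<Longrightarrow> A - B \<in> BH"
  by (simp add: BH_def blinfun.diff_left complex_vector.scale_right_diff_distrib)

lemma BH_scaleR: "A \<in> BH \<Longrightarrow> r *\<^sub>R A \<in> BH"
  by (simp add: BH_def blinfun.scaleR_left scaleR_scaleC scaleC_scaleC mult.commute)

lemma BH_0: "0 \<in> BH" by (simp add: BH_def)

lemma BH_id: "id_blinfun \<in> BH" by (simp add: BH_def)

lemmas BH_intros = BH_compose BH_add BH_diff BH_scaleR BH_0 BH_id

lemma BH_limit:
  assumes "\<And>n. A n \<in> BH" "\<And>x. (\<lambda>n. blinfun_apply (A n) x) \<longlonglongrightarrow> blinfun_apply B x"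
  shows "B \<in> BH"
proof -
  have "blinfun_apply B (c *\<^sub>C x) = c *\<^sub>C blinfun_apply B x" for c x
  proof (rule LIMSEQ_unique[OF assms(2)])
    show "(\<lambda>n. blinfun_apply (A n) (c *\<^sub>C x)) \<longlonglongrightarrow> c *\<^sub>C blinfun_apply B x"
      using bounded_linear.tendsto[OF bounded_linear_scaleC assms(2)] assms(1)
      by (simp add: BH_def)
  qed
  then show ?thesis by (simp add: BH_def)
qed

text \<open>The real identity at \<open>\<i> *\<^sub>C x\<close> supplies the imaginary parts, by
  complex linearity of \<open>T\<close>. Self-adjointness can thus be checked with the real inner
  product.\<close>

lemma is_adjoint_iff_inner:
  assumes "T \<in> BH"
  shows "is_adjoint S T \<longleftrightarrow>
    (\<forall>x y. inner (blinfun_apply T x) y = inner x (blinfun_apply S y))"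
proof
  assume "is_adjoint S T"
  then show "\<forall>x y. inner (blinfun_apply T x) y = inner x (blinfun_apply S y)"
    by (simp add: is_adjoint_def inner_eq_Re_cinner)
next
  assume h: "\<forall>x y. inner (blinfun_apply T x) y = inner x (blinfun_apply S y)"
  show "is_adjoint S T"
    unfolding is_adjoint_def
  proof (intro allI)
    fix x y
    have "Im (cinner (blinfun_apply T x) y) = - inner (blinfun_apply T (\<i> *\<^sub>C x)) y"
      using assms by (simp add: BH_scaleC inner_imaginary_left)
    also have "\<dots> = Im (cinner x (blinfun_apply S y))"
      by (simp add: h inner_imaginary_left)
    finally show "cinner (blinfun_apply T x) y = cinner x (blinfun_apply S y)"
      using h by (simp add: complex_eq_iff flip: inner_eq_Re_cinner)
  qed
qed

lemma is_adjoint_sym: "is_adjoint S T \<Longrightarrow> is_adjoint T S"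
  unfolding is_adjoint_def by (metis cinner_commute)

subsection \<open>Orthogonal projections and adjoints\<close>

lemma inner_eq_right_iff: "(\<forall>x. inner x y = inner x z) \<longleftrightarrow> y = (z::'a::real_inner)"
proof
  assume "\<forall>x. inner x y = inner x z"
  then have "inner (y - z) (y - z) = 0" by (simp add: inner_diff_right)
  then show "y = z" by simp
qed simp

lemma inner_eq_right_imp: "(\<And>x. inner x y = inner x z) \<Longrightarrow> y = (z::'a::real_inner)"
  using inner_eq_right_iff by blast

lemma cinner_eq_right_imp: "(\<And>x. cinner x y = cinner x z) \<Longrightarrow> y = z"
  by (rule inner_eq_right_imp) (simp add: inner_eq_Re_cinner)

section \<open>Nearest points, orthogonal decomposition, Riesz representation\<close>

lemma closest_point_in_closed_subspace:
  fixes V :: "'a::{real_inner,banach} set"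
  assumes V: "subspace V" "closed V"
  obtains p where "p \<in> V" "\<And>v. v \<in> V \<Longrightarrow> norm (x - p) \<le> norm (x - v)"
proof -
  define d where "d = (INF v\<in>V. (norm (x - v))\<^sup>2)"
  have bdd: "bdd_below ((\<lambda>v. (norm (x - v))\<^sup>2) ` V)" by (rule bdd_belowI[of _ 0]) auto
  have ne: "V \<noteq> {}" using V subspace_0 by blast
  have dle: "d \<le> (norm (x - v))\<^sup>2" if "v \<in> V" for v
    unfolding d_def by (rule cINF_lower[OF bdd that])
  have "\<exists>v\<in>V. (norm (x - v))\<^sup>2 < d + 1 / Suc n" for n
    using cINF_less_iff[OF ne bdd, of "d + 1 / Suc n"] by (simp add: d_def)
  then obtain v where v: "v n \<in> V" "(norm (x - v n))\<^sup>2 < d + 1 / Suc n" for n by metis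
  \<comment> \<open>The midpoint of two members of the minimising sequence lies in \<open>V\<close>,
    so its squared distance from \<open>x\<close> is at least the infimum; the parallelogram law
    turns this into a Cauchy estimate.\<close>
  have close: "(norm (v m - v n))\<^sup>2 \<le> 2 / Suc m + 2 / Suc n" for m n
  proof -
    have "(1/2) *\<^sub>R (v m + v n) \<in> V"
      using v V by (simp add: subspace_add subspace_scale)
    then have "d \<le> (norm (x - (1/2) *\<^sub>R (v m + v n)))\<^sup>2" by (rule dle)
    moreover have "(norm (v m - v n))\<^sup>2 =
       2 * (norm (x - v m))\<^sup>2 + 2 * (norm (x - v n))\<^sup>2 - 4 * (norm (x - (1/2) *\<^sub>R (v m + v n)))\<^sup>2"
      by (simp add: power2_norm_eq_inner inner_diff_left inner_diff_right inner_add_left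
          inner_add_right inner_commute field_simps)
    moreover have "(norm (x - v m))\<^sup>2 < d + 1 / Suc m" "(norm (x - v n))\<^sup>2 < d + 1 / Suc n"
      using v by blast+
    ultimately show ?thesis by linarith
  qed
  have "Cauchy v"
  proof (rule metric_CauchyI)
    fix e :: real assume e: "e > 0"
    obtain N :: nat where N: "4 / e\<^sup>2 < N" using reals_Archimedean2 by blast
    have "dist (v m) (v n) < e" if "m \<ge> N" "n \<ge> N" for m n
    proof -
      have N0: "0 < real N" using N e by (smt (verit) divide_pos_pos zero_less_power)
      have "2 / Suc m \<le> 2 / real N" "2 / Suc n \<le> 2 / real N"
        using that N0 by (auto intro!: divide_left_mono)
      then have "(norm (v m - v n))\<^sup>2 \<le> 4 / N" using close[of m n] by linarith
      also have "\<dots> < e\<^sup>2" using N N0 e by (simp add: field_simps)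
      finally show ?thesis using e by (simp add: dist_norm power_less_imp_less_base)
    qed
    then show "\<exists>M. \<forall>m\<ge>M. \<forall>n\<ge>M. dist (v m) (v n) < e" by blast
  qed
  then obtain p where p: "v \<longlonglongrightarrow> p" using Cauchy_convergent_iff convergent_def by blast
  have pV: "p \<in> V" using V(2) v(1) p by (rule closed_sequentially)
  have "(norm (x - p))\<^sup>2 \<le> d"
  proof (rule LIMSEQ_le)
    show "(\<lambda>n. (norm (x - v n))\<^sup>2) \<longlonglongrightarrow> (norm (x - p))\<^sup>2" using p by (intro tendsto_intros)
    show "(\<lambda>n. d + 1 / Suc n) \<longlonglongrightarrow> d"
      using tendsto_add[OF tendsto_const LIMSEQ_inverse_real_of_nat, of d]
      by (simp add: inverse_eq_divide)
    show "\<exists>N. \<forall>n\<ge>N. (norm (x - v n))\<^sup>2 \<le> d + 1 / real (Suc n)" using v(2) less_imp_le by blast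
  qed
  then have "norm (x - p) \<le> norm (x - w)" if "w \<in> V" for w
    using dle[OF that] by (meson norm_ge_zero order_trans power2_le_imp_le)
  with pV show thesis using that by blast
qed

lemma orthogonal_decomposition:
  fixes V :: "'a::{real_inner,banach} set"
  assumes V: "subspace V" "closed V"
  obtains p where "p \<in> V" "\<And>v. v \<in> V \<Longrightarrow> inner (x - p) v = 0"
proof -
  obtain p where p: "p \<in> V" and min: "\<And>v. v \<in> V \<Longrightarrow> norm (x - p) \<le> norm (x - v)"
    using closest_point_in_closed_subspace[OF V] by blast
  have "inner (x - p) v = 0" if v: "v \<in> V" for v
  proof (cases "v = 0")
    case False
    \<comment> \<open>This \<open>t\<close> minimises the distance from \<open>x\<close> to
      \<open>p + t *\<^sub>R v\<close>; unless it is 0, it would beat the nearest point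
      \<open>p\<close>.\<close>
    define t where "t = inner (x - p) v / inner v v"
    have "p + t *\<^sub>R v \<in> V" using p v V by (simp add: subspace_add subspace_scale)
    then have "(norm (x - p))\<^sup>2 \<le> (norm (x - (p + t *\<^sub>R v)))\<^sup>2"
      using min by (simp add: power_mono)
    also have "\<dots> = (norm (x - p))\<^sup>2 - (inner (x - p) v)\<^sup>2 / inner v v"
    proof -
      have "(norm (x - (p + t *\<^sub>R v)))\<^sup>2 = (norm ((x - p) - t *\<^sub>R v))\<^sup>2"
        by (simp add: algebra_simps)
      also have "\<dots> = (norm (x - p))\<^sup>2 - 2 * t * inner (x - p) v + t * (t * inner v v)"
        unfolding power2_norm_eq_inner inner_diff_left[of "x - p" "t *\<^sub>R v"]
          inner_diff_right[of _ "x - p" "t *\<^sub>R v"]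
        by (simp add: inner_commute[of v "x - p"])
      also have "t * inner v v = inner (x - p) v" using False by (simp add: t_def)
      finally show ?thesis using False by (simp add: t_def power2_eq_square)
    qed
    finally have "(inner (x - p) v)\<^sup>2 / inner v v \<le> 0" by simp
    moreover have "inner v v > 0" using False by simp
    ultimately have "(inner (x - p) v)\<^sup>2 \<le> 0" by (simp add: divide_le_0_iff)
    then show ?thesis by simp
  qed simp
  with p show thesis using that by blast
qed

lemma riesz_representation:
  fixes f :: "'a::{real_inner,banach} \<Rightarrow> real"
  assumes f: "bounded_linear f"
  obtains z where "\<And>x. f x = inner x z"
proof (cases "\<forall>x. f x = 0")
  case True
  then show thesis using that[of 0] by simp
next
  case False
  then obtain x where x: "f x \<noteq> 0" by blast
  interpret bounded_linear f by (rule f)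
  have "subspace {v. f v = 0}" by (simp add: subspace_def add scaleR)
  moreover have "closed {v. f v = 0}"
    by (intro closed_Collect_eq linear_continuous_on f continuous_on_const)
  ultimately obtain p where p: "f p = 0" "\<And>v. f v = 0 \<Longrightarrow> inner (x - p) v = 0"
    using orthogonal_decomposition[of "{v. f v = 0}" x] by auto
  \<comment> \<open>\<open>w\<close> is orthogonal to the kernel, and every \<open>y\<close> differs
    from a multiple of \<open>w\<close> by a kernel element; hence the functional is a multiple of
    the inner product with \<open>w\<close>.\<close>
  define w where "w = x - p"
  have fw: "f w \<noteq> 0" using x p by (simp add: w_def diff)
  have w0: "w \<noteq> 0" using fw by auto
  have "f y = inner y ((f w / inner w w) *\<^sub>R w)" for y
  proof -
    have "f (y - (f y / f w) *\<^sub>R w) = 0" using fw by (simp add: diff scaleR)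
    then have "inner w (y - (f y / f w) *\<^sub>R w) = 0" using p(2) by (simp add: w_def)
    then have "inner w y = f y / f w * inner w w" by (simp add: inner_diff_right)
    then show ?thesis using fw w0 by (simp add: inner_commute field_simps)
  qed
  then show thesis using that by blast
qed

text \<open>Riesz representation is applied to the real inner product; complex linearity of the
  resulting operator is recovered from the complex adjoint identity.\<close>

lemma adjoint_exists:
  assumes T: "T \<in> BH"
  obtains S where "S \<in> BH" "is_adjoint S T"
proof -
  have "\<exists>z. \<forall>x. inner (blinfun_apply T x) y = inner x z" for y
  proof -
    have "bounded_linear (\<lambda>x. inner (blinfun_apply T x) y)"
      by (intro bounded_linear_compose[OF bounded_linear_inner_left] blinfun.bounded_linear_right)
    then show ?thesis using riesz_representation by metis
  qed
  then obtain S where S: "inner (blinfun_apply T x) y = inner x (S y)" for x y by metis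
  have "bounded_linear S"
  proof (rule bounded_linear_intro[where K = "norm T"])
    show "S (x + y) = S x + S y" for x y
      by (rule inner_eq_right_imp) (simp add: inner_add_right flip: S)
    show "S (r *\<^sub>R x) = r *\<^sub>R S x" for r x
      by (rule inner_eq_right_imp) (simp flip: S)
    show "norm (S y) \<le> norm y * norm T" for y
    proof -
      have "norm (S y) * norm (S y) = inner (blinfun_apply T (S y)) y"
        by (simp add: S flip: power2_norm_eq_inner power2_eq_square)
      also have "\<dots> \<le> norm (blinfun_apply T (S y)) * norm y" by (rule norm_cauchy_schwarz)
      also have "\<dots> \<le> norm T * norm (S y) * norm y" by (intro mult_right_mono norm_blinfun) auto
      finally show ?thesis by (cases "S y = 0") (auto simp: mult_ac)
    qed
  qed
  then have app: "blinfun_apply (Blinfun S) = S" by (rule bounded_linear_Blinfun_apply)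
  then have adj: "is_adjoint (Blinfun S) T" using T S by (simp add: is_adjoint_iff_inner)
  have "S (c *\<^sub>C x) = c *\<^sub>C S x" for c x
  proof -
    have "cinner z (S (c *\<^sub>C x)) = cinner z (c *\<^sub>C S x)" for z
      using adj[unfolded is_adjoint_def app, rule_format, of z "c *\<^sub>C x"]
        adj[unfolded is_adjoint_def app, rule_format, of z x]
      by (simp add: cinner_scaleC_right)
    then show ?thesis by (rule cinner_eq_right_imp)
  qed
  then have "Blinfun S \<in> BH" by (simp add: BH_def app)
  with adj show thesis using that by blast
qed

text \<open>Separate from \<open>projections_in\<close>: projections arise from closed subspaces and
  spectral splittings first, and their membership in the masa is shown afterwards.\<close>

definition orth_proj :: "('a::chilbert_space \<Rightarrow>\<^sub>L 'a) \<Rightarrow> bool"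
  where "orth_proj P \<longleftrightarrow> P \<in> BH \<and> P o\<^sub>L P = P \<and> is_adjoint P P"

lemma orth_projD:
  assumes "orth_proj P"
  shows "P \<in> BH" "blinfun_apply P (blinfun_apply P x) = blinfun_apply P x"
    "inner (blinfun_apply P x) y = inner x (blinfun_apply P y)"
    "cinner (blinfun_apply P x) y = cinner x (blinfun_apply P y)"
proof -
  show "P \<in> BH" using assms by (simp add: orth_proj_def)
  show "blinfun_apply P (blinfun_apply P x) = blinfun_apply P x"
    using assms unfolding orth_proj_def by (metis blinfun_apply_blinfun_compose)
  show 4: "cinner (blinfun_apply P x) y = cinner x (blinfun_apply P y)"
    using assms by (simp add: orth_proj_def is_adjoint_def)
  then show "inner (blinfun_apply P x) y = inner x (blinfun_apply P y)"
    by (simp add: inner_eq_Re_cinner)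
qed

lemma orth_projI:
  assumes "P \<in> BH" "\<And>x. blinfun_apply P (blinfun_apply P x) = blinfun_apply P x"
    "\<And>x y. inner (blinfun_apply P x) y = inner x (blinfun_apply P y)"
  shows "orth_proj P"
  using assms by (auto simp: orth_proj_def is_adjoint_iff_inner intro!: blinfun_eqI)

lemma orth_proj_pythagoras:
  assumes "orth_proj P"
  shows "(norm x)\<^sup>2 = (norm (blinfun_apply P x))\<^sup>2 + (norm (x - blinfun_apply P x))\<^sup>2"
  by (simp add: power2_norm_eq_inner inner_diff_left inner_diff_right orth_projD[OF assms])

lemma orth_proj_norm_le:
  assumes "orth_proj P"
  shows "norm (blinfun_apply P x) \<le> norm x"
proof (rule power2_le_imp_le)
  show "(norm (blinfun_apply P x))\<^sup>2 \<le> (norm x)\<^sup>2"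
    unfolding orth_proj_pythagoras[OF assms, of x] by simp
qed simp

lemma orth_proj_exists:
  fixes V :: "'a::chilbert_space set"
  assumes V: "complex_vector.subspace V" "closed V"
  shows "\<exists>P. orth_proj P \<and> range (blinfun_apply P) = V \<and> (\<forall>x. blinfun_apply P x = x \<longleftrightarrow> x \<in> V) \<and>
    (\<forall>x. \<forall>v\<in>V. inner (x - blinfun_apply P x) v = 0)"
proof -
  have sub: "subspace V" using V complex_subspace_imp_subspace by blast
  have "\<exists>p. p \<in> V \<and> (\<forall>v\<in>V. inner (x - p) v = 0)" for x
    using orthogonal_decomposition[OF sub V(2), of x] by metis
  then obtain p where p: "p x \<in> V" "v \<in> V \<Longrightarrow> inner (x - p x) v = 0" for x v by metis
  \<comment> \<open>Additivity and homogeneity follow by checking this characterisation for the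
    candidate value.\<close>
  have uniq: "p x = q" if "q \<in> V" "\<And>v. v \<in> V \<Longrightarrow> inner (x - q) v = 0" for x q
  proof -
    have "p x - q \<in> V" using p that sub by (simp add: subspace_diff)
    then have "inner (x - q) (p x - q) - inner (x - p x) (p x - q) = 0" using that p by simp
    then have "inner (p x - q) (p x - q) = 0" by (simp add: inner_diff_left)
    then show ?thesis by simp
  qed
  have fixp: "p x = x \<longleftrightarrow> x \<in> V" for x using uniq[of x x] p(1)[of x] by auto
  have add: "p (x + y) = p x + p y" for x y
  proof (rule uniq)
    show "p x + p y \<in> V" using p sub by (simp add: subspace_add)
    show "inner (x + y - (p x + p y)) v = 0" if "v \<in> V" for v
      using p(2)[OF that, of x] p(2)[OF that, of y] by (simp add: inner_diff_left inner_add_left)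
  qed
  have scC: "p (c *\<^sub>C x) = c *\<^sub>C p x" for c x
  proof (rule uniq)
    show "c *\<^sub>C p x \<in> V" using p V by (simp add: complex_vector.subspace_scale)
    fix v assume v: "v \<in> V"
    have "inner (c *\<^sub>C x - c *\<^sub>C p x) v = inner (x - p x) (cnj c *\<^sub>C v)"
      by (simp add: inner_eq_Re_cinner cinner_scaleC_left cinner_scaleC_right
          flip: complex_vector.scale_right_diff_distrib)
    also have "\<dots> = 0" using p v V by (simp add: complex_vector.subspace_scale)
    finally show "inner (c *\<^sub>C x - c *\<^sub>C p x) v = 0" .
  qed
  have sa: "inner (p x) y = inner x (p y)" for x y
    using p(2)[OF p(1), of x y] p(2)[OF p(1), of y x] inner_commute[of x "p y"] inner_commute[of y "p x"]
      inner_commute[of "p x" "p y"]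
    by (simp add: inner_diff_left)
  have "bounded_linear p"
  proof (rule bounded_linear_intro[where K = 1])
    show "p (x + y) = p x + p y" for x y by (rule add)
    show "p (r *\<^sub>R x) = r *\<^sub>R p x" for r x by (simp add: scC scaleR_scaleC)
    have "(norm x)\<^sup>2 = (norm (p x))\<^sup>2 + (norm (x - p x))\<^sup>2" for x
      using p(2)[OF p(1), of x x]
      by (simp add: power2_norm_eq_inner inner_diff_left inner_diff_right inner_commute)
    then show "norm (p x) \<le> norm x * 1" for x
      by (metis le_add_same_cancel1 mult.right_neutral norm_ge_zero power2_le_imp_le zero_le_power2)
  qed
  then have app: "blinfun_apply (Blinfun p) = p" by (rule bounded_linear_Blinfun_apply)
  show ?thesis
  proof (intro exI[of _ "Blinfun p"] conjI allI ballI)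
    show "orth_proj (Blinfun p)"
      by (rule orth_projI) (auto simp: app BH_def scC sa fixp p)
    show "range (blinfun_apply (Blinfun p)) = V" unfolding app
    proof (intro equalityI subsetI)
      show "x \<in> V" if "x \<in> range p" for x using that p(1) by blast
      show "x \<in> range p" if "x \<in> V" for x
        by (rule range_eqI[of _ _ x]) (use fixp[of x] that in simp)
    qed
    show "blinfun_apply (Blinfun p) x = x \<longleftrightarrow> x \<in> V" for x by (simp add: app fixp)
    show "inner (x - blinfun_apply (Blinfun p) x) v = 0" if "v \<in> V" for x v
      using p that by (simp add: app)
  qed
qed

text \<open>Invariance of the range under \<open>B\<close> gives \<open>P B P = B P\<close>;
  invariance under the adjoint \<open>C\<close> gives, after taking adjoints,
  \<open>P B P = P B\<close>.\<close>

lemma orth_proj_commute: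
  assumes P: "orth_proj P" and adj: "\<And>x y. inner (blinfun_apply B x) y = inner x (blinfun_apply C y)"
    and B: "\<And>x. blinfun_apply P x = x \<Longrightarrow> blinfun_apply P (blinfun_apply B x) = blinfun_apply B x"
    and C: "\<And>x. blinfun_apply P x = x \<Longrightarrow> blinfun_apply P (blinfun_apply C x) = blinfun_apply C x"
  shows "blinfun_apply B (blinfun_apply P x) = blinfun_apply P (blinfun_apply B x)"
proof -
  note P' = orth_projD[OF P]
  have 1: "blinfun_apply P (blinfun_apply B (blinfun_apply P x)) = blinfun_apply B (blinfun_apply P x)" for x
    using B P' by blast
  have 2: "blinfun_apply P (blinfun_apply C (blinfun_apply P x)) = blinfun_apply C (blinfun_apply P x)" for x
    using C P' by blast
  have "blinfun_apply P (blinfun_apply B (blinfun_apply P x)) = blinfun_apply P (blinfun_apply B x)"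
  proof (rule inner_eq_right_imp)
    fix y
    have "inner y (blinfun_apply P (blinfun_apply B (blinfun_apply P x))) =
        inner (blinfun_apply B (blinfun_apply P x)) (blinfun_apply P y)"
      by (metis P'(3) inner_commute)
    also have "\<dots> = inner x (blinfun_apply P (blinfun_apply C (blinfun_apply P y)))"
      unfolding adj P'(3) ..
    also have "\<dots> = inner (blinfun_apply B x) (blinfun_apply P y)" unfolding adj 2 ..
    also have "\<dots> = inner y (blinfun_apply P (blinfun_apply B x))"
      by (metis P'(3) inner_commute)
    finally show "inner y (blinfun_apply P (blinfun_apply B (blinfun_apply P x))) =
        inner y (blinfun_apply P (blinfun_apply B x))" .
  qed
  then show ?thesis using 1 by simp
qed

subsection \<open>Spectral splitting of self-adjoint operators\<close>

lemma blinfun_commute_iff: "A o\<^sub>L B = B o\<^sub>L A \<longleftrightarrow> (\<forall>x. A (B x) = B (A x))"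
  by (metis blinfun_apply_blinfun_compose blinfun_eqI)

text \<open>The iteration for the fixed point \<open>Y = 1 - sqrt (1 - B)\<close> of \<open>Y = (B + Y\<^sup>2) / 2\<close>; it is
  dominated in norm by the scalar iteration with \<open>B = 1\<close>.\<close>

fun sqrt_iter :: "('a::real_normed_vector \<Rightarrow>\<^sub>L 'a) \<Rightarrow> nat \<Rightarrow> 'a \<Rightarrow>\<^sub>L 'a" where
  "sqrt_iter B 0 = 0"
| "sqrt_iter B (Suc n) = (1/2) *\<^sub>R (B + (sqrt_iter B n o\<^sub>L sqrt_iter B n))"

fun sqrt_bound :: "nat \<Rightarrow> real" where
  "sqrt_bound 0 = 0"
| "sqrt_bound (Suc n) = (1 + sqrt_bound n * sqrt_bound n) / 2"

lemma sqrt_bound_range: "0 \<le> sqrt_bound n \<and> sqrt_bound n \<le> 1"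
proof (induction n)
  case (Suc n)
  then have "sqrt_bound n * sqrt_bound n \<le> 1 * 1" by (intro mult_mono) auto
  with Suc show ?case by simp
qed simp

lemma sqrt_bound_Suc: "sqrt_bound n \<le> sqrt_bound (Suc n)"
proof -
  have "0 \<le> (1 - sqrt_bound n)\<^sup>2" by simp
  then show ?thesis by (simp add: power2_eq_square algebra_simps)
qed

lemma sqrt_iter_commute:
  fixes B C :: "'a::real_normed_vector \<Rightarrow>\<^sub>L 'a"
  assumes "\<And>x. C (B x) = B (C x)"
  shows "C (sqrt_iter B n x) = sqrt_iter B n (C x)"
  by (induction n arbitrary: x) (simp_all add: blinfun.bilinear_simps assms)

lemma sqrt_iter_commute_self: "sqrt_iter B m (sqrt_iter B n x) = sqrt_iter B n (sqrt_iter B m x)"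
  by (intro sqrt_iter_commute sqrt_iter_commute[symmetric]) simp

lemma norm_sqrt_iter:
  assumes "norm B \<le> 1"
  shows "norm (sqrt_iter B n) \<le> sqrt_bound n"
proof (induction n)
  case (Suc n)
  have "norm (sqrt_iter B n o\<^sub>L sqrt_iter B n) \<le> sqrt_bound n * sqrt_bound n"
    by (rule order_trans[OF norm_blinfun_compose]) (intro mult_mono Suc, auto simp: sqrt_bound_range)
  then have "norm (B + (sqrt_iter B n o\<^sub>L sqrt_iter B n)) \<le> 1 + sqrt_bound n * sqrt_bound n"
    using assms norm_triangle_ineq by (smt (verit))
  then show ?case by simp
qed simp

text \<open>The iterates commute, so a difference of two squares factors as difference times sum;
  each increment is dominated by the corresponding scalar increment.\<close>

lemma norm_sqrt_iter_diff:
  fixes B :: "'a::real_normed_vector \<Rightarrow>\<^sub>L 'a"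
  assumes "norm B \<le> 1"
  shows "norm (sqrt_iter B (Suc n) - sqrt_iter B n) \<le> sqrt_bound (Suc n) - sqrt_bound n"
proof (induction n)
  case (Suc n)
  let ?Y = "sqrt_iter B" and ?y = sqrt_bound
  have "(1/2) *\<^sub>R (B + (Z o\<^sub>L Z)) - (1/2) *\<^sub>R (B + (W o\<^sub>L W)) = (1/2) *\<^sub>R ((Z - W) o\<^sub>L (Z + W))"
    if "\<And>x. Z (W x) = W (Z x)" for Z W :: "'a \<Rightarrow>\<^sub>L 'a"
    by (rule blinfun_eqI) (simp add: blinfun.bilinear_simps algebra_simps that)
  from this[of "?Y (Suc n)" "?Y n", OF sqrt_iter_commute_self]
  have "?Y (Suc (Suc n)) - ?Y (Suc n) = (1/2) *\<^sub>R ((?Y (Suc n) - ?Y n) o\<^sub>L (?Y (Suc n) + ?Y n))"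
    by (simp only: sqrt_iter.simps(2)[of B "Suc n"] sqrt_iter.simps(2)[of B n, symmetric])
  moreover have "norm ((?Y (Suc n) - ?Y n) o\<^sub>L (?Y (Suc n) + ?Y n)) \<le>
      (?y (Suc n) - ?y n) * (?y (Suc n) + ?y n)"
  proof (rule order_trans[OF norm_blinfun_compose], intro mult_mono Suc)
    show "norm (?Y (Suc n) + ?Y n) \<le> ?y (Suc n) + ?y n"
      using norm_sqrt_iter[OF assms] norm_triangle_ineq by (meson add_mono order_trans)
  qed (use sqrt_bound_Suc[of n] in \<open>auto simp del: sqrt_bound.simps\<close>)
  moreover have "(?y (Suc n) - ?y n) * (?y (Suc n) + ?y n) / 2 = ?y (Suc (Suc n)) - ?y (Suc n)"
    by (simp add: field_simps)
  ultimately show ?case by (simp del: sqrt_iter.simps sqrt_bound.simps)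
qed (use assms in simp)

text \<open>The scalar increments are nonnegative and telescope to at most 1, so the operator
  increments are summable.\<close>

lemma sqrt_iter_convergent:
  fixes B :: "'a::banach \<Rightarrow>\<^sub>L 'a"
  assumes "norm B \<le> 1"
  obtains Y where "sqrt_iter B \<longlonglongrightarrow> Y" "norm Y \<le> 1" "Y = (1/2) *\<^sub>R (B + (Y o\<^sub>L Y))"
proof -
  have "summable (\<lambda>n. sqrt_bound (Suc n) - sqrt_bound n)"
  proof (rule bounded_imp_summable)
    show "0 \<le> sqrt_bound (Suc n) - sqrt_bound n" for n
      using sqrt_bound_Suc[of n] by linarith
    show "(\<Sum>k\<le>n. sqrt_bound (Suc k) - sqrt_bound k) \<le> 1" for n
      using sqrt_bound_range[of "Suc n"]
      by (simp only: lessThan_Suc_atMost[symmetric] sum_lessThan_telescope) simp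
  qed
  then have "summable (\<lambda>n. sqrt_iter B (Suc n) - sqrt_iter B n)"
    by (rule summable_comparison_test'[where N = 0]) (rule norm_sqrt_iter_diff[OF assms])
  then have "convergent (\<lambda>n. \<Sum>k<n. sqrt_iter B (Suc k) - sqrt_iter B k)"
    by (simp only: summable_iff_convergent)
  then have "convergent (sqrt_iter B)"
    by (simp only: sum_lessThan_telescope) simp
  then obtain Y where Y: "sqrt_iter B \<longlonglongrightarrow> Y" by (auto simp: convergent_def)
  have le1: "norm (sqrt_iter B n) \<le> 1" for n
    using norm_sqrt_iter[OF assms] sqrt_bound_range order_trans by blast
  show thesis
  proof (rule that[OF Y])
    show "norm Y \<le> 1"
      by (rule LIMSEQ_le_const2[OF tendsto_norm[OF Y]]) (use le1 in blast)
    have "(\<lambda>n. sqrt_iter B (Suc n)) \<longlonglongrightarrow> (1/2) *\<^sub>R (B + (Y o\<^sub>L Y))"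
      unfolding sqrt_iter.simps
      by (intro tendsto_intros bounded_bilinear.tendsto[OF bounded_bilinear_blinfun_compose] Y)
    moreover have "(\<lambda>n. sqrt_iter B (Suc n)) \<longlonglongrightarrow> Y" using Y by (rule LIMSEQ_Suc)
    ultimately show "Y = (1/2) *\<^sub>R (B + (Y o\<^sub>L Y))" using LIMSEQ_unique by blast
  qed
qed

lemma tendsto_blinfun_apply:
  assumes "Y \<longlonglongrightarrow> (Z::'a::real_normed_vector \<Rightarrow>\<^sub>L 'b::real_normed_vector)"
  shows "(\<lambda>n. blinfun_apply (Y n) x) \<longlonglongrightarrow> blinfun_apply Z x"
  using assms by (intro blinfun.tendsto tendsto_const)

lemma BH_sqrt_iter: "B \<in> BH \<Longrightarrow> sqrt_iter B n \<in> BH"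
  by (induction n) (auto intro!: BH_intros simp del: scaleR_blinfun.rep_eq)

text \<open>\<open>S\<close> is the absolute value of \<open>A\<close>. With
  \<open>B = 1 - A\<^sup>2\<close> the fixed point \<open>Y\<close> satisfies
  \<open>(1 - Y)\<^sup>2 = 1 - B = A\<^sup>2\<close>, and \<open>norm Y \<le> 1\<close> makes
  \<open>1 - Y\<close> positive. Whatever commutes with \<open>A\<close> commutes with all iterates
  and hence with the limit.\<close>

lemma abs_operator_exists:
  fixes A :: "'a::chilbert_space \<Rightarrow>\<^sub>L 'a"
  assumes A: "A \<in> BH" and sa: "\<And>x y. inner (A x) y = inner x (A y)" and "norm A \<le> 1"
  shows "\<exists>S\<in>BH. (\<forall>x y. inner (S x) y = inner x (S y)) \<and> (\<forall>x. S (S x) = A (A x)) \<and>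
    (\<forall>x. inner (S x) x \<ge> 0) \<and>
    (\<forall>C :: 'a \<Rightarrow>\<^sub>L 'a. (\<forall>x. C (A x) = A (C x)) \<longrightarrow> (\<forall>x. C (S x) = S (C x)))"
proof -
  define B where "B = id_blinfun - (A o\<^sub>L A)"
  have "norm (B x) \<le> norm x" for x
  proof (rule power2_le_imp_le)
    have Ale: "norm (A z) \<le> norm z" for z
      using order_trans[OF norm_blinfun[of A z] mult_right_mono[OF assms(3) norm_ge_zero]] by simp
    have "(norm (B x))\<^sup>2 = (norm x)\<^sup>2 - 2 * (norm (A x))\<^sup>2 + (norm (A (A x)))\<^sup>2"
    proof -
      have "B x = x - A (A x)" by (simp add: B_def blinfun.bilinear_simps)
      moreover have "inner (A x) (A x) = inner x (A (A x))" "inner (A (A x)) x = inner x (A (A x))"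
        by (simp_all only: sa)
      ultimately show ?thesis
        unfolding power2_norm_eq_inner by (simp only: inner_diff_left inner_diff_right)
    qed
    also have "\<dots> \<le> (norm x)\<^sup>2"
      using power_mono[OF Ale[of "A x"] norm_ge_zero, of 2] zero_le_power2[of "norm (A x)"] by linarith
    finally show "(norm (B x))\<^sup>2 \<le> (norm x)\<^sup>2" .
  qed simp
  then have "norm B \<le> 1" by (intro norm_blinfun_bound) auto
  then obtain Y where Y: "sqrt_iter B \<longlonglongrightarrow> Y" "norm Y \<le> 1" "Y = (1/2) *\<^sub>R (B + (Y o\<^sub>L Y))"
    using sqrt_iter_convergent by blast
  have Bsa: "inner (B x) y = inner x (B y)" for x y
    by (simp add: B_def blinfun.bilinear_simps inner_diff_left inner_diff_right sa)
  have iter_sa: "inner (sqrt_iter B n x) y = inner x (sqrt_iter B n y)" for n x y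
    by (induction n arbitrary: x y)
      (simp_all add: blinfun.bilinear_simps inner_add_left inner_add_right Bsa)
  have Ysa: "inner (Y x) y = inner x (Y y)" for x y
  proof (rule LIMSEQ_unique)
    show "(\<lambda>n. inner (sqrt_iter B n x) y) \<longlonglongrightarrow> inner (Y x) y"
      by (intro tendsto_inner tendsto_blinfun_apply Y(1) tendsto_const)
    show "(\<lambda>n. inner (sqrt_iter B n x) y) \<longlonglongrightarrow> inner x (Y y)"
      unfolding iter_sa by (intro tendsto_inner tendsto_blinfun_apply Y(1) tendsto_const)
  qed
  have YY: "Y (Y x) = 2 *\<^sub>R Y x - B x" for x
  proof -
    have "2 *\<^sub>R Y = B + (Y o\<^sub>L Y)" using arg_cong[OF Y(3), of "\<lambda>Z. 2 *\<^sub>R Z"] by simp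
    then have "(2 *\<^sub>R Y) x = (B + (Y o\<^sub>L Y)) x" by (rule arg_cong)
    then show ?thesis by (simp add: blinfun.bilinear_simps)
  qed
  show ?thesis
  proof (intro bexI[of _ "id_blinfun - Y"] conjI allI impI)
    have "B \<in> BH" unfolding B_def using A by (intro BH_intros)
    then have "Y \<in> BH"
      by (rule BH_limit[of "sqrt_iter B", OF BH_sqrt_iter]) (rule tendsto_blinfun_apply[OF Y(1)])
    then show "id_blinfun - Y \<in> BH" by (intro BH_intros)
    show "inner ((id_blinfun - Y) x) y = inner x ((id_blinfun - Y) y)" for x y
      by (simp add: blinfun.bilinear_simps inner_diff_left inner_diff_right Ysa)
    show "(id_blinfun - Y) ((id_blinfun - Y) x) = A (A x)" for x
      by (simp add: blinfun.bilinear_simps YY) (simp add: B_def blinfun.bilinear_simps scaleR_2)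
    show "inner ((id_blinfun - Y) x) x \<ge> 0" for x
    proof -
      have "inner (Y x) x \<le> norm (Y x) * norm x" by (rule norm_cauchy_schwarz)
      also have "\<dots> \<le> (1 * norm x) * norm x"
        by (rule mult_right_mono[OF order_trans[OF norm_blinfun mult_right_mono[OF Y(2)]]]) auto
      finally show ?thesis
        by (simp add: blinfun.bilinear_simps inner_diff_left dot_square_norm power2_eq_square)
    qed
    show "C ((id_blinfun - Y) x) = (id_blinfun - Y) (C x)" if "\<forall>x. C (A x) = A (C x)" for C :: "'a \<Rightarrow>\<^sub>L 'a" and x
    proof -
      have comm: "C (sqrt_iter B n x) = sqrt_iter B n (C x)" for n
        by (rule sqrt_iter_commute) (simp add: B_def blinfun.bilinear_simps that)
      have "C (Y x) = Y (C x)"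
      proof (rule LIMSEQ_unique)
        show "(\<lambda>n. C (sqrt_iter B n x)) \<longlonglongrightarrow> C (Y x)"
          by (intro blinfun.tendsto tendsto_const Y(1))
        show "(\<lambda>n. C (sqrt_iter B n x)) \<longlonglongrightarrow> Y (C x)"
          unfolding comm by (intro tendsto_blinfun_apply Y(1))
      qed
      then show ?thesis by (simp add: blinfun.bilinear_simps)
    qed
  qed
qed

text \<open>\<open>E\<close> projects onto the kernel of \<open>A' - S\<close>, where
  \<open>S\<close> is the absolute value of the rescaled operator \<open>A'\<close>. On the kernel
  \<open>A' = S\<close> is positive. Since \<open>(A' - S) (A' + S) = 0\<close>, vectors orthogonal
  to the kernel satisfy \<open>A' x = - S x\<close>.\<close>

lemma spectral_split:
  fixes A :: "'a::chilbert_space \<Rightarrow>\<^sub>L 'a"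
  assumes A: "A \<in> BH" and sa: "\<And>x y. inner (A x) y = inner x (A y)"
  shows "\<exists>E. orth_proj E \<and> (\<forall>x. E x = x \<longrightarrow> inner (A x) x \<ge> 0) \<and> (\<forall>x. E x = 0 \<longrightarrow> inner (A x) x \<le> 0) \<and>
    (\<forall>C\<in>BH. (\<forall>x. C (A x) = A (C x)) \<longrightarrow> (\<forall>x. C (E x) = E (C x)))"
proof -
  \<comment> \<open>The square root construction requires a contraction; the added 1 also covers
    \<open>A = 0\<close>.\<close>
  define r where "r = 1 / (norm A + 1)"
  have r: "r > 0" by (simp add: r_def add_nonneg_pos)
  define A' where "A' = r *\<^sub>R A"
  have A'app: "A' x = r *\<^sub>R A x" for x by (simp add: A'_def blinfun.bilinear_simps)
  have "norm A + 1 > 0" by (simp add: add_nonneg_pos)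
  then have nA': "norm A' \<le> 1" by (simp add: A'_def r_def divide_le_eq)
  have A'BH: "A' \<in> BH" unfolding A'_def using A by (intro BH_intros)
  have A'sa: "inner (A' x) y = inner x (A' y)" for x y by (simp add: A'app sa)
  obtain S where S: "S \<in> BH" "\<And>x y. inner (S x) y = inner x (S y)"
      "\<And>x. S (S x) = A' (A' x)" "\<And>x. inner (S x) x \<ge> 0"
      "\<And>(C :: 'a \<Rightarrow>\<^sub>L 'a) x. (\<And>x. C (A' x) = A' (C x)) \<Longrightarrow> C (S x) = S (C x)"
    using abs_operator_exists[OF A'BH A'sa nA'] by blast
  have sub: "complex_vector.subspace {x. A' x - S x = 0}"
    using A'BH S(1) by (auto simp: complex_vector.subspace_def BH_scaleC blinfun.bilinear_simps)
  have cl: "closed {x. A' x - S x = 0}"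
    by (intro closed_Collect_eq continuous_intros)
  obtain E where E1: "orth_proj E" "\<forall>x. E x = x \<longleftrightarrow> x \<in> {x. A' x - S x = 0}"
      "\<forall>x. \<forall>v\<in>{x. A' x - S x = 0}. inner (x - E x) v = 0"
    using orth_proj_exists[OF sub cl] by blast
  then have E: "orth_proj E" "E x = x \<longleftrightarrow> A' x - S x = 0"
      "A' v - S v = 0 \<Longrightarrow> inner (x - E x) v = 0" for x v by simp_all
  show ?thesis
  proof (intro exI[of _ E] conjI allI ballI impI E(1))
    show "inner (A x) x \<ge> 0" if "E x = x" for x
    proof -
      have "A' x = S x" using that E(2) by simp
      then have "r * inner (A x) x \<ge> 0" using S(4)[of x] by (simp add: A'app flip: inner_scaleR_left)
      then show ?thesis using r by (simp add: zero_le_mult_iff)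
    qed
    show "inner (A x) x \<le> 0" if "E x = 0" for x
    proof -
      have AS: "A' (S z) = S (A' z)" for z by (rule S(5)) simp
      have "inner x (A' z + S z) = 0" for z
        using E(3)[of "A' z + S z" x] that by (simp add: blinfun.bilinear_simps S(3) AS)
      then have "inner (A' x + S x) z = inner 0 z" for z
        by (simp add: inner_add_left inner_add_right A'sa S(2))
      from this[of "A' x + S x"] have "A' x = - S x" by (simp add: eq_neg_iff_add_eq_0)
      then have "r * inner (A x) x \<le> 0" using S(4)[of x] by (simp add: A'app flip: inner_scaleR_left)
      then show ?thesis using r by (simp add: mult_le_0_iff)
    qed
    show "C (E x) = E (C x)" if "C \<in> BH" "\<forall>x. C (A x) = A (C x)" for C :: "'a \<Rightarrow>\<^sub>L 'a" and x
    proof -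
      have C: "C \<in> BH" "\<And>x. C (A x) = A (C x)" using that by blast+
    \<comment> \<open>The kernel is invariant under \<open>C\<close> and under its adjoint, so it
      reduces \<open>C\<close>.\<close>
    obtain C' where C': "C' \<in> BH" "is_adjoint C' C" using adjoint_exists[OF C(1)] by blast
    have adj: "inner (C x) y = inner x (C' y)" for x y using C' C(1) is_adjoint_iff_inner by blast
    have CA: "C (A' x) = A' (C x)" for x by (simp add: A'app blinfun.bilinear_simps C(2))
    have C'A: "C' (A' x) = A' (C' x)" for x
    proof (rule inner_eq_right_imp)
      show "inner y (C' (A' x)) = inner y (A' (C' x))" for y
        unfolding adj[symmetric] A'sa[symmetric] CA ..
    qed
    show ?thesis
    proof (rule orth_proj_commute[OF E(1) adj])
      show "E (C x) = C x" if "E x = x" for x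
        using that CA[of x] S(5)[OF CA, of x] by (simp add: E(2))
      show "E (C' x) = C' x" if "E x = x" for x
        using that C'A[of x] S(5)[OF C'A, of x] by (simp add: E(2))
    qed
    qed
  qed
qed

text \<open>For symmetric operators the norm is bounded by the numerical radius, and this localises
  to an invariant subspace.\<close>

lemma symmetric_norm_bound:
  fixes B :: "'a::real_inner \<Rightarrow>\<^sub>L 'a"
  assumes V: "subspace V" "\<And>v. v \<in> V \<Longrightarrow> B v \<in> V"
    and sa: "\<And>x y. inner (B x) y = inner x (B y)"
    and bd: "\<And>v. v \<in> V \<Longrightarrow> \<bar>inner (B v) v\<bar> \<le> m * (norm v)\<^sup>2" and v: "v \<in> V"
  shows "norm (B v) \<le> m * norm v"
proof (cases "B v = 0 \<or> v = 0")
  case True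
  show ?thesis
  proof (cases "v = 0")
    case False
    then have "0 \<le> m" using bd[OF v] True by (simp add: zero_le_mult_iff)
    then show ?thesis using True False by simp
  qed (simp add: blinfun.zero_right)
next
  case False
  have par: "(norm (a + b))\<^sup>2 + (norm (a - b))\<^sup>2 = 2 * (norm a)\<^sup>2 + 2 * (norm b)\<^sup>2" for a b :: 'a
    unfolding power2_norm_eq_inner
    by (simp add: inner_add_left inner_add_right inner_diff_left inner_diff_right)
  \<comment> \<open>\<open>B v\<close> is rescaled to the length of \<open>v\<close>, which makes
    polarisation and the parallelogram law balance.\<close>
  define y where "y = (norm v / norm (B v)) *\<^sub>R B v"
  have ny: "norm y = norm v" using False by (simp add: y_def)
  have yV: "y \<in> V" unfolding y_def using V v by (intro subspace_scale) auto
  have vy: "v + y \<in> V" "v - y \<in> V" using subspace_add[OF V(1) v yV] subspace_diff[OF V(1) v yV] by auto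
  have "inner (B y) v = inner (B v) y" unfolding sa[of y v] by (rule inner_commute)
  then have "4 * inner (B v) y = inner (B (v + y)) (v + y) - inner (B (v - y)) (v - y)"
    by (simp add: blinfun.add_right blinfun.diff_right inner_add_left inner_add_right inner_diff_left inner_diff_right)
  also have "\<dots> \<le> m * (norm (v + y))\<^sup>2 + m * (norm (v - y))\<^sup>2"
    using bd[OF vy(1)] bd[OF vy(2)] by linarith
  also have "\<dots> = m * (2 * (norm v)\<^sup>2 + 2 * (norm y)\<^sup>2)"
    by (simp only: par distrib_left[symmetric])
  also have "\<dots> = 4 * (m * (norm v)\<^sup>2)" by (simp add: ny)
  finally have "inner (B v) y \<le> m * (norm v)\<^sup>2" by simp
  moreover have "inner (B v) y = norm v * norm (B v)"
    using False by (simp add: y_def dot_square_norm power2_eq_square)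
  ultimately have "norm v * norm (B v) \<le> norm v * (m * norm v)"
    by (simp only: power2_eq_square mult_ac)
  moreover have "norm v > 0" using False by simp
  ultimately show ?thesis by (rule mult_left_le_imp_le)
qed

subsection \<open>Maximal abelian self-adjoint algebras\<close>

definition commutant :: "('a::chilbert_space \<Rightarrow>\<^sub>L 'a) set \<Rightarrow> ('a \<Rightarrow>\<^sub>L 'a) set"
  where "commutant S = {X \<in> BH. \<forall>A\<in>S. \<forall>x. X (A x) = A (X x)}"

lemma adjoint_commute:
  fixes Z Z' B B' :: "'a::chilbert_space \<Rightarrow>\<^sub>L 'a"
  assumes "is_adjoint Z' Z" "is_adjoint B' B" "\<And>x. Z (B' x) = B' (Z x)"
  shows "Z' (B x) = B (Z' x)"
proof (rule cinner_eq_right_imp)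
  have 1: "cinner (Z u) v = cinner u (Z' v)" for u v using assms(1) by (simp add: is_adjoint_def)
  have 2: "cinner (B' u) v = cinner u (B v)" for u v
    using is_adjoint_sym[OF assms(2)] by (simp add: is_adjoint_def)
  show "cinner w (Z' (B x)) = cinner w (B (Z' x))" for w
    unfolding 1[symmetric] 2[symmetric] assms(3) ..
qed

text \<open>Commuting members put \<open>S\<close> inside its commutant, so the bicommutant lies in
  the commutant and is abelian; closure under adjoints passes from \<open>S\<close> to the commutant
  and on to the bicommutant. This avoids building a generated algebra by hand.\<close>

lemma abelian_sa_subalgebra_bicommutant:
  fixes S :: "('a::chilbert_space \<Rightarrow>\<^sub>L 'a) set"
  assumes S: "S \<subseteq> BH" and comm: "\<And>A B x. A \<in> S \<Longrightarrow> B \<in> S \<Longrightarrow> A (B x) = B (A x)"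
    and star: "\<And>A. A \<in> S \<Longrightarrow> \<exists>B\<in>S. is_adjoint B A"
  shows "abelian_sa_subalgebra (commutant (commutant S))"
  unfolding abelian_sa_subalgebra_def
proof (intro conjI ballI allI impI)
  let ?E = "commutant (commutant S)"
  have E_BH: "X \<in> BH" if "X \<in> ?E" for X using that by (simp add: commutant_def)
  have E_comm: "X (Z x) = Z (X x)" if "X \<in> ?E" "Z \<in> commutant S" for X Z x
    using that by (simp add: commutant_def)
  have EI: "X \<in> ?E" if "X \<in> BH" "\<And>Z x. Z \<in> commutant S \<Longrightarrow> X (Z x) = Z (X x)" for X
    using that by (simp add: commutant_def)
  have "S \<subseteq> commutant S" using S comm by (auto simp: commutant_def)
  then have sub: "?E \<subseteq> commutant S" by (auto simp: commutant_def)
  show "?E \<subseteq> BH" using E_BH by blast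
  show "0 \<in> ?E" by (rule EI) (simp_all add: BH_0 blinfun.zero_right)
  show "X + Y \<in> ?E" if "X \<in> ?E" "Y \<in> ?E" for X Y
    by (rule EI) (simp_all add: BH_add E_BH that E_comm[OF that(1)] E_comm[OF that(2)] blinfun.bilinear_simps)
  show "X o\<^sub>L Y \<in> ?E" if "X \<in> ?E" "Y \<in> ?E" for X Y
    by (rule EI) (simp_all add: BH_compose E_BH that E_comm[OF that(1)] E_comm[OF that(2)])
  show "X o\<^sub>L Y = Y o\<^sub>L X" if "X \<in> ?E" "Y \<in> ?E" for X Y
    using E_comm[OF that(1), of Y] that sub by (auto simp: blinfun_commute_iff)
  show "Y \<in> ?E" if "X \<in> ?E" "Y \<in> BH" "\<forall>x. Y x = c *\<^sub>C X x" for c X Y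
  proof (rule EI[OF that(2)])
    fix Z x assume Z: "Z \<in> commutant S"
    then have "Z \<in> BH" by (simp add: commutant_def)
    then show "Y (Z x) = Z (Y x)" using that(3) E_comm[OF that(1) Z] by (simp add: BH_scaleC)
  qed
  show "\<exists>Y\<in>?E. is_adjoint Y X" if X: "X \<in> ?E" for X
  proof -
    obtain Y where Y: "Y \<in> BH" "is_adjoint Y X" using adjoint_exists[OF E_BH[OF X]] by blast
    have "Y \<in> ?E"
    proof (rule EI[OF Y(1)])
      fix Z x assume Z: "Z \<in> commutant S"
      then have ZB: "Z \<in> BH" by (simp add: commutant_def)
      obtain Z' where Z': "Z' \<in> BH" "is_adjoint Z' Z" using adjoint_exists[OF ZB] by blast
      have "Z' \<in> commutant S"
        unfolding commutant_def
      proof (intro CollectI conjI ballI allI Z'(1))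
        fix A x assume A: "A \<in> S"
        then obtain B where B: "B \<in> S" "is_adjoint B A" using star by blast
        show "Z' (A x) = A (Z' x)"
          by (rule adjoint_commute[OF Z'(2) B(2)]) (use Z B(1) in \<open>simp add: commutant_def\<close>)
      qed
      then show "Y (Z x) = Z (Y x)"
        by (intro adjoint_commute[OF Y(2) Z'(2)] E_comm[OF X])
    qed
    then show ?thesis using Y by blast
  qed
qed

lemma subset_bicommutant: "S \<subseteq> BH \<Longrightarrow> S \<subseteq> commutant (commutant S)"
  by (auto simp: commutant_def)

locale masa_algebra =
  fixes \<D> :: "('a::chilbert_space \<Rightarrow>\<^sub>L 'a) set"
  assumes masa: "masa \<D>"
begin

lemma abelian: "abelian_sa_subalgebra \<D>"
  using masa by (simp add: masa_def)

lemma D_BH: "D \<in> \<D> \<Longrightarrow> D \<in> BH"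
  using abelian unfolding abelian_sa_subalgebra_def by blast

lemma D_add: "C \<in> \<D> \<Longrightarrow> D \<in> \<D> \<Longrightarrow> C + D \<in> \<D>"
  using abelian unfolding abelian_sa_subalgebra_def by blast

lemma D_scaleC: "C \<in> \<D> \<Longrightarrow> D \<in> BH \<Longrightarrow> (\<And>x. D x = c *\<^sub>C C x) \<Longrightarrow> D \<in> \<D>"
  using abelian unfolding abelian_sa_subalgebra_def by blast

lemma D_commute: "C \<in> \<D> \<Longrightarrow> D \<in> \<D> \<Longrightarrow> C (D x) = D (C x)"
  using abelian unfolding abelian_sa_subalgebra_def blinfun_commute_iff by blast

lemma D_adjoint: "C \<in> \<D> \<Longrightarrow> \<exists>D\<in>\<D>. is_adjoint D C"
  using abelian unfolding abelian_sa_subalgebra_def by blast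

text \<open>Adjoining the self-adjoint \<open>A\<close> to the masa leaves a commuting set closed
  under adjoints; maximality identifies its bicommutant with the masa.\<close>

lemma selfadjoint_commutant_in_D:
  assumes "A \<in> BH" "is_adjoint A A" "\<And>D x. D \<in> \<D> \<Longrightarrow> A (D x) = D (A x)"
  shows "A \<in> \<D>"
proof -
  let ?S = "insert A \<D>"
  have S: "?S \<subseteq> BH" using assms(1) D_BH by blast
  have "abelian_sa_subalgebra (commutant (commutant ?S))"
    by (rule abelian_sa_subalgebra_bicommutant[OF S])
      (use assms D_commute D_adjoint in \<open>auto simp: assms(3)\<close>)
  moreover have "?S \<subseteq> commutant (commutant ?S)" by (rule subset_bicommutant[OF S])
  ultimately have "commutant (commutant ?S) = \<D>" using masa unfolding masa_def by blast
  then show ?thesis using \<open>?S \<subseteq> commutant (commutant ?S)\<close> by blast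
qed

text \<open>Up to the factors 2 and -2 these are the real and imaginary parts; the factors are dealt
  with where the operator is put together again.\<close>

lemma cartesian_decomposition:
  assumes X: "X \<in> BH" "is_adjoint Y X" "Y \<in> BH"
  shows "\<exists>A\<in>BH. \<exists>B\<in>BH. is_adjoint A A \<and> is_adjoint B B \<and>
    (\<forall>x. A x = X x + Y x) \<and> (\<forall>x. B x = \<i> *\<^sub>C (X x - Y x))"
proof -
  define B where "B = Blinfun ((*\<^sub>C) \<i>) o\<^sub>L (X - Y)"
  have B: "B x = \<i> *\<^sub>C (X x - Y x)" for x
    by (simp add: B_def bounded_linear_Blinfun_apply[OF bounded_linear_scaleC] blinfun.bilinear_simps)
  have XY: "cinner (X x) y = cinner x (Y y)" "cinner (Y x) y = cinner x (X y)" for x y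
    using X(2) is_adjoint_sym[OF X(2)] by (simp_all add: is_adjoint_def)
  show ?thesis
  proof (rule bexI[of _ "X + Y"], rule bexI[of _ B], intro conjI allI)
    show "X + Y \<in> BH" using X by (intro BH_intros)
    show "B \<in> BH"
      using X by (simp add: BH_def B scaleC_scaleC mult.commute
          flip: complex_vector.scale_right_diff_distrib)
    show "is_adjoint (X + Y) (X + Y)"
      by (simp add: is_adjoint_def blinfun.bilinear_simps cinner_add_left cinner_add_right XY)
    show "is_adjoint B B"
      by (simp add: is_adjoint_def B cinner_scaleC_left cinner_scaleC_right cinner_diff_left
          cinner_diff_right XY algebra_simps)
    show "(X + Y) x = X x + Y x" for x by (simp add: blinfun.bilinear_simps)
    show "B x = \<i> *\<^sub>C (X x - Y x)" for x by (rule B)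
  qed
qed

text \<open>The commutant of a masa is closed under adjoints, so an operator in it splits into two
  self-adjoint parts, to which maximality applies.\<close>

lemma commutant_in_D:
  assumes X: "X \<in> BH" "\<And>D x. D \<in> \<D> \<Longrightarrow> X (D x) = D (X x)"
  shows "X \<in> \<D>"
proof -
  obtain Y where Y: "Y \<in> BH" "is_adjoint Y X" using adjoint_exists[OF X(1)] by blast
  have Yc: "Y (D x) = D (Y x)" if D: "D \<in> \<D>" for D x
  proof -
    obtain D' where "D' \<in> \<D>" "is_adjoint D' D" using D_adjoint[OF D] by blast
    then show ?thesis by (intro adjoint_commute[OF Y(2)] X(2))
  qed
  obtain A B where AB: "A \<in> BH" "B \<in> BH" "is_adjoint A A" "is_adjoint B B"
    "\<And>x. A x = X x + Y x" "\<And>x. B x = \<i> *\<^sub>C (X x - Y x)"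
    using cartesian_decomposition[OF X(1) Y(2) Y(1)] by blast
  have A: "A \<in> \<D>"
    by (rule selfadjoint_commutant_in_D[OF AB(1,3)])
      (simp add: AB(5) X(2) Yc blinfun.add_right)
  have B: "B \<in> \<D>"
    by (rule selfadjoint_commutant_in_D[OF AB(2,4)])
      (simp add: AB(6) X(2) Yc BH_scaleC[OF D_BH] blinfun.diff_right)
  \<comment> \<open>\<open>J\<close> is \<open>X - Y\<close>, so that
    \<open>A + J = 2 X\<close>.\<close>
  define J where "J = Blinfun ((*\<^sub>C) (- \<i>)) o\<^sub>L B"
  have J: "J x = (- \<i>) *\<^sub>C B x" for x
    unfolding J_def by (simp only: blinfun_apply_blinfun_compose
        bounded_linear_Blinfun_apply[OF bounded_linear_scaleC])
  have JBH: "J \<in> BH" using AB(2) by (simp add: BH_def J scaleC_scaleC mult.commute)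
  have JD: "J \<in> \<D>" by (rule D_scaleC[OF B JBH J])
  have "X x = (1/2) *\<^sub>C (A + J) x" for x
  proof -
    have "(A + J) x = 2 *\<^sub>R X x"
      by (simp add: blinfun.bilinear_simps J AB(5,6) scaleC_scaleC scaleR_2)
    then show ?thesis by (simp add: scaleR_scaleC scaleC_scaleC)
  qed
  then show ?thesis using D_scaleC[OF D_add[OF A JD] X(1)] by blast
qed

end

section \<open>The Boolean algebra of projections in a masa\<close>

context masa_algebra
begin

abbreviation PP :: "('a \<Rightarrow>\<^sub>L 'a) set" where "PP \<equiv> projections_in \<D>"

lemma id_in_D: "id_blinfun \<in> \<D>"
  by (rule commutant_in_D) (simp_all add: BH_id)

lemma diff_in_D: "C \<in> \<D> \<Longrightarrow> D \<in> \<D> \<Longrightarrow> C - D \<in> \<D>"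
  by (rule commutant_in_D) (auto intro: BH_diff D_BH simp: blinfun.bilinear_simps D_commute)

lemma scaleR_in_D: "D \<in> \<D> \<Longrightarrow> r *\<^sub>R D \<in> \<D>"
  by (rule commutant_in_D) (auto intro: BH_scaleR D_BH simp: blinfun.bilinear_simps D_commute)

lemma compose_in_D: "C \<in> \<D> \<Longrightarrow> D \<in> \<D> \<Longrightarrow> C o\<^sub>L D \<in> \<D>"
  by (rule commutant_in_D) (auto intro: BH_compose D_BH simp: D_commute)

lemma PP_iff: "P \<in> PP \<longleftrightarrow> P \<in> \<D> \<and> orth_proj P"
  by (auto simp: projections_in_def orth_proj_def D_BH)

lemma PP_orth_proj: "P \<in> PP \<Longrightarrow> orth_proj P" by (simp add: PP_iff)
lemma PP_in_D: "P \<in> PP \<Longrightarrow> P \<in> \<D>" by (simp add: PP_iff)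
lemma PP_BH: "P \<in> PP \<Longrightarrow> P \<in> BH" by (simp add: PP_iff D_BH)
lemma PP_idem [simp]: "P \<in> PP \<Longrightarrow> P (P x) = P x" by (simp add: PP_iff orth_projD)
lemma PP_sa: "P \<in> PP \<Longrightarrow> inner (P x) y = inner x (P y)" by (simp add: PP_iff orth_projD)
lemma PP_csa: "P \<in> PP \<Longrightarrow> cinner (P x) y = cinner x (P y)" by (simp add: PP_iff orth_projD)
lemma PP_commute: "P \<in> PP \<Longrightarrow> Q \<in> PP \<Longrightarrow> P (Q x) = Q (P x)" by (simp add: PP_iff D_commute)
lemma PP_D_commute: "P \<in> PP \<Longrightarrow> D \<in> \<D> \<Longrightarrow> P (D x) = D (P x)" by (simp add: PP_iff D_commute)

lemma PP_id: "id_blinfun \<in> PP"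
  by (auto simp: PP_iff id_in_D intro: orth_projI BH_id)

lemma PP_0: "0 \<in> PP"
  using diff_in_D[OF id_in_D id_in_D] by (auto simp: PP_iff BH_0 intro: orth_projI)

lemma PP_compl: "P \<in> PP \<Longrightarrow> id_blinfun - P \<in> PP"
  by (auto simp: PP_iff diff_in_D id_in_D D_BH blinfun.bilinear_simps orth_projD inner_diff_left
      inner_diff_right intro!: orth_projI BH_diff BH_id)

lemma PP_compose: "P \<in> PP \<Longrightarrow> Q \<in> PP \<Longrightarrow> P o\<^sub>L Q \<in> PP"
  unfolding PP_iff[of "P o\<^sub>L Q"]
  by (intro conjI compose_in_D PP_in_D orth_projI BH_compose PP_BH)
    (simp_all add: PP_sa PP_commute[of P Q])

lemma PP_add: "P \<in> PP \<Longrightarrow> Q \<in> PP \<Longrightarrow> (\<And>x. P (Q x) = 0) \<Longrightarrow> P + Q \<in> PP"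
  unfolding PP_iff[of "P + Q"]
  by (intro conjI D_add PP_in_D orth_projI BH_add PP_BH)
    (simp_all add: PP_sa PP_commute[of Q P] blinfun.bilinear_simps inner_add_left inner_add_right)

lemma PP_diff: "P \<in> PP \<Longrightarrow> Q \<in> PP \<Longrightarrow> (\<And>x. P (Q x) = Q x) \<Longrightarrow> P - Q \<in> PP"
  unfolding PP_iff[of "P - Q"]
  by (intro conjI diff_in_D PP_in_D orth_projI BH_diff PP_BH)
    (simp_all add: PP_sa PP_commute[of Q P] blinfun.bilinear_simps inner_diff_left inner_diff_right)

lemma PP_norm_le: "P \<in> PP \<Longrightarrow> norm (P x) \<le> norm x"
  by (simp add: PP_iff orth_proj_norm_le)

lemma PP_pythagoras: "P \<in> PP \<Longrightarrow> (norm x)\<^sup>2 = (norm (P x))\<^sup>2 + (norm (x - P x))\<^sup>2"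
  by (rule orth_proj_pythagoras) (simp add: PP_iff)

section \<open>Operators commuting with the projections of a masa\<close>

lemma spectral_split_in_PP:
  assumes A: "A \<in> \<D>" and sa: "\<And>x y. inner (A x) y = inner x (A y)"
  shows "\<exists>E\<in>PP. (\<forall>x. E x = x \<longrightarrow> inner (A x) x \<ge> 0) \<and> (\<forall>x. E x = 0 \<longrightarrow> inner (A x) x \<le> 0)"
proof -
  obtain E where E: "orth_proj E" "\<forall>x. E x = x \<longrightarrow> inner (A x) x \<ge> 0"
    "\<forall>x. E x = 0 \<longrightarrow> inner (A x) x \<le> 0"
    "\<forall>C\<in>BH. (\<forall>x. C (A x) = A (C x)) \<longrightarrow> (\<forall>x. C (E x) = E (C x))"
    using spectral_split[OF D_BH[OF A] sa] by blast
  have "E \<in> \<D>"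
    by (rule commutant_in_D) (use E D_BH D_commute[OF _ A] in \<open>auto simp: orth_projD\<close>)
  then show ?thesis using E by (auto simp: PP_iff)
qed

text \<open>Bisection replaces approximation by step functions of spectral projections. If the form
  of \<open>A\<close> on the range of \<open>Q\<close> varies within \<open>[a, b]\<close>, centring
  \<open>A\<close> bounds the commutator by \<open>norm X * (b - a)\<close>. Cutting at the midpoint
  halves this on both spectral pieces.\<close>

lemma commutator_bound:
  fixes A X :: "'a \<Rightarrow>\<^sub>L 'a"
  assumes A: "A \<in> \<D>" and sa: "\<And>x y. inner (A x) y = inner x (A y)"
    and X: "\<And>P x. P \<in> PP \<Longrightarrow> X (P x) = P (X x)"
    and Q: "Q \<in> PP" "\<And>v. Q v = v \<Longrightarrow> a * (norm v)\<^sup>2 \<le> inner (A v) v"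
      "\<And>v. Q v = v \<Longrightarrow> inner (A v) v \<le> b * (norm v)\<^sup>2" and "a \<le> b" and v: "Q v = v"
  shows "norm (X (A v) - A (X v)) \<le> norm X * ((b - a) / 2 ^ n) * norm v"
  using Q \<open>a \<le> b\<close> v
proof (induction n arbitrary: Q a b v)
  case 0
  \<comment> \<open>Subtracting the midpoint leaves the commutator unchanged and bounds the form by
    half the length of the interval.\<close>
  define B where "B = A - ((a + b) / 2) *\<^sub>R id_blinfun"
  have B: "B x = A x - ((a + b) / 2) *\<^sub>R x" for x by (simp add: B_def blinfun.bilinear_simps)
  have bound: "norm (B w) \<le> ((b - a) / 2) * norm w" if "Q w = w" for w
  proof (rule symmetric_norm_bound[where V = "{w. Q w = w}"])
    show "subspace {w. Q w = w}" by (simp add: subspace_def blinfun.bilinear_simps)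
    show "B w \<in> {w. Q w = w}" if "w \<in> {w. Q w = w}" for w
      using that PP_D_commute[OF 0(1) A] by (simp add: B blinfun.bilinear_simps)
    show "inner (B x) y = inner x (B y)" for x y
      by (simp add: B inner_diff_left inner_diff_right sa)
    show "\<bar>inner (B w) w\<bar> \<le> ((b - a) / 2) * (norm w)\<^sup>2" if "w \<in> {w. Q w = w}" for w
    proof -
      have "inner (B w) w = inner (A w) w - (a + b) / 2 * (norm w)\<^sup>2"
        by (simp add: B inner_diff_left power2_norm_eq_inner)
      moreover have "a * (norm w)\<^sup>2 \<le> inner (A w) w" "inner (A w) w \<le> b * (norm w)\<^sup>2"
        using 0 that by auto
      ultimately show ?thesis by (auto simp: abs_le_iff field_simps)
    qed
  qed (use that in simp)
  have Xv: "Q (X v) = X v" using X[OF 0(1), of v] 0 by simp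
  have "X (A v) - A (X v) = X (B v) - B (X v)" by (simp add: B blinfun.bilinear_simps)
  also have "norm \<dots> \<le> norm (X (B v)) + norm (B (X v))" by (rule norm_triangle_ineq4)
  also have "\<dots> \<le> norm X * ((b - a) / 2 * norm v) + (b - a) / 2 * (norm X * norm v)"
    using order_trans[OF norm_blinfun mult_left_mono[OF bound[OF \<open>Q v = v\<close>] norm_ge_zero], of X]
      order_trans[OF bound[OF Xv] mult_left_mono[OF norm_blinfun]] \<open>a \<le> b\<close>
    by (intro add_mono) auto
  also have "\<dots> = norm X * ((b - a) / 2 ^ 0) * norm v" by (simp add: field_simps)
  finally show ?case .
next
  case (Suc n)
  define c where "c = (a + b) / 2"
  have c: "a \<le> c" "c \<le> b" "c - a = (b - a) / 2" "b - c = (b - a) / 2"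
    using Suc.prems(4) by (auto simp: c_def field_simps)
  define K where "K = norm X * ((b - a) / 2 ^ Suc n)"
  have K0: "K \<ge> 0" using Suc.prems(4) by (simp add: K_def)
  have "A - c *\<^sub>R id_blinfun \<in> \<D>" by (intro diff_in_D A scaleR_in_D id_in_D)
  then obtain E where E: "E \<in> PP" "\<forall>x. E x = x \<longrightarrow> inner ((A - c *\<^sub>R id_blinfun) x) x \<ge> 0"
      "\<forall>x. E x = 0 \<longrightarrow> inner ((A - c *\<^sub>R id_blinfun) x) x \<le> 0"
    using spectral_split_in_PP[of "A - c *\<^sub>R id_blinfun"]
    by (auto simp: blinfun.bilinear_simps inner_diff_left inner_diff_right sa)
  have E1: "c * (norm w)\<^sup>2 \<le> inner (A w) w" if "E w = w" for w
    using E(2)[rule_format, OF that] by (simp add: blinfun.bilinear_simps inner_diff_left power2_norm_eq_inner)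
  have E0: "inner (A w) w \<le> c * (norm w)\<^sup>2" if "E w = 0" for w
    using E(3)[rule_format, OF that] by (simp add: blinfun.bilinear_simps inner_diff_left power2_norm_eq_inner)
  have Qv: "Q v = v" by (rule Suc.prems(5))
  have QE: "Q (E v) = E v" using PP_commute[OF Suc.prems(1) E(1), of v] Qv by simp
  have 1: "norm (X (A (E v)) - A (X (E v))) \<le> K * norm (E v)"
  proof -
    have r: "Q w = w \<and> E w = w" if "(Q o\<^sub>L E) w = w" for w
      using that PP_commute[OF Suc.prems(1) E(1), of w] PP_idem[OF E(1)] PP_idem[OF Suc.prems(1)]
      by (metis blinfun_apply_blinfun_compose)
    have "norm (X (A (E v)) - A (X (E v))) \<le> norm X * ((b - c) / 2 ^ n) * norm (E v)"
    proof (rule Suc.IH[OF PP_compose[OF Suc.prems(1) E(1)]])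
      show "c * (norm w)\<^sup>2 \<le> inner (A w) w" if "(Q o\<^sub>L E) w = w" for w using E1 r[OF that] by blast
      show "inner (A w) w \<le> b * (norm w)\<^sup>2" if "(Q o\<^sub>L E) w = w" for w using Suc.prems(3) r[OF that] by blast
      show "(Q o\<^sub>L E) (E v) = E v" using QE E(1) by simp
    qed (rule c)
    then show ?thesis by (simp add: K_def c)
  qed
  have 0: "norm (X (A (v - E v)) - A (X (v - E v))) \<le> K * norm (v - E v)"
  proof -
    have r: "Q w = w \<and> E w = 0" if "(Q o\<^sub>L (id_blinfun - E)) w = w" for w
    proof -
      have w: "Q (w - E w) = w" using that by (simp add: blinfun.bilinear_simps)
      then have "Q w = w" using PP_idem[OF Suc.prems(1), of "w - E w"] by simp
      moreover have "E w = Q (E w - E (E w))"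
        using arg_cong[OF w, of E] PP_commute[OF E(1) Suc.prems(1), of "w - E w"]
        by (simp add: blinfun.bilinear_simps)
      ultimately show ?thesis using E(1) by (simp add: blinfun.zero_right)
    qed
    have "norm (X (A (v - E v)) - A (X (v - E v))) \<le> norm X * ((c - a) / 2 ^ n) * norm (v - E v)"
    proof (rule Suc.IH[OF PP_compose[OF Suc.prems(1) PP_compl[OF E(1)]]])
      show "a * (norm w)\<^sup>2 \<le> inner (A w) w" if "(Q o\<^sub>L (id_blinfun - E)) w = w" for w
        using Suc.prems(2) r[OF that] by blast
      show "inner (A w) w \<le> c * (norm w)\<^sup>2" if "(Q o\<^sub>L (id_blinfun - E)) w = w" for w
        using E0 r[OF that] by blast
      show "(Q o\<^sub>L (id_blinfun - E)) (v - E v) = v - E v"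
        using QE E(1) Qv by (simp add: blinfun.diff_left blinfun.diff_right)
    qed (rule c)
    then show ?thesis by (simp add: K_def c)
  qed
  let ?Z = "\<lambda>w. X (A w) - A (X w)"
  have EZ: "?Z (E v) = E (?Z v)"
    by (simp add: blinfun.bilinear_simps PP_D_commute[OF E(1) A] flip: X[OF E(1)])
  moreover have "?Z (v - E v) = ?Z v - E (?Z v)"
    unfolding EZ[symmetric] by (simp add: blinfun.bilinear_simps)
  \<comment> \<open>The commutator maps the ranges of \<open>E\<close> and of its complement into
    themselves, so the estimates on the two pieces combine by Pythagoras without loss.\<close>
  ultimately have "(norm (?Z v))\<^sup>2 = (norm (?Z (E v)))\<^sup>2 + (norm (?Z (v - E v)))\<^sup>2"
    using PP_pythagoras[OF E(1), of "?Z v"] by simp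
  also have "\<dots> \<le> (K * norm (E v))\<^sup>2 + (K * norm (v - E v))\<^sup>2"
    using 1 0 by (intro add_mono power_mono) auto
  also have "\<dots> = (K * norm v)\<^sup>2"
    using PP_pythagoras[OF E(1), of v] by (simp add: power_mult_distrib flip: distrib_left)
  finally have "norm (?Z v) \<le> K * norm v"
    using K0 by (intro power2_le_imp_le[of "norm (?Z v)"]) auto
  then show ?case by (simp add: K_def)
qed

text \<open>The form of \<open>A\<close> varies within \<open>[- norm A, norm A]\<close>; letting
  the number of bisections grow sends the commutator bound to 0.\<close>

lemma PP_commutant_selfadjoint:
  fixes A X :: "'a \<Rightarrow>\<^sub>L 'a"
  assumes A: "A \<in> \<D>" and sa: "\<And>x y. inner (A x) y = inner x (A y)"
    and X: "\<And>P x. P \<in> PP \<Longrightarrow> X (P x) = P (X x)"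
  shows "X (A v) = A (X v)"
proof -
  have *: "\<bar>inner (A w) w\<bar> \<le> norm A * (norm w)\<^sup>2" for w
    using order_trans[OF Cauchy_Schwarz_ineq2 mult_right_mono[OF norm_blinfun norm_ge_zero], of A w w]
    by (simp add: power2_eq_square mult.assoc)
  have "norm (X (A v) - A (X v)) \<le> norm X * ((norm A - (- norm A)) / 2 ^ n) * norm v" for n
    using * by (intro commutator_bound[OF A sa X PP_id]) (auto simp: abs_le_iff minus_le_iff)
  then have "norm (X (A v) - A (X v)) \<le> (2 * norm X * norm A * norm v) * (1/2) ^ n" for n
    by (simp add: power_divide mult_ac)
  moreover have "(\<lambda>n. (2 * norm X * norm A * norm v) * (1/2) ^ n) \<longlonglongrightarrow> 2 * norm X * norm A * norm v * 0"
    by (intro tendsto_mult tendsto_const LIMSEQ_realpow_zero) auto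
  ultimately have "norm (X (A v) - A (X v)) \<le> 2 * norm X * norm A * norm v * 0"
    by (intro LIMSEQ_le_const) auto
  then show ?thesis by simp
qed

text \<open>Commuting with the projections passes to self-adjoint members of the masa and, through
  real and imaginary parts, to all members; a masa contains its commutant.\<close>

lemma PP_commutant_in_D:
  assumes XB: "X \<in> BH" and X: "\<And>P x. P \<in> PP \<Longrightarrow> X (P x) = P (X x)"
  shows "X \<in> \<D>"
proof (rule commutant_in_D[OF XB])
  fix D x assume D: "D \<in> \<D>"
  obtain D' where D': "D' \<in> \<D>" "is_adjoint D' D" using D_adjoint[OF D] by blast
  obtain A B where AB: "A \<in> BH" "B \<in> BH" "is_adjoint A A" "is_adjoint B B"
    "\<forall>x. A x = D x + D' x" "\<forall>x. B x = \<i> *\<^sub>C (D x - D' x)"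
    using cartesian_decomposition[OF D_BH[OF D] D'(2) D_BH[OF D'(1)]] by blast
  have A: "A \<in> \<D>"
    by (rule commutant_in_D[OF AB(1)])
      (use AB(5) D_commute D D' in \<open>auto simp: blinfun.add_right\<close>)
  have B: "B \<in> \<D>"
    by (rule commutant_in_D[OF AB(2)])
      (use AB(6) D_commute D D' in \<open>auto simp: blinfun.diff_right BH_scaleC[OF D_BH]\<close>)
  have "X (A x) = A (X x)"
    by (rule PP_commutant_selfadjoint[OF A _ X]) (use AB(1,3) is_adjoint_iff_inner in blast)
  then have 1: "X (D x) + X (D' x) = D (X x) + D' (X x)" using AB(5) by (simp add: blinfun.add_right)
  have "X (B x) = B (X x)"
    by (rule PP_commutant_selfadjoint[OF B _ X]) (use AB(2,4) is_adjoint_iff_inner in blast)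
  then have "\<i> *\<^sub>C (X (D x) - X (D' x)) = \<i> *\<^sub>C (D (X x) - D' (X x))"
    using AB(6) by (simp add: blinfun.diff_right BH_scaleC[OF XB])
  then have 2: "X (D x) - X (D' x) = D (X x) - D' (X x)"
    by (simp only: complex_vector.scale_left_imp_eq[of \<i>] complex_vector.scale_cancel_left) simp
  have "2 *\<^sub>R X (D x) = 2 *\<^sub>R D (X x)"
    using arg_cong2[OF 1 2, of "(+)"] by (simp add: scaleR_2 algebra_simps)
  then show "X (D x) = D (X x)" by simp
qed

text \<open>Projections are their own adjoints, so invariance of the range already makes it
  reducing.\<close>

lemma orth_proj_in_PP:
  assumes "orth_proj P" "\<And>Q x. Q \<in> PP \<Longrightarrow> P x = x \<Longrightarrow> P (Q x) = Q x"
  shows "P \<in> PP"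
proof -
  have "P \<in> \<D>"
  proof (rule PP_commutant_in_D)
    show "P \<in> BH" using assms(1) by (rule orth_projD)
    show "P (Q x) = Q (P x)" if Q: "Q \<in> PP" for Q x
      by (rule orth_proj_commute[OF assms(1) PP_sa[OF Q], symmetric]) (use assms(2) Q in auto)
  qed
  then show ?thesis using assms(1) by (simp add: PP_iff)
qed

end

subsection \<open>Ranks of operators\<close>

lemma finite_basis_of_complex_finite_dim:
  assumes "complex_finite_dim V"
  shows "\<exists>C\<subseteq>V. complex_vector.independent C \<and> V \<subseteq> complex_vector.span C \<and>
    finite C \<and> card C = complex_vector.dim V"
proof -
  obtain B where B: "finite B" "V \<subseteq> complex_vector.span B"
    using assms by (auto simp: complex_finite_dim_def)
  obtain C where C: "C \<subseteq> V" "complex_vector.independent C" "V \<subseteq> complex_vector.span C"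
      "card C = complex_vector.dim V"
    using complex_vector.basis_exists by blast
  have "finite C" using complex_vector.independent_span_bound[OF B(1) C(2)] B(2) C(1) by blast
  with C show ?thesis by blast
qed

text \<open>Working form of the rank: finite spanning sets take the place of the dimension and the
  case distinction in \<open>rank_op\<close>.\<close>

lemma rank_op_le_iff:
  "rank_op A \<le> enat n \<longleftrightarrow> (\<exists>B. finite B \<and> card B \<le> n \<and> range (blinfun_apply A) \<subseteq> complex_vector.span B)"
proof
  assume "rank_op A \<le> enat n"
  then have fd: "complex_finite_dim (range (blinfun_apply A))"
    and n: "complex_vector.dim (range (blinfun_apply A)) \<le> n"
    by (auto simp: rank_op_def split: if_splits)
  obtain C where "range (blinfun_apply A) \<subseteq> complex_vector.span C" "finite C"
      "card C = complex_vector.dim (range (blinfun_apply A))"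
    using finite_basis_of_complex_finite_dim[OF fd] by blast
  then show "\<exists>B. finite B \<and> card B \<le> n \<and> range (blinfun_apply A) \<subseteq> complex_vector.span B"
    using n by auto
next
  assume "\<exists>B. finite B \<and> card B \<le> n \<and> range (blinfun_apply A) \<subseteq> complex_vector.span B"
  then obtain B where B: "finite B" "card B \<le> n" "range (blinfun_apply A) \<subseteq> complex_vector.span B"
    by blast
  then have fd: "complex_finite_dim (range (blinfun_apply A))" by (auto simp: complex_finite_dim_def)
  obtain C where C: "C \<subseteq> range (blinfun_apply A)" "complex_vector.independent C"
      "card C = complex_vector.dim (range (blinfun_apply A))"
    using finite_basis_of_complex_finite_dim[OF fd] by blast
  have "card C \<le> card B" using complex_vector.independent_span_bound[OF B(1) C(2)] B(3) C(1) by blast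
  then show "rank_op A \<le> enat n" using fd C(3) B(2) by (simp add: rank_op_def)
qed

lemma rank_op_finite_iff: "rank_op A < \<infinity> \<longleftrightarrow> complex_finite_dim (range (blinfun_apply A))"
  by (simp add: rank_op_def)

lemma rank_op_mono:
  assumes "range (blinfun_apply A) \<subseteq> range (blinfun_apply B)"
  shows "rank_op A \<le> rank_op B"
proof (cases "rank_op B")
  case (enat n)
  then have "rank_op B \<le> enat n" by simp
  then have "rank_op A \<le> enat n" using assms unfolding rank_op_le_iff by blast
  then show ?thesis using enat by simp
qed simp

lemma rank_op_compose_right: "rank_op (A o\<^sub>L B) \<le> rank_op A"
  by (rule rank_op_mono) auto

lemma rank_op_compose_left:
  assumes "A \<in> BH"
  shows "rank_op (A o\<^sub>L B) \<le> rank_op B"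
proof (cases "rank_op B")
  case (enat n)
  interpret A: Vector_Spaces.linear "(*\<^sub>C)" "(*\<^sub>C)" "blinfun_apply A" by (rule BH_linear[OF assms])
  obtain S where S: "finite S" "card S \<le> n" "range (blinfun_apply B) \<subseteq> complex_vector.span S"
    using enat rank_op_le_iff[of B n] by auto
  have "range (blinfun_apply (A o\<^sub>L B)) \<subseteq> blinfun_apply A ` complex_vector.span S" using S(3) by auto
  also have "\<dots> = complex_vector.span (blinfun_apply A ` S)" by (rule A.span_image[symmetric])
  finally have "rank_op (A o\<^sub>L B) \<le> enat n"
    unfolding rank_op_le_iff using S(1) order_trans[OF card_image_le[OF S(1)] S(2)]
    by (intro exI[of _ "blinfun_apply A ` S"]) simp
  then show ?thesis using enat by simp
qed simp

lemma rank_op_add_diff: "rank_op (A + B) \<le> rank_op A + rank_op B" "rank_op (A - B) \<le> rank_op A + rank_op B"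
proof -
  have "rank_op (A + B) \<le> rank_op A + rank_op B \<and> rank_op (A - B) \<le> rank_op A + rank_op B"
  proof (cases "rank_op A = \<infinity> \<or> rank_op B = \<infinity>")
    case False
    then obtain a b where ab: "rank_op A = enat a" "rank_op B = enat b" by auto
    obtain S where S: "finite S" "card S \<le> a" "range (blinfun_apply A) \<subseteq> complex_vector.span S"
      using ab rank_op_le_iff[of A a] by auto
    obtain S' where S': "finite S'" "card S' \<le> b" "range (blinfun_apply B) \<subseteq> complex_vector.span S'"
      using ab rank_op_le_iff[of B b] by auto
    have A: "A x \<in> complex_vector.span (S \<union> S')" and B: "B x \<in> complex_vector.span (S \<union> S')" for x
      using S(3) S'(3) complex_vector.span_mono[of S "S \<union> S'"] complex_vector.span_mono[of S' "S \<union> S'"]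
      by blast+
    have "finite (S \<union> S')" "card (S \<union> S') \<le> a + b"
      using S S' card_Un_le[of S S'] by auto
    then have "rank_op (A + B) \<le> enat (a + b)" "rank_op (A - B) \<le> enat (a + b)"
      unfolding rank_op_le_iff using complex_vector.span_add[OF A B] complex_vector.span_diff[OF A B]
      by (intro exI[of _ "S \<union> S'"]; auto simp: blinfun.bilinear_simps)+
    then show ?thesis by (simp add: ab)
  qed auto
  then show "rank_op (A + B) \<le> rank_op A + rank_op B" "rank_op (A - B) \<le> rank_op A + rank_op B" by auto
qed

lemmas rank_op_add = rank_op_add_diff(1) and rank_op_diff = rank_op_add_diff(2)

lemma rank_op_0 [simp]: "rank_op 0 = 0"
proof -
  have "rank_op (0 :: 'a \<Rightarrow>\<^sub>L 'a) \<le> enat 0"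
    unfolding rank_op_le_iff by (intro exI[of _ "{}"]) (auto simp: blinfun.zero_left)
  then show ?thesis by (simp add: enat_0)
qed

lemma independent_card_le_rank_op:
  assumes "complex_vector.independent C" "finite C" "C \<subseteq> range (blinfun_apply A)"
  shows "enat (card C) \<le> rank_op A"
proof (cases "rank_op A")
  case (enat n)
  then obtain B where B: "finite B" "card B \<le> n" "range (blinfun_apply A) \<subseteq> complex_vector.span B"
    using rank_op_le_iff[of A n] by auto
  have "C \<subseteq> complex_vector.span B" using assms(3) B(3) by blast
  then show ?thesis using complex_vector.independent_span_bound[OF B(1) assms(1)] B(2) enat by simp
qed simp

text \<open>Covers infinite rank too, where a \<open>k\<close>-element part is cut out of an
  infinite basis.\<close>

lemma rank_op_ge_independent:
  assumes "enat k \<le> rank_op A"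
  shows "\<exists>C. complex_vector.independent C \<and> finite C \<and> C \<subseteq> range (blinfun_apply A) \<and> card C = k"
proof -
  obtain C where C: "C \<subseteq> range (blinfun_apply A)" "complex_vector.independent C"
      "range (blinfun_apply A) \<subseteq> complex_vector.span C" "card C = complex_vector.dim (range (blinfun_apply A))"
    using complex_vector.basis_exists[of "range (blinfun_apply A)"] by blast
  have "\<exists>S\<subseteq>C. finite S \<and> card S = k"
  proof (cases "finite C")
    case True
    then have "rank_op A \<le> enat (card C)" unfolding rank_op_le_iff using C(3)
      by (intro exI[of _ C]) simp
    from order_trans[OF assms this] have "k \<le> card C" by simp
    then obtain S where "S \<subseteq> C" "card S = k" "finite S" by (rule obtain_subset_with_card_n)
    then show ?thesis by blast
  next
    case False
    from infinite_arbitrarily_large[OF this, of k] show ?thesis by blast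
  qed
  then obtain S where S: "S \<subseteq> C" "finite S" "card S = k" by blast
  show ?thesis
    by (intro exI[of _ S] conjI S complex_vector.independent_mono[OF C(2) S(1)] order_trans[OF S(1) C(1)])
qed

section \<open>Biorthogonal systems as certificates of rank\<close>

lemma cinner_span_eq_0:
  assumes "\<And>s. s \<in> S \<Longrightarrow> cinner s x = 0" "v \<in> complex_vector.span S"
  shows "cinner v x = 0"
proof -
  have "complex_vector.subspace {v. cinner v x = 0}"
    by (auto simp: complex_vector.subspace_def cinner_add_left cinner_scaleC_left)
  then have "complex_vector.span S \<subseteq> {v. cinner v x = 0}"
    using assms(1) by (intro complex_vector.span_minimal) auto
  then show ?thesis using assms(2) by blast
qed

text \<open>One Gram-Schmidt step for each new vector. The argument is algebraic, and closedness of
  finite spans is later derived from it.\<close>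

lemma finite_orthogonal_decomposition:
  assumes "finite S"
  shows "\<exists>p\<in>complex_vector.span S. \<forall>s\<in>S. cinner s (x - p) = 0"
  using assms
proof (induction S arbitrary: x)
  case empty
  then show ?case by (intro bexI[of _ 0]) auto
next
  case (insert s S)
  obtain p where p: "p \<in> complex_vector.span S" "\<forall>t\<in>S. cinner t (x - p) = 0" using insert.IH by blast
  obtain r where r: "r \<in> complex_vector.span S" "\<forall>t\<in>S. cinner t (s - r) = 0" using insert.IH by blast
  define q where "q = s - r"
  define c where "c = (if q = 0 then 0 else cnj (cinner q (x - p)) / cinner q q)"
  have sub: "v \<in> complex_vector.span (insert s S)" if "v \<in> complex_vector.span S" for v
    using that complex_vector.span_mono[of S "insert s S"] by blast
  have qs: "q \<in> complex_vector.span (insert s S)"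
    unfolding q_def by (intro complex_vector.span_diff sub r(1) complex_vector.span_base) simp
  have S: "cinner t (x - (p + c *\<^sub>C q)) = 0" if "t \<in> S" for t
    using that p(2) r(2) by (simp add: q_def[symmetric] diff_diff_eq[symmetric] cinner_diff_right[of _ "x - p"]
        cinner_scaleC_right)
  have "cnj (cinner q q) = cinner q q" by (metis cinner_commute)
  then have "cinner q (x - (p + c *\<^sub>C q)) = 0"
    by (simp add: diff_diff_eq[symmetric] cinner_diff_right[of _ "x - p"] cinner_scaleC_right c_def)
  moreover have "cinner r (x - (p + c *\<^sub>C q)) = 0" by (rule cinner_span_eq_0[OF S r(1)])
  ultimately have "cinner s (x - (p + c *\<^sub>C q)) = 0"
    using cinner_add_left[of q r] by (simp add: q_def)
  with S show ?case
    by (intro bexI[of _ "p + c *\<^sub>C q"] complex_vector.span_add sub p(1) complex_vector.span_scale qs) auto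
qed

text \<open>The component of \<open>b\<close> orthogonal to the other vectors, rescaled; it is
  nonzero by independence.\<close>

lemma dual_vector_exists:
  assumes "complex_vector.independent C" "finite C" "b \<in> C"
  shows "\<exists>y. cinner b y = 1 \<and> (\<forall>c\<in>C - {b}. cinner c y = 0)"
proof -
  obtain p where p: "p \<in> complex_vector.span (C - {b})" "\<forall>s\<in>C - {b}. cinner s (b - p) = 0"
    using finite_orthogonal_decomposition[of "C - {b}" b] assms(2) by blast
  have "b \<notin> complex_vector.span (C - {b})"
    using assms(1,3) by (auto simp: complex_vector.dependent_def)
  then have "b - p \<noteq> 0" using p(1) by auto
  then have nz: "cinner (b - p) (b - p) \<noteq> 0" by simp
  have "cinner p (b - p) = 0" by (rule cinner_span_eq_0[OF _ p(1)]) (use p(2) in blast)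
  then have bb: "cinner b (b - p) = cinner (b - p) (b - p)" by (simp add: cinner_diff_left)
  show ?thesis
  proof (intro exI conjI ballI)
    let ?y = "cnj (1 / cinner (b - p) (b - p)) *\<^sub>C (b - p)"
    show "cinner b ?y = 1" using nz bb by (simp only: cinner_scaleC_right) simp
    show "cinner c ?y = 0" if "c \<in> C - {b}" for c using p(2) that by (simp only: cinner_scaleC_right) simp
  qed
qed

text \<open>Such a system certifies rank at least \<open>k\<close> by finitely many vectors. It
  tolerates perturbations and, with \<open>x\<close> and \<open>y\<close> exchanged, serves the
  adjoint.\<close>

lemma rank_op_ge_biorthogonal:
  assumes "enat k \<le> rank_op A"
  shows "\<exists>x y :: nat \<Rightarrow> _. \<forall>i<k. \<forall>j<k. cinner (A (x i)) (y j) = (if i = j then 1 else 0)"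
proof -
  obtain C where C: "complex_vector.independent C" "finite C" "C \<subseteq> range (blinfun_apply A)" "card C = k"
    using rank_op_ge_independent[OF assms] by blast
  obtain c where c: "bij_betw c {..<k} C"
    using ex_bij_betw_nat_finite[OF C(2)] C(4) by (auto simp: atLeast0LessThan)
  have "\<forall>i. \<exists>x. i < k \<longrightarrow> A x = c i"
  proof
    fix i
    show "\<exists>x. i < k \<longrightarrow> A x = c i"
    proof (cases "i < k")
      case True
      then have "c i \<in> range (blinfun_apply A)" using c C(3) by (auto simp: bij_betw_def)
      then show ?thesis by auto
    qed auto
  qed
  from choice[OF this] obtain x where x: "\<And>i. i < k \<Longrightarrow> A (x i) = c i" by blast
  have "\<forall>i. \<exists>y. i < k \<longrightarrow> cinner (c i) y = 1 \<and> (\<forall>b\<in>C - {c i}. cinner b y = 0)"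
    using dual_vector_exists[OF C(1,2)] bij_betwE[OF c] by simp
  then obtain y where y: "\<And>i. i < k \<Longrightarrow> cinner (c i) (y i) = 1 \<and> (\<forall>b\<in>C - {c i}. cinner b (y i) = 0)"
    using choice[of "\<lambda>i y. i < k \<longrightarrow> cinner (c i) y = 1 \<and> (\<forall>b\<in>C - {c i}. cinner b y = 0)"] by blast
  have "cinner (A (x i)) (y j) = (if i = j then 1 else 0)" if ij: "i < k" "j < k" for i j
  proof (cases "i = j")
    case False
    then have "c i \<in> C - {c j}" using c ij by (auto simp: bij_betw_def inj_on_def)
    then show ?thesis using y[OF ij(2)] x[OF ij(1)] False by simp
  qed (use y x ij in simp)
  then show ?thesis by blast
qed

text \<open>A matrix whose entries differ from the identity by less than \<open>1 / (k + 1)\<close>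
  is invertible: in a vanishing combination the errors at a largest coefficient add up to at most
  \<open>k / (k + 1)\<close> of it.\<close>

lemma nearly_biorthogonal_rank_op_ge:
  fixes x y :: "nat \<Rightarrow> 'a::chilbert_space" and A :: "'a \<Rightarrow>\<^sub>L 'a"
  assumes near: "\<And>i j. i < k \<Longrightarrow> j < k \<Longrightarrow>
      cmod (cinner (A (x i)) (y j) - (if i = j then 1 else 0)) < 1 / (real k + 1)"
  shows "enat k \<le> rank_op A"
proof -
  have lin: "\<forall>i<k. c i = 0" if zero: "(\<Sum>i<k. c i *\<^sub>C A (x i)) = 0" for c
  proof (cases "k = 0")
    case False
    let ?N = "(\<lambda>i. cmod (c i)) ` {..<k}"
    have N: "finite ?N" "?N \<noteq> {}" using False by auto
    obtain j where j1: "j < k" "Max ?N = cmod (c j)" using Max_in[OF N] by auto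
    have j: "j < k" "\<And>i. i < k \<Longrightarrow> cmod (c i) \<le> cmod (c j)"
      using j1 Max_ge[OF N(1)] by auto
    define e where "e i = cinner (A (x i)) (y j) - (if i = j then 1 else 0)" for i
    have "0 = (\<Sum>i<k. c i * cinner (A (x i)) (y j))"
      using arg_cong[OF zero, of "\<lambda>v. cinner v (y j)"] by (simp add: cinner_sum_left cinner_scaleC_left)
    also have "\<dots> = (\<Sum>i<k. c i * (if i = j then 1 else 0) + c i * e i)"
      by (simp add: e_def algebra_simps)
    also have "\<dots> = (\<Sum>i<k. c i * (if i = j then 1 else 0)) + (\<Sum>i<k. c i * e i)"
      by (rule sum.distrib)
    also have "(\<Sum>i<k. c i * (if i = j then 1 else 0)) = (\<Sum>i\<in>{j}. c i * (if i = j then 1 else 0))"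
      using j(1) by (intro sum.mono_neutral_right) auto
    finally have "c j = - (\<Sum>i<k. c i * e i)" by (simp add: eq_neg_iff_add_eq_0)
    then have "cmod (c j) = cmod (\<Sum>i<k. c i * e i)" by (simp only: norm_minus_cancel)
    also have "\<dots> \<le> (\<Sum>i<k. cmod (c i * e i))" by (rule norm_sum)
    also have "\<dots> \<le> (\<Sum>i<k. cmod (c j) * (1 / (real k + 1)))"
    proof (rule sum_mono)
      fix i assume "i \<in> {..<k}"
      then have i: "i < k" by simp
      show "cmod (c i * e i) \<le> cmod (c j) * (1 / (real k + 1))"
        unfolding norm_mult e_def
        by (rule mult_mono[OF j(2)[OF i] less_imp_le[OF near[OF i j(1)]]]) auto
    qed
    also have "\<dots> = cmod (c j) * (real k / (real k + 1))" by simp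
    finally have "cmod (c j) * (1 - real k / (real k + 1)) \<le> 0" by (simp add: algebra_simps)
    then have "c j = 0" by (simp add: mult_le_0_iff divide_simps)
    then show ?thesis using j(2) by auto
  qed auto
  \<comment> \<open>Independence is a property of sets, so coinciding vectors must be excluded
    separately; the combination with coefficients 1 and -1 does this.\<close>
  have inj: "inj_on (\<lambda>i. A (x i)) {..<k}"
  proof (rule inj_onI)
    fix i j assume ij: "i \<in> {..<k}" "j \<in> {..<k}" "A (x i) = A (x j)"
    show "i = j"
    proof (rule ccontr)
      assume ne: "i \<noteq> j"
      define c where "c l = (if l = i then 1 else if l = j then - 1 else (0::complex))" for l
      have "(\<Sum>l<k. c l *\<^sub>C A (x l)) = (\<Sum>l\<in>{i,j}. c l *\<^sub>C A (x l))"
        using ij by (intro sum.mono_neutral_right) (auto simp: c_def)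
      also have "\<dots> = 0" using ne ij(3) by (simp add: c_def)
      finally show False using lin[of c] ij by (auto simp: c_def)
    qed
  qed
  have "complex_vector.independent ((\<lambda>i. A (x i)) ` {..<k})"
  proof
    assume "complex_vector.dependent ((\<lambda>i. A (x i)) ` {..<k})"
    then obtain u where u: "\<exists>v\<in>(\<lambda>i. A (x i)) ` {..<k}. u v \<noteq> 0" "(\<Sum>v\<in>(\<lambda>i. A (x i)) ` {..<k}. u v *\<^sub>C v) = 0"
      using complex_vector.dependent_finite[of "(\<lambda>i. A (x i)) ` {..<k}"] by auto
    have "(\<Sum>i<k. u (A (x i)) *\<^sub>C A (x i)) = 0" using u(2) by (simp add: sum.reindex[OF inj])
    from lin[OF this] u(1) show False by auto
  qed
  from independent_card_le_rank_op[OF this] show ?thesis by (auto simp: card_image[OF inj])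
qed

text \<open>The certificate involves \<open>A\<close> only at the vectors \<open>x i\<close>, so
  closeness there is enough.\<close>

lemma rank_op_lower_semicontinuous:
  fixes A :: "'a::chilbert_space \<Rightarrow>\<^sub>L 'a"
  assumes "enat k \<le> rank_op A"
  shows "\<exists>W \<epsilon>. finite W \<and> \<epsilon> > 0 \<and>
    (\<forall>B. (\<forall>x\<in>W. norm (blinfun_apply B x - A x) < \<epsilon>) \<longrightarrow> enat k \<le> rank_op B)"
proof -
  obtain x y :: "nat \<Rightarrow> 'a" where xy:
    "\<forall>i<k. \<forall>j<k. cinner (A (x i)) (y j) = (if i = j then 1 else 0)"
    using rank_op_ge_biorthogonal[OF assms] by blast
  \<comment> \<open>The summand 1 makes \<open>M\<close> positive, also for \<open>k = 0\<close>,
    and the bound on the \<open>y j\<close> strict.\<close>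
  define M where "M = 1 + (\<Sum>j<k. norm (y j))"
  have M: "norm (y j) < M" if "j < k" for j
    using member_le_sum[of j "{..<k}" "\<lambda>j. norm (y j)"] that by (simp add: M_def)
  have M0: "M > 0" by (simp add: M_def add_pos_nonneg sum_nonneg)
  define \<epsilon> where "\<epsilon> = 1 / (real k + 1) / M"
  have \<epsilon>: "\<epsilon> > 0" using M0 by (simp add: \<epsilon>_def add_nonneg_pos)
  have "enat k \<le> rank_op B" if near: "\<forall>u\<in>x ` {..<k}. norm (B u - A u) < \<epsilon>" for B :: "'a \<Rightarrow>\<^sub>L 'a"
  proof (rule nearly_biorthogonal_rank_op_ge[of k B x y])
    fix i j assume ij: "i < k" "j < k"
    have "cmod (cinner (B (x i)) (y j) - (if i = j then 1 else 0)) = cmod (cinner (B (x i) - A (x i)) (y j))"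
      using xy ij by (simp add: cinner_diff_left)
    also have "\<dots> \<le> norm (B (x i) - A (x i)) * norm (y j)" by (rule norm_cinner_le)
    also have "\<dots> \<le> \<epsilon> * norm (y j)" using near ij(1) by (intro mult_right_mono) (auto intro: less_imp_le)
    also have "\<dots> < \<epsilon> * M" using M[OF ij(2)] \<epsilon> by (rule mult_strict_left_mono)
    also have "\<dots> = 1 / (real k + 1)" using M0 by (simp add: \<epsilon>_def)
    finally show "cmod (cinner (B (x i)) (y j) - (if i = j then 1 else 0)) < 1 / (real k + 1)" .
  qed
  then show ?thesis using \<epsilon> by (intro exI[of _ "x ` {..<k}"] exI[of _ \<epsilon>]) simp
qed

text \<open>The difference of the blocks is \<open>E' T (G' - G) + (E' - E) T G\<close>, so besides
  \<open>W\<close> the vectors \<open>T (G w)\<close> have to be controlled; \<open>E'\<close> is a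
  contraction.\<close>

lemma rank_op_compression_lsc:
  fixes E G T :: "'a::chilbert_space \<Rightarrow>\<^sub>L 'a"
  assumes "enat k \<le> rank_op (E o\<^sub>L T o\<^sub>L G)"
  shows "\<exists>W \<epsilon>. finite W \<and> \<epsilon> > 0 \<and> (\<forall>E' G'. orth_proj E' \<longrightarrow>
    (\<forall>w\<in>W. norm (blinfun_apply E' w - E w) < \<epsilon> \<and> norm (blinfun_apply G' w - G w) < \<epsilon>) \<longrightarrow> enat k \<le> rank_op (E' o\<^sub>L T o\<^sub>L G'))"
proof -
  obtain W \<epsilon> where W: "finite W" "\<epsilon> > 0"
    "\<forall>B. (\<forall>x\<in>W. norm (blinfun_apply B x - (E o\<^sub>L T o\<^sub>L G) x) < \<epsilon>) \<longrightarrow> enat k \<le> rank_op B"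
    using rank_op_lower_semicontinuous[OF assms] by blast
  define \<delta> where "\<delta> = \<epsilon> / (norm T + 1)"
  have pos: "norm T + 1 > 0" by (simp add: add_nonneg_pos)
  have \<delta>: "\<delta> > 0" "norm T * \<delta> + \<delta> = \<epsilon>"
    using pos W(2) distrib_right[of "norm T" 1 \<delta>] by (simp_all add: \<delta>_def)
  show ?thesis
  proof (intro exI[of _ "W \<union> (\<lambda>w. T (G w)) ` W"] exI[of _ \<delta>] conjI allI impI)
    fix E' G' :: "'a \<Rightarrow>\<^sub>L 'a"
    assume E': "orth_proj E'" and near: "\<forall>w\<in>W \<union> (\<lambda>w. T (G w)) ` W. norm (E' w - E w) < \<delta> \<and> norm (G' w - G w) < \<delta>"
    show "enat k \<le> rank_op (E' o\<^sub>L T o\<^sub>L G')"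
    proof (rule W(3)[rule_format])
      fix x assume x: "x \<in> W"
      have "(E' o\<^sub>L T o\<^sub>L G') x - (E o\<^sub>L T o\<^sub>L G) x = E' (T (G' x - G x)) + (E' (T (G x)) - E (T (G x)))"
        by (simp add: blinfun.bilinear_simps)
      moreover have "norm (E' (T (G' x - G x))) \<le> norm T * \<delta>"
        using orth_proj_norm_le[OF E', of "T (G' x - G x)"] norm_blinfun[of T "G' x - G x"] near[rule_format, of x] x
          mult_left_mono[of "norm (G' x - G x)" \<delta> "norm T"] by auto
      moreover have "norm (E' (T (G x)) - E (T (G x))) < \<delta>"
        using near[rule_format, of "T (G x)"] x by simp
      ultimately show "norm ((E' o\<^sub>L T o\<^sub>L G') x - (E o\<^sub>L T o\<^sub>L G) x) < \<epsilon>"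
        using norm_triangle_ineq[of "E' (T (G' x - G x))" "E' (T (G x)) - E (T (G x))"] \<delta>(2)
        by (simp only:)
    qed
  qed (use W \<delta> in auto)
qed

subsection \<open>Splitting projections into rank-one and small pieces\<close>

lemma rank_one_operator_exists:
  fixes u v :: "'a::chilbert_space"
  shows "\<exists>X\<in>BH. \<forall>x. blinfun_apply X x = cinner x v *\<^sub>C u"
proof -
  have "bounded_linear (\<lambda>x. cinner x v *\<^sub>C u)"
  proof (rule bounded_linear_intro[where K = "norm v * norm u"])
    show "cinner (x + y) v *\<^sub>C u = cinner x v *\<^sub>C u + cinner y v *\<^sub>C u" for x y
      by (simp add: cinner_add_left scaleC_add_left)
    show "cinner (r *\<^sub>R x) v *\<^sub>C u = r *\<^sub>R cinner x v *\<^sub>C u" for r x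
      by (simp add: scaleR_scaleC cinner_scaleC_left scaleC_scaleC)
    show "norm (cinner x v *\<^sub>C u) \<le> norm x * (norm v * norm u)" for x
      using mult_right_mono[OF norm_cinner_le[of x v] norm_ge_zero[of u]] by (simp add: norm_scaleC mult.assoc)
  qed
  then have app: "blinfun_apply (Blinfun (\<lambda>x. cinner x v *\<^sub>C u)) x = cinner x v *\<^sub>C u" for x
    by (simp add: bounded_linear_Blinfun_apply)
  then have "Blinfun (\<lambda>x. cinner x v *\<^sub>C u) \<in> BH"
    by (simp add: BH_def cinner_scaleC_left scaleC_scaleC)
  with app show ?thesis by blast
qed

context masa_algebra
begin

text \<open>Every projection of the masa acts on the range of a minimal \<open>Q\<close> as 0 or as
  the identity. Hence all rank-one operators between vectors of this range commute with the
  projections and lie in the masa, which is abelian; so the range has dimension at most 1.\<close>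

lemma minimal_projection_rank:
  assumes Q: "Q \<in> PP" and min: "\<And>P. P \<in> PP \<Longrightarrow> (\<forall>x. P (Q x) = 0) \<or> (\<forall>x. P (Q x) = Q x)"
  shows "rank_op Q \<le> 1"
proof (cases "\<forall>x. Q x = 0")
  case True
  then have "Q = 0" by (intro blinfun_eqI) (simp add: blinfun.zero_left)
  then show ?thesis by simp
next
  case False
  then obtain u where u: "Q u = u" "u \<noteq> 0" using PP_idem[OF Q] by blast
  have ketbra: "\<exists>X\<in>\<D>. \<forall>x. X x = cinner x b *\<^sub>C a" if ab: "Q a = a" "Q b = b" for a b
  proof -
    obtain X where X: "X \<in> BH" "\<forall>x. X x = cinner x b *\<^sub>C a" using rank_one_operator_exists by blast
    have "X \<in> \<D>"
    proof (rule PP_commutant_in_D[OF X(1)])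
      fix P x assume P: "P \<in> PP"
      have "(P a = 0 \<and> P b = 0) \<or> (P a = a \<and> P b = b)" using min[OF P] ab by metis
      then show "X (P x) = P (X x)"
        using X(2) PP_csa[OF P, of x b] BH_scaleC[OF PP_BH[OF P]] by auto
    qed
    then show ?thesis using X(2) by blast
  qed
  have "Q x \<in> complex_vector.span {u}" for x
  proof (cases "Q x = 0")
    case False
    define v where "v = Q x"
    have v: "Q v = v" "v \<noteq> 0" using False Q by (auto simp: v_def)
    obtain X where X: "X \<in> \<D>" "\<forall>z. X z = cinner z v *\<^sub>C u" using ketbra[OF u(1) v(1)] by blast
    obtain Y where Y: "Y \<in> \<D>" "\<forall>z. Y z = cinner z u *\<^sub>C v" using ketbra[OF v(1) u(1)] by blast
    \<comment> \<open>Evaluating the commutation of the two rank-one operators at \<open>v\<close>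
      makes \<open>u\<close> and \<open>v\<close> proportional.\<close>
    have "(cinner v u * cinner v v) *\<^sub>C u = (cinner v v * cinner u u) *\<^sub>C v"
      using D_commute[OF X(1) Y(1), of v] X(2) Y(2) by (simp add: cinner_scaleC_left)
    from arg_cong[OF this, of "\<lambda>z. inverse (cinner v v * cinner u u) *\<^sub>C z"]
    have "inverse (cinner v v * cinner u u) *\<^sub>C ((cinner v u * cinner v v) *\<^sub>C u) =
        (inverse (cinner v v * cinner u u) * (cinner v v * cinner u u)) *\<^sub>C v"
      by (simp only: scaleC_scaleC)
    also have "inverse (cinner v v * cinner u u) * (cinner v v * cinner u u) = 1"
      using u(2) v(2) by (intro left_inverse) simp
    finally have "v = inverse (cinner v v * cinner u u) *\<^sub>C ((cinner v u * cinner v v) *\<^sub>C u)" by simp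
    moreover have "inverse (cinner v v * cinner u u) *\<^sub>C ((cinner v u * cinner v v) *\<^sub>C u) \<in> complex_vector.span {u}"
      by (intro complex_vector.span_scale complex_vector.span_base) simp
    ultimately show ?thesis by (simp add: v_def)
  qed (simp add: complex_vector.span_zero)
  then have "rank_op Q \<le> enat 1"
    unfolding rank_op_le_iff by (intro exI[of _ "{u}"]) auto
  then show ?thesis by (simp add: one_enat_def)
qed

text \<open>The limit is the projection onto the intersection of the ranges. Squared norms along the
  sequence decrease, and Pythagoras turns their convergence into the Cauchy property.\<close>

lemma decreasing_projections_limit:
  assumes Q: "\<And>n. Q n \<in> PP" and dec: "\<And>n x. Q n (Q (Suc n) x) = Q (Suc n) x"
  shows "\<exists>R\<in>PP. (\<forall>x. (\<lambda>n. Q n x) \<longlonglongrightarrow> R x) \<and> (\<forall>n x. Q n (R x) = R x)"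
proof -
  have dec': "Q m (Q n x) = Q n x" if "m \<le> n" for m n x
    using that
  proof (induction n arbitrary: x rule: dec_induct)
    case base
    show ?case using Q by simp
  next
    case (step n)
    have "Q m (Q (Suc n) x) = Q m (Q n (Q (Suc n) x))" by (simp add: dec)
    also have "\<dots> = Q (Suc n) x" using step.IH[of "Q (Suc n) x"] by (simp only: dec)
    finally show ?case .
  qed
  define V where "V = {x. \<forall>n. Q n x = x}"
  have sub: "complex_vector.subspace V"
    by (auto simp: V_def complex_vector.subspace_def blinfun.bilinear_simps BH_scaleC[OF PP_BH[OF Q]])
  have "V = (\<Inter>n. {x. Q n x = x})" by (auto simp: V_def)
  also have "closed \<dots>" by (intro closed_INT ballI closed_Collect_eq continuous_intros)
  finally have cl: "closed V" .
  obtain R where R: "orth_proj R" "\<forall>x. R x = x \<longleftrightarrow> x \<in> V" "\<forall>x. \<forall>v\<in>V. inner (x - R x) v = 0"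
    using orth_proj_exists[OF sub cl] by blast
  have RV: "R x \<in> V" for x using R(2) orth_projD(2)[OF R(1)] by blast
  have "R \<in> PP"
  proof (rule orth_proj_in_PP[OF R(1)])
    fix P x assume P: "P \<in> PP" and x: "R x = x"
    then have "x \<in> V" using R(2) by blast
    then have "P x \<in> V" unfolding V_def using PP_commute[OF Q P] by simp
    then show "R (P x) = P x" using R(2) by blast
  qed
  moreover have "(\<lambda>n. Q n x) \<longlonglongrightarrow> R x" for x
  proof -
    have diff: "(norm (Q m x - Q n x))\<^sup>2 = (norm (Q m x))\<^sup>2 - (norm (Q n x))\<^sup>2" if "m \<le> n" for m n
      using PP_pythagoras[OF Q, of "Q m x" n] dec'[OF that, of x] PP_commute[OF Q Q, of n m x] by simp
    have "decseq (\<lambda>n. (norm (Q n x))\<^sup>2)"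
      using diff by (intro decseq_SucI) (metis diff_ge_0_iff_ge le_SucI order_refl zero_le_power2)
    then have "convergent (\<lambda>n. (norm (Q n x))\<^sup>2)"
      by (rule decseq_convergent[where B = 0]) (auto simp: convergent_def)
    then have C: "Cauchy (\<lambda>n. (norm (Q n x))\<^sup>2)" by (rule convergent_Cauchy)
    have "Cauchy (\<lambda>n. Q n x)"
    proof (rule metric_CauchyI)
      fix e :: real assume e: "e > 0"
      obtain N where N: "\<And>m n. m \<ge> N \<Longrightarrow> n \<ge> N \<Longrightarrow> dist ((norm (Q m x))\<^sup>2) ((norm (Q n x))\<^sup>2) < e\<^sup>2"
        using metric_CauchyD[OF C, of "e\<^sup>2"] e by auto
      have "dist (Q m x) (Q n x) < e" if "m \<ge> N" "n \<ge> N" "m \<le> n" for m n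
        using N[OF that(1,2)] diff[OF that(3)] e
        by (intro power_less_imp_less_base[of _ 2 e]) (auto simp: dist_norm)
      then show "\<exists>M. \<forall>m\<ge>M. \<forall>n\<ge>M. dist (Q m x) (Q n x) < e"
        by (metis dist_commute nat_le_linear)
    qed
    then obtain z where z: "(\<lambda>n. Q n x) \<longlonglongrightarrow> z" using Cauchy_convergent_iff convergent_def by blast
    have "Q m z = z" for m
    proof (rule LIMSEQ_unique)
      show "(\<lambda>n. Q m (Q n x)) \<longlonglongrightarrow> Q m z" by (intro blinfun.tendsto tendsto_const z)
      show "(\<lambda>n. Q m (Q n x)) \<longlonglongrightarrow> z"
        by (rule Lim_transform_eventually[OF z]) (auto simp: eventually_sequentially dec' intro!: exI[of _ m])
    qed
    then have zV: "z \<in> V" by (simp add: V_def)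
    have orth: "inner (x - z) v = 0" if v: "v \<in> V" for v
    proof (rule LIMSEQ_unique)
      show "(\<lambda>n. inner (x - Q n x) v) \<longlonglongrightarrow> inner (x - z) v"
        by (intro tendsto_inner tendsto_diff tendsto_const z)
      have "inner (x - Q n x) v = 0" for n
        using v by (simp add: V_def inner_diff_left PP_sa[OF Q])
      then show "(\<lambda>n. inner (x - Q n x) v) \<longlonglongrightarrow> 0" by simp
    qed
    have "R x - z \<in> V" using complex_vector.subspace_diff[OF sub RV zV] .
    then have "inner (R x - z) (R x - z) = 0"
      using orth[of "R x - z"] R(3)[rule_format, of "R x - z" x] by (simp add: inner_diff_left)
    then have "R x = z" by simp
    with z show ?thesis by simp
  qed
  moreover have "Q n (R x) = R x" for n x using RV[of x] by (simp add: V_def)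
  ultimately show ?thesis by blast
qed

end

locale separable_masa_algebra = masa_algebra \<D> for \<D> :: "('a::chilbert_space \<Rightarrow>\<^sub>L 'a) set" +
  assumes separable: "separable_space (euclidean :: 'a topology)"
begin

lemma dense_sequence_exists: "\<exists>h :: nat \<Rightarrow> 'a. closure (range h) = UNIV"
proof -
  obtain C :: "'a set" where C: "countable C" "closure C = UNIV"
    using separable by (auto simp: separable_space_def)
  then have "C \<noteq> {}" by auto
  then have "range (from_nat_into C) = C" using C(1) by (rule range_from_nat_into)
  then show ?thesis using C(2) by (intro exI[of _ "from_nat_into C"]) simp
qed

text \<open>If \<open>\<Phi>\<close> fails somewhere, a greedy sequence of decreasing failures converges to a
  failure that is minimal, hence of rank at most one.\<close>

theorem partition_principle:
  assumes W: "finite W" "\<epsilon> > 0"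
    and add: "\<And>P Q. P \<in> PP \<Longrightarrow> Q \<in> PP \<Longrightarrow> (\<And>x. P (Q x) = 0) \<Longrightarrow> \<Phi> P \<Longrightarrow> \<Phi> Q \<Longrightarrow> \<Phi> (P + Q)"
    and rank1: "\<And>P. P \<in> PP \<Longrightarrow> rank_op P \<le> 1 \<Longrightarrow> \<Phi> P"
    and small: "\<And>P. P \<in> PP \<Longrightarrow> (\<And>w. w \<in> W \<Longrightarrow> norm (P w) < \<epsilon>) \<Longrightarrow> \<Phi> P"
    and P: "P \<in> PP"
  shows "\<Phi> P"
proof (rule ccontr)
  assume bad0: "\<not> \<Phi> P"
  obtain h :: "nat \<Rightarrow> 'a" where h: "closure (range h) = UNIV" using dense_sequence_exists by blast
  define bad where "bad Q \<longleftrightarrow> Q \<in> PP \<and> \<not> \<Phi> Q" for Q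
  \<comment> \<open>The decoding visits every index of the dense sequence infinitely often, so each
    \<open>h i\<close> is tested with tolerances tending to 0.\<close>
  define k where "k n = h (fst (prod_decode n))" for n
  have "\<exists>Q :: nat \<Rightarrow> 'a \<Rightarrow>\<^sub>L 'a. \<forall>n. bad (Q n) \<and> ((\<forall>x. Q n (Q (Suc n) x) = Q (Suc n) x) \<and>
      (\<forall>R. bad R \<longrightarrow> (\<forall>x. Q n (R x) = R x) \<longrightarrow>
        (norm (Q (Suc n) (k n)))\<^sup>2 \<le> (norm (R (k n)))\<^sup>2 + 1 / real (Suc n)))"
  proof (rule dependent_nat_choice)
    show "\<exists>Q. bad Q" using bad0 P by (auto simp: bad_def)
    fix Q :: "'a \<Rightarrow>\<^sub>L 'a" and n assume Q: "bad Q"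
    let ?A = "{R. bad R \<and> (\<forall>x. Q (R x) = R x)}"
    let ?f = "\<lambda>R. (norm (blinfun_apply R (k n)))\<^sup>2"
    have "Q \<in> ?A" using Q by (auto simp: bad_def)
    then have ne: "?A \<noteq> {}" by blast
    have bdd: "bdd_below (?f ` ?A)" by (rule bdd_belowI[of _ 0]) auto
    have "\<exists>S\<in>?A. ?f S < (INF R\<in>?A. ?f R) + 1 / real (Suc n)"
      using cINF_less_iff[OF ne bdd, of "(INF R\<in>?A. ?f R) + 1 / real (Suc n)"] by simp
    then obtain S where S: "S \<in> ?A" "?f S < (INF R\<in>?A. ?f R) + 1 / real (Suc n)" by blast
    have "?f S \<le> ?f R + 1 / real (Suc n)" if "R \<in> ?A" for R
      using S(2) cINF_lower[OF bdd that] by linarith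
    then show "\<exists>S. bad S \<and> (\<forall>x. Q (S x) = S x) \<and> (\<forall>R. bad R \<longrightarrow> (\<forall>x. Q (R x) = R x) \<longrightarrow>
        ?f S \<le> ?f R + 1 / real (Suc n))"
      using S(1) by (intro exI[of _ S]) simp
  qed
  then obtain Q where Q: "\<And>n. bad (Q n)" "\<And>n x. Q n (Q (Suc n) x) = Q (Suc n) x"
    "\<And>n R. bad R \<Longrightarrow> (\<And>x. Q n (R x) = R x) \<Longrightarrow>
        (norm (Q (Suc n) (k n)))\<^sup>2 \<le> (norm (R (k n)))\<^sup>2 + 1 / real (Suc n)"
    by blast
  have QP: "Q n \<in> PP" for n using Q(1) by (simp add: bad_def)
  obtain S where S: "S \<in> PP" "\<forall>x. (\<lambda>n. Q n x) \<longlonglongrightarrow> S x" "\<forall>n x. Q n (S x) = S x"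
    using decreasing_projections_limit[of Q, OF QP Q(2)] by blast
  have SQ: "S (Q n x) = S x" for n x using S(3) PP_commute[OF S(1) QP, of n x] by simp
  \<comment> \<open>Far out in the sequence \<open>Q n - S\<close> is small on \<open>W\<close>, so
    \<open>\<Phi>\<close> for \<open>S\<close> would give \<open>\<Phi>\<close> for
    \<open>Q n\<close>.\<close>
  have badS: "bad S"
  proof (rule ccontr)
    assume "\<not> bad S"
    then have "\<Phi> S" using S(1) by (simp add: bad_def)
    have "\<forall>\<^sub>F n in sequentially. \<forall>w\<in>W. norm (Q n w - S w) < \<epsilon>"
      using W S(2) by (intro eventually_ball_finite ballI)
        (auto simp: tendsto_iff dist_norm)
    then obtain n where n: "\<forall>w\<in>W. norm (Q n w - S w) < \<epsilon>" by (auto simp: eventually_sequentially)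
    have D: "Q n - S \<in> PP" by (intro PP_diff QP S(1)) (use S(3) in blast)
    have "\<Phi> (Q n - S)" by (rule small[OF D]) (use n in \<open>simp add: blinfun.diff_left\<close>)
    then have "\<Phi> (S + (Q n - S))"
      by (intro add[OF S(1) D _ \<open>\<Phi> S\<close>]) (simp add: blinfun.bilinear_simps SQ S(1))
    then show False using Q(1)[of n] by (simp add: bad_def)
  qed
  \<comment> \<open>A failure below \<open>S\<close> competes at every stage of the greedy choice,
    so it is not shorter than \<open>S\<close> on any \<open>h i\<close>; being dominated by
    \<open>S\<close>, it agrees with \<open>S\<close> on a dense set.\<close>
  have eqS: "R x = S x" if R: "bad R" "\<And>x. S (R x) = R x" for R x
  proof -
    have RP: "R \<in> PP" using R(1) by (simp add: bad_def)
    have RS: "R (S x) = R x" for x using R(2)[of x] PP_commute[OF RP S(1), of x] by simp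
    have le: "(norm (S (h i)))\<^sup>2 \<le> (norm (R (h i)))\<^sup>2" for i
    proof (rule LIMSEQ_le_const)
      show "(\<lambda>m. (norm (R (h i)))\<^sup>2 + 1 / real (Suc m)) \<longlonglongrightarrow> (norm (R (h i)))\<^sup>2"
        using tendsto_add[OF tendsto_const LIMSEQ_inverse_real_of_nat, of "(norm (R (h i)))\<^sup>2"]
        by (simp add: inverse_eq_divide)
      have "(norm (S (h i)))\<^sup>2 \<le> (norm (R (h i)))\<^sup>2 + 1 / real (Suc m)" for m
      proof -
        define n where "n = prod_encode (i, m)"
        have kn: "k n = h i" by (simp add: k_def n_def)
        have nm: "m \<le> n" by (simp add: n_def le_prod_encode_2)
        have "norm (S (h i)) \<le> norm (Q (Suc n) (h i))"
          using PP_norm_le[OF S(1), of "Q (Suc n) (h i)"] by (simp add: SQ)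
        then have "(norm (S (h i)))\<^sup>2 \<le> (norm (Q (Suc n) (h i)))\<^sup>2" by (simp add: power_mono)
        also have "\<dots> \<le> (norm (R (h i)))\<^sup>2 + 1 / real (Suc n)"
          using Q(3)[OF R(1), of n] S(3) R(2) by (metis kn)
        also have "\<dots> \<le> (norm (R (h i)))\<^sup>2 + 1 / real (Suc m)"
          using nm by (simp add: frac_le)
        finally show ?thesis .
      qed
      then show "\<exists>N. \<forall>n\<ge>N. (norm (S (h i)))\<^sup>2 \<le> (norm (R (h i)))\<^sup>2 + 1 / real (Suc n)" by blast
    qed
    have "R (h i) = S (h i)" for i
      using PP_pythagoras[OF RP, of "S (h i)"] le[of i] by (simp add: RS)
    then have "range h \<subseteq> {x. R x = S x}" by auto
    moreover have "closed {x. R x = S x}" by (intro closed_Collect_eq continuous_intros)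
    ultimately have "closure (range h) \<subseteq> {x. R x = S x}" by (rule closure_minimal)
    then show ?thesis using h by auto
  qed
  have "rank_op S \<le> 1"
  proof (rule minimal_projection_rank[OF S(1)])
    fix E assume E: "E \<in> PP"
    let ?A = "E o\<^sub>L S" and ?B = "(id_blinfun - E) o\<^sub>L S"
    have A: "?A \<in> PP" and B: "?B \<in> PP" by (intro PP_compose PP_compl E S(1))+
    \<comment> \<open>By \<open>add\<close> one of the two parts of \<open>S\<close> cut by
      \<open>E\<close> fails, and a failure below \<open>S\<close> equals \<open>S\<close>; this is
      minimality.\<close>
    have "bad ?A \<or> bad ?B"
    proof (rule ccontr)
      assume "\<not> (bad ?A \<or> bad ?B)"
      then have "\<Phi> ?A" "\<Phi> ?B" using A B by (auto simp: bad_def)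
      moreover have "?A (?B x) = 0" for x
        by (simp add: blinfun.bilinear_simps PP_commute[OF S(1) E] S(1) E)
      ultimately have "\<Phi> (?A + ?B)" by (intro add A B) auto
      moreover have "?A + ?B = S" by (intro blinfun_eqI) (simp add: blinfun.bilinear_simps)
      ultimately show False using badS by (simp add: bad_def)
    qed
    then show "(\<forall>x. E (S x) = 0) \<or> (\<forall>x. E (S x) = S x)"
    proof
      assume "bad ?A"
      then show ?thesis using eqS[of ?A] PP_commute[OF S(1) E] S(1) by simp
    next
      assume "bad ?B"
      then have "?B x = S x" for x
        by (rule eqS) (simp add: blinfun.bilinear_simps PP_commute[OF S(1) E] S(1))
      then show ?thesis by (simp add: blinfun.bilinear_simps)
    qed
  qed
  then show False using rank1[OF S(1)] badS by (simp add: bad_def)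
qed

end

subsection \<open>Boundedness of the ranks\<close>

definition below :: "('a::real_normed_vector \<Rightarrow>\<^sub>L 'a) \<Rightarrow> ('a \<Rightarrow>\<^sub>L 'a) \<Rightarrow> bool"
  where "below P Q \<longleftrightarrow> (\<forall>x. Q (P x) = P x)"

lemma belowD: "below P Q \<Longrightarrow> Q (P x) = P x"
  by (simp add: below_def)

lemma below_trans: "below P Q \<Longrightarrow> below Q R \<Longrightarrow> below P R"
  unfolding below_def by metis

text \<open>The commutator is linear in \<open>P\<close>, which makes its rank subadditive over sums
  and differences. It is comparable with the off-diagonal blocks:
  \<open>P T - T P = P T (I - P) - (I - P) T P\<close>, and compression recovers
  \<open>(I - P) T P\<close> up to sign.\<close>

definition commutator_rank :: "('a::chilbert_space \<Rightarrow>\<^sub>L 'a) \<Rightarrow> ('a \<Rightarrow>\<^sub>L 'a) \<Rightarrow> enat"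
  where "commutator_rank T P = rank_op ((P o\<^sub>L T) - (T o\<^sub>L P))"

lemma commutator_rank_add: "commutator_rank T (P + Q) \<le> commutator_rank T P + commutator_rank T Q"
proof -
  have "((P + Q) o\<^sub>L T) - (T o\<^sub>L (P + Q)) = ((P o\<^sub>L T) - (T o\<^sub>L P)) + ((Q o\<^sub>L T) - (T o\<^sub>L Q))"
    by (rule blinfun_eqI) (simp add: blinfun.bilinear_simps)
  then show ?thesis unfolding commutator_rank_def by (simp add: rank_op_add)
qed

lemma commutator_rank_diff: "commutator_rank T (P - Q) \<le> commutator_rank T P + commutator_rank T Q"
proof -
  have "((P - Q) o\<^sub>L T) - (T o\<^sub>L (P - Q)) = ((P o\<^sub>L T) - (T o\<^sub>L P)) - ((Q o\<^sub>L T) - (T o\<^sub>L Q))"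
    by (rule blinfun_eqI) (simp add: blinfun.bilinear_simps)
  then show ?thesis unfolding commutator_rank_def by (simp add: rank_op_diff)
qed

text \<open>\<open>P\<close> enters at \<open>T x\<close> as well as at \<open>x\<close>, so the
  test set is enlarged by its image under \<open>T\<close>.\<close>

lemma commutator_rank_lsc:
  fixes T P :: "'a::chilbert_space \<Rightarrow>\<^sub>L 'a"
  assumes "enat k \<le> commutator_rank T P"
  shows "\<exists>W \<epsilon>. finite W \<and> \<epsilon> > 0 \<and>
    (\<forall>E. (\<forall>w\<in>W. norm (blinfun_apply E w - P w) < \<epsilon>) \<longrightarrow> enat k \<le> commutator_rank T E)"
proof -
  obtain W \<epsilon> where W: "finite W" "\<epsilon> > 0"
    "\<forall>B. (\<forall>x\<in>W. norm (blinfun_apply B x - ((P o\<^sub>L T) - (T o\<^sub>L P)) x) < \<epsilon>) \<longrightarrow> enat k \<le> rank_op B"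
    using rank_op_lower_semicontinuous[OF assms[unfolded commutator_rank_def]] by blast
  define \<delta> where "\<delta> = \<epsilon> / (norm T + 1)"
  have pos: "norm T + 1 > 0" by (simp add: add_nonneg_pos)
  have \<delta>: "\<delta> > 0" "norm T * \<delta> + \<delta> = \<epsilon>"
    using pos W(2) distrib_right[of "norm T" 1 \<delta>] by (simp_all add: \<delta>_def)
  show ?thesis
  proof (intro exI[of _ "W \<union> blinfun_apply T ` W"] exI[of _ \<delta>] conjI allI impI)
    fix E :: "'a \<Rightarrow>\<^sub>L 'a"
    assume near: "\<forall>w\<in>W \<union> blinfun_apply T ` W. norm (E w - P w) < \<delta>"
    show "enat k \<le> commutator_rank T E"
      unfolding commutator_rank_def
    proof (rule W(3)[rule_format])
      fix x assume x: "x \<in> W"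
      let ?A = "(E o\<^sub>L T) - (T o\<^sub>L E)" and ?B = "(P o\<^sub>L T) - (T o\<^sub>L P)"
      have "?A x - ?B x = (E (T x) - P (T x)) - T (E x - P x)"
        by (simp add: blinfun.bilinear_simps)
      moreover have "norm (T (E x - P x)) \<le> norm T * \<delta>"
        using order_trans[OF norm_blinfun[of T "E x - P x"] mult_left_mono[of "norm (E x - P x)" \<delta> "norm T"]]
          near[rule_format, of x] x by simp
      moreover have "norm (E (T x) - P (T x)) < \<delta>"
        using near[rule_format, of "T x"] x by simp
      ultimately show "norm (?A x - ?B x) < \<epsilon>"
        using norm_triangle_ineq4[of "E (T x) - P (T x)" "T (E x - P x)"] \<delta>(2) by (simp only:)
    qed
  qed (use W \<delta> in auto)
qed

context masa_algebra
begin

lemma below_commute: "P \<in> PP \<Longrightarrow> Q \<in> PP \<Longrightarrow> below P Q \<Longrightarrow> P (Q x) = P x"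
  by (simp add: PP_commute[of P Q] belowD)

lemma below_compose_right: "P \<in> PP \<Longrightarrow> Q \<in> PP \<Longrightarrow> below (P o\<^sub>L Q) Q"
  by (simp add: below_def PP_commute[of P Q])

lemma below_compose_left: "P \<in> PP \<Longrightarrow> below (P o\<^sub>L Q) P"
  by (simp add: below_def)

end

context separable_masa_algebra
begin

context
  fixes T :: "'a \<Rightarrow>\<^sub>L 'a"
  assumes T: "T \<in> BH" and fin: "\<And>P. P \<in> PP \<Longrightarrow> commutator_rank T P < \<infinity>"
begin

text \<open>Uniform boundedness of the ranks over all projections under \<open>Q\<close>, not a
  lower bound. The gliding hump works with projections for which it fails.\<close>

definition bounded_below :: "('a \<Rightarrow>\<^sub>L 'a) \<Rightarrow> bool"
  where "bounded_below Q \<longleftrightarrow> (\<exists>n. \<forall>P\<in>PP. below P Q \<longrightarrow> commutator_rank T P \<le> enat n)"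

text \<open>A projection under \<open>A + B\<close> splits into a part under \<open>A\<close> and a
  part under \<open>B\<close>.\<close>

lemma bounded_below_add:
  assumes A: "A \<in> PP" "bounded_below A" and B: "B \<in> PP" "bounded_below B"
  shows "bounded_below (A + B)"
proof -
  obtain m where m: "\<And>P. P \<in> PP \<Longrightarrow> below P A \<Longrightarrow> commutator_rank T P \<le> enat m"
    using A(2) unfolding bounded_below_def by blast
  obtain n where n: "\<And>P. P \<in> PP \<Longrightarrow> below P B \<Longrightarrow> commutator_rank T P \<le> enat n"
    using B(2) unfolding bounded_below_def by blast
  have "commutator_rank T E \<le> enat (m + n)" if E: "E \<in> PP" "below E (A + B)" for E
  proof -
    have "E = (E o\<^sub>L A) + (E o\<^sub>L B)"
      using belowD[OF E(2)]
      by (intro blinfun_eqI) (simp add: blinfun.bilinear_simps PP_commute[OF E(1) A(1)] PP_commute[OF E(1) B(1)])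
    then have "commutator_rank T E \<le> commutator_rank T (E o\<^sub>L A) + commutator_rank T (E o\<^sub>L B)"
      by (metis commutator_rank_add)
    also have "\<dots> \<le> enat m + enat n"
      by (intro add_mono m n PP_compose E A(1) B(1) below_compose_right)
    finally show ?thesis by simp
  qed
  then show ?thesis unfolding bounded_below_def by blast
qed

lemma bounded_below_rank_one:
  assumes P: "P \<in> PP" "rank_op P \<le> 1"
  shows "bounded_below P"
proof -
  have "commutator_rank T E \<le> enat 2" if E: "E \<in> PP" "below E P" for E
  proof -
    have "E = P o\<^sub>L E" by (intro blinfun_eqI) (simp add: belowD[OF E(2)])
    then have "rank_op E \<le> rank_op P" by (metis rank_op_compose_right)
    then have 1: "rank_op E \<le> 1" using P(2) by simp
    have "commutator_rank T E \<le> rank_op (E o\<^sub>L T) + rank_op (T o\<^sub>L E)"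
      unfolding commutator_rank_def by (rule rank_op_diff)
    also have "\<dots> \<le> 1 + 1"
      using rank_op_compose_right[of E T] rank_op_compose_left[OF T, of E] 1
      by (intro add_mono) auto
    finally show ?thesis by (simp add: one_enat_def numeral_2_eq_2)
  qed
  then show ?thesis unfolding bounded_below_def by blast
qed

text \<open>If every small projection under \<open>Q\<close> were bounded, the partition principle
  for the property \<open>bounded_below (Q o\<^sub>L P)\<close> of \<open>P\<close> would reach the
  identity and so \<open>Q\<close> itself.\<close>

lemma small_unbounded_projection:
  assumes Q: "Q \<in> PP" "\<not> bounded_below Q" and W: "finite W" "\<epsilon> > 0"
  shows "\<exists>R\<in>PP. below R Q \<and> \<not> bounded_below R \<and> (\<forall>w\<in>W. norm (R w) < \<epsilon>)"
proof (rule ccontr)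
  assume none: "\<not> ?thesis"
  have "bounded_below (Q o\<^sub>L id_blinfun)"
  proof (rule partition_principle[OF W, of "\<lambda>P. bounded_below (Q o\<^sub>L P)"])
    show "bounded_below (Q o\<^sub>L (P + R))" if "P \<in> PP" "R \<in> PP" "bounded_below (Q o\<^sub>L P)" "bounded_below (Q o\<^sub>L R)" for P R
    proof -
      have "Q o\<^sub>L (P + R) = (Q o\<^sub>L P) + (Q o\<^sub>L R)" by (intro blinfun_eqI) (simp add: blinfun.bilinear_simps)
      then show ?thesis using that bounded_below_add PP_compose[OF Q(1)] by metis
    qed
    show "bounded_below (Q o\<^sub>L P)" if "P \<in> PP" "rank_op P \<le> 1" for P
      by (rule bounded_below_rank_one[OF PP_compose[OF Q(1) that(1)]
            order_trans[OF rank_op_compose_left[OF PP_BH[OF Q(1)]] that(2)]])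
    show "bounded_below (Q o\<^sub>L P)" if P: "P \<in> PP" "\<And>w. w \<in> W \<Longrightarrow> norm (P w) < \<epsilon>" for P
    proof (rule ccontr)
      assume nb: "\<not> bounded_below (Q o\<^sub>L P)"
      have "norm ((Q o\<^sub>L P) w) < \<epsilon>" if "w \<in> W" for w
        using PP_norm_le[OF Q(1), of "P w"] P(2)[OF that] by simp
      then show False using none nb PP_compose[OF Q(1) P(1)] below_compose_left[OF Q(1)] by blast
    qed
  qed (rule PP_id)
  moreover have "Q o\<^sub>L id_blinfun = Q" by (intro blinfun_eqI) simp
  ultimately show False using Q(2) by simp
qed

text \<open>State of the gliding hump: \<open>P\<close> is the part chosen so far, \<open>Q\<close> the reservoir for the rest.\<close>

definition hump :: "nat \<Rightarrow> ('a \<Rightarrow>\<^sub>L 'a) \<times> ('a \<Rightarrow>\<^sub>L 'a) \<Rightarrow> bool"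
  where "hump k S \<longleftrightarrow> (case S of (P, Q) \<Rightarrow> P \<in> PP \<and> Q \<in> PP \<and> (\<forall>x. P (Q x) = 0) \<and> \<not> bounded_below Q \<and>
    (\<forall>E\<in>PP. below P E \<longrightarrow> below E (P + Q) \<longrightarrow> enat k \<le> commutator_rank T E))"

text \<open>A part \<open>A\<close> with large commutator rank is moved from the reservoir to
  \<open>P\<close>, while an unbounded rest \<open>S\<close> is kept. The rest is then replaced by a
  projection small on a test set, so that by semicontinuity nothing chosen later can undo the rank
  reached.\<close>

lemma hump_step:
  assumes "hump k (P, Q)"
  shows "\<exists>P' Q'. hump (Suc k) (P', Q') \<and> below P P' \<and> below (P' + Q') (P + Q)"
proof -
  have P: "P \<in> PP" and Q: "Q \<in> PP" and PQ: "\<And>x. P (Q x) = 0" and nb: "\<not> bounded_below Q"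
    using assms by (auto simp: hump_def)
  have QP: "Q (P x) = 0" for x using PQ PP_commute[OF P Q] by simp
  obtain p q where p: "commutator_rank T P = enat p" and q: "commutator_rank T Q = enat q"
    using fin[OF P] fin[OF Q] by auto
  \<comment> \<open>The excess \<open>q\<close> pays for passing from \<open>R\<close> to
    \<open>Q - R\<close>, the excess \<open>p\<close> for joining the part to
    \<open>P\<close>.\<close>
  obtain R where R: "R \<in> PP" "below R Q" "\<not> commutator_rank T R \<le> enat (Suc k + p + q)"
    using nb unfolding bounded_below_def by blast
  have QR: "Q - R \<in> PP" using PP_diff[OF Q R(1)] belowD[OF R(2)] by blast
  have RQ: "R (Q x) = R x" for x by (rule below_commute[OF R(1) Q R(2)])
  have belowQR: "below (Q - R) Q" using Q belowD[OF R(2)] by (simp add: below_def blinfun.bilinear_simps)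
  obtain r where r: "commutator_rank T R = enat r" "Suc k + p + q < r" using R(3) fin[OF R(1)] by auto
  \<comment> \<open>At least one of \<open>R\<close> and \<open>Q - R\<close> is unbounded and
    becomes the reservoir; the other one supplies the rank.\<close>
  have "\<exists>A\<in>PP. \<exists>S\<in>PP. below A Q \<and> below S Q \<and> (\<forall>x. A (S x) = 0) \<and> \<not> bounded_below S \<and>
      enat (Suc k + p) \<le> commutator_rank T A"
  proof (cases "bounded_below (Q - R)")
    case False
    then show ?thesis
      using R(1,2) QR belowQR RQ r
      by (intro bexI[of _ R] bexI[of _ "Q - R"]) (auto simp: blinfun.bilinear_simps)
  next
    case True
    have "\<not> bounded_below R"
    proof
      assume "bounded_below R"
      then have "bounded_below (R + (Q - R))" by (intro bounded_below_add R(1) QR True)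
      then show False using nb by simp
    qed
    moreover have "commutator_rank T R \<le> commutator_rank T Q + commutator_rank T (Q - R)"
      using commutator_rank_diff[of T Q "Q - R"] by simp
    then have "enat (Suc k + p) \<le> commutator_rank T (Q - R)"
      using r q by (cases "commutator_rank T (Q - R)") auto
    ultimately show ?thesis
      using R(1,2) QR belowQR belowD[OF R(2)]
      by (intro bexI[of _ "Q - R"] bexI[of _ R]) (auto simp: blinfun.bilinear_simps)
  qed
  then obtain A S where A: "A \<in> PP" "S \<in> PP" "below A Q" "below S Q" "\<forall>x. A (S x) = 0"
    "\<not> bounded_below S" "enat (Suc k + p) \<le> commutator_rank T A" by blast
  have PA: "P (A x) = 0" for x using PQ[of "A x"] belowD[OF A(3), of x] by simp
  have AP: "A (P x) = 0" for x using PA PP_commute[OF P A(1)] by simp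
  define P' where "P' = P + A"
  have P': "P' \<in> PP" unfolding P'_def by (rule PP_add[OF P A(1) PA])
  have "A = P' - P" by (simp add: P'_def)
  then have "commutator_rank T A \<le> commutator_rank T P' + commutator_rank T P"
    using commutator_rank_diff[of T P' P] by simp
  from order_trans[OF A(7) this] have "enat (Suc k) \<le> commutator_rank T P'"
    using p by (cases "commutator_rank T P'") auto
  from commutator_rank_lsc[OF this] obtain W \<epsilon> where W: "finite W" "\<epsilon> > 0"
    "\<forall>E. (\<forall>w\<in>W. norm (blinfun_apply E w - P' w) < \<epsilon>) \<longrightarrow> enat (Suc k) \<le> commutator_rank T E" by blast
  obtain Q' where Q': "Q' \<in> PP" "below Q' S" "\<not> bounded_below Q'" "\<forall>w\<in>W. norm (Q' w) < \<epsilon>"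
    using small_unbounded_projection[OF A(2,6) W(1,2)] by blast
  have Q'Q: "below Q' Q" by (rule below_trans[OF Q'(2) A(4)])
  have "P' (Q' x) = 0" for x
  proof -
    have "A (Q' x) = 0" using A(5)[rule_format, of "Q' x"] belowD[OF Q'(2)] by simp
    moreover have "P (Q' x) = 0" using PQ[of "Q' x"] belowD[OF Q'Q] by simp
    ultimately show ?thesis by (simp add: P'_def blinfun.bilinear_simps)
  qed
  moreover have "enat (Suc k) \<le> commutator_rank T E" if E: "E \<in> PP" "below P' E" "below E (P' + Q')" for E
  proof (rule W(3)[rule_format])
    fix w assume w: "w \<in> W"
    \<comment> \<open>\<open>E\<close> and \<open>P'\<close> differ by \<open>E Q'\<close>, which is
      small on \<open>W\<close>.\<close>
    have "E w = P' (E w) + Q' (E w)" using belowD[OF E(3), of w] by (simp add: blinfun.bilinear_simps)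
    also have "P' (E w) = P' w" by (rule below_commute[OF P' E(1,2)])
    also have "Q' (E w) = E (Q' w)" by (rule PP_commute[OF Q'(1) E(1)])
    finally have "E w - P' w = E (Q' w)" by simp
    then show "norm (E w - P' w) < \<epsilon>" using PP_norm_le[OF E(1), of "Q' w"] Q'(4) w by fastforce
  qed
  ultimately have "hump (Suc k) (P', Q')" using P' Q' by (auto simp: hump_def)
  moreover have "below P P'" using P AP by (simp add: below_def P'_def blinfun.bilinear_simps)
  moreover have "below (P' + Q') (P + Q)"
  proof -
    have "P (Q' x) = 0" for x using PQ[of "Q' x"] belowD[OF Q'Q] by simp
    then show ?thesis using P PA QP belowD[OF A(3)] belowD[OF Q'Q]
      by (simp add: below_def P'_def blinfun.bilinear_simps)
  qed
  ultimately show ?thesis by blast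
qed

text \<open>The limit \<open>E\<close> of the chosen parts lies between \<open>P n\<close> and
  \<open>P n + Q n\<close> for every \<open>n\<close>, so its commutator rank is at least every
  \<open>n\<close>, against finiteness for single projections.\<close>

lemma commutator_rank_bounded: "\<exists>n. \<forall>P\<in>PP. commutator_rank T P \<le> enat n"
proof (rule ccontr)
  assume unb: "\<not> ?thesis"
  have "below P id_blinfun" for P :: "'a \<Rightarrow>\<^sub>L 'a" by (simp add: below_def)
  then have nb: "\<not> bounded_below id_blinfun" using unb by (auto simp: bounded_below_def)
  have "\<exists>S. \<forall>n. hump n (S n) \<and> (below (fst (S n)) (fst (S (Suc n))) \<and>
      below (fst (S (Suc n)) + snd (S (Suc n))) (fst (S n) + snd (S n)))"
  proof (rule dependent_nat_choice)
    have "hump 0 (0, id_blinfun)"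
      using nb by (auto simp: hump_def PP_0 PP_id blinfun.zero_left zero_enat_def[symmetric])
    then show "\<exists>S. hump 0 S" by blast
    fix S n assume "hump n S"
    then show "\<exists>S'. hump (Suc n) S' \<and> (below (fst S) (fst S') \<and> below (fst S' + snd S') (fst S + snd S))"
      using hump_step[of n "fst S" "snd S"] by (metis fst_conv snd_conv prod.collapse)
  qed
  then obtain S where S: "\<And>n. hump n (S n)" "\<And>n. below (fst (S n)) (fst (S (Suc n)))"
    "\<And>n. below (fst (S (Suc n)) + snd (S (Suc n))) (fst (S n) + snd (S n))" by blast
  define P where "P n = fst (S n)" for n
  define Q where "Q n = snd (S n)" for n
  have PP: "P n \<in> PP" and QQ: "Q n \<in> PP" and PQ: "P n (Q n x) = 0" for n x
    using S(1)[of n] by (auto simp: hump_def P_def Q_def split: prod.splits)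
  have stable: "enat n \<le> commutator_rank T E" if "E \<in> PP" "below (P n) E" "below E (P n + Q n)" for n E
    using S(1)[of n] that by (auto simp: hump_def P_def Q_def split: prod.splits)
  have PQP: "P n + Q n \<in> PP" for n by (rule PP_add[OF PP QQ PQ])
  have incP: "below (P m) (P n)" if "m \<le> n" for m n
    using that
  proof (induction n rule: dec_induct)
    case base
    show ?case using PP by (simp add: below_def)
  next
    case (step n)
    then show ?case using below_trans S(2) by (auto simp: P_def)
  qed
  have decPQ: "below (P n + Q n) (P m + Q m)" if "m \<le> n" for m n
    using that
  proof (induction n rule: dec_induct)
    case base
    show ?case using PQP by (simp add: below_def)
  next
    case (step n)
    then show ?case using below_trans S(3) by (auto simp: P_def Q_def)
  qed
  \<comment> \<open>The complements of the \<open>P n\<close> decrease, which gives the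
    limit.\<close>
  have "(id_blinfun - P n) ((id_blinfun - P (Suc n)) x) = (id_blinfun - P (Suc n)) x" for n x
    using below_commute[OF PP PP incP[of n "Suc n"]] by (simp add: blinfun.bilinear_simps)
  then obtain R where R: "R \<in> PP" "\<forall>x. (\<lambda>n. (id_blinfun - P n) x) \<longlonglongrightarrow> R x"
      "\<forall>n x. (id_blinfun - P n) (R x) = R x"
    using decreasing_projections_limit[of "\<lambda>n. id_blinfun - P n", OF PP_compl[OF PP]] by blast
  define E where "E = id_blinfun - R"
  have E: "E \<in> PP" unfolding E_def by (rule PP_compl[OF R(1)])
  have Elim: "(\<lambda>n. P n x) \<longlonglongrightarrow> E x" for x
    using tendsto_diff[OF tendsto_const[of x] R(2)[rule_format, of x]]
    by (simp add: E_def blinfun.bilinear_simps)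
  have 1: "below (P n) E" for n
  proof -
    have "P n (R x) = 0" for x using R(3)[rule_format, of n x] by (simp add: blinfun.bilinear_simps)
    then have "R (P n x) = 0" for x using PP_commute[OF R(1) PP] by simp
    then show ?thesis by (simp add: below_def E_def blinfun.bilinear_simps)
  qed
  have 2: "below E (P n + Q n)" for n
    unfolding below_def
  proof
    fix x
    show "(P n + Q n) (E x) = E x"
    proof (rule LIMSEQ_unique)
      show "(\<lambda>m. (P n + Q n) (P m x)) \<longlonglongrightarrow> (P n + Q n) (E x)"
        by (intro blinfun.tendsto tendsto_const Elim)
      have "(P n + Q n) (P m x) = P m x" if "n \<le> m" for m
      proof -
        have "P m x = (P m + Q m) (P m x)"
          using PP PQ PP_commute[OF QQ PP, of m m x] by (simp add: blinfun.bilinear_simps)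
        then show ?thesis using belowD[OF decPQ[OF that], of "P m x"] by simp
      qed
      then show "(\<lambda>m. (P n + Q n) (P m x)) \<longlonglongrightarrow> E x"
        by (intro Lim_transform_eventually[OF Elim]) (auto simp: eventually_sequentially intro!: exI[of _ n])
    qed
  qed
  have "enat n \<le> commutator_rank T E" for n using stable[OF E 1 2] .
  moreover obtain m where "commutator_rank T E = enat m" using fin[OF E] by auto
  ultimately have "enat (Suc m) \<le> enat m" by metis
  then show False by simp
qed

end

end

subsection \<open>Selecting few pieces that carry the full rank\<close>

text \<open>Exchanging the two halves of a biorthogonal system turns a certificate for
  \<open>A\<close> into one for its adjoint.\<close>

lemma rank_op_adjoint_ge:
  assumes "is_adjoint B A" "enat k \<le> rank_op A"
  shows "enat k \<le> rank_op B"
proof -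
  obtain x y :: "nat \<Rightarrow> 'a" where xy:
    "\<forall>i<k. \<forall>j<k. cinner (blinfun_apply A (x i)) (y j) = (if i = j then 1 else 0)"
    using rank_op_ge_biorthogonal[OF assms(2)] by blast
  have "cinner (blinfun_apply B (y i)) (x j) = (if i = j then 1 else 0)" if "i < k" "j < k" for i j
  proof -
    have "cinner (blinfun_apply B (y i)) (x j) = cinner (y i) (blinfun_apply A (x j))"
      using is_adjoint_sym[OF assms(1)] by (simp add: is_adjoint_def)
    also have "\<dots> = cnj (cinner (blinfun_apply A (x j)) (y i))" by (rule cinner_commute)
    finally show ?thesis using xy that by simp
  qed
  then show ?thesis by (intro nearly_biorthogonal_rank_op_ge[of k B y x]) simp
qed

lemma rank_op_sum_le:
  assumes "finite S" "\<And>A. A \<in> S \<Longrightarrow> rank_op A \<le> 1"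
  shows "rank_op (\<Sum>S) \<le> enat (card S)"
  using assms
proof (induction S rule: finite_induct)
  case empty
  then show ?case by (simp add: zero_enat_def)
next
  case (insert A S)
  have "rank_op (\<Sum>(insert A S)) \<le> rank_op A + rank_op (\<Sum>S)"
    using insert.hyps by (simp add: rank_op_add)
  also have "\<dots> \<le> 1 + enat (card S)" using insert by (intro add_mono) auto
  finally show ?case using insert.hyps by (simp add: one_enat_def)
qed

context masa_algebra
begin

text \<open>Finite sets instead of indexed families: when two mutually orthogonal families are
  united, a common member is 0, so merging loses nothing.\<close>

definition orth_family :: "('a \<Rightarrow>\<^sub>L 'a) set \<Rightarrow> bool"
  where "orth_family \<Q> \<longleftrightarrow> finite \<Q> \<and> \<Q> \<subseteq> PP \<and> (\<forall>P\<in>\<Q>. \<forall>R\<in>\<Q>. P \<noteq> R \<longrightarrow> (\<forall>x. blinfun_apply P (blinfun_apply R x) = 0))"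

lemma orth_family_subset:
  assumes "orth_family \<Q>" "\<R> \<subseteq> \<Q>"
  shows "orth_family \<R>"
  unfolding orth_family_def
proof (intro conjI ballI impI)
  show "finite \<R>" using assms finite_subset[OF assms(2)] by (simp add: orth_family_def)
  show "\<R> \<subseteq> PP" using assms order_trans[OF assms(2)] by (simp add: orth_family_def)
  show "\<forall>x. P (R x) = 0" if "P \<in> \<R>" "R \<in> \<R>" "P \<noteq> R" for P R
    using assms(1) that subsetD[OF assms(2)] by (simp add: orth_family_def)
qed

lemma blinfun_sum_apply: "blinfun_apply (\<Sum>\<Q>) x = (\<Sum>P\<in>\<Q>. blinfun_apply P x)"
  by (rule blinfun.sum_left)

lemma orth_family_sum:
  assumes "orth_family \<Q>"
  shows "\<Sum>\<Q> \<in> PP" and "P \<in> \<Q> \<Longrightarrow> (\<Sum>\<Q>) (P x) = P x"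
    and "\<R> \<subseteq> \<Q> \<Longrightarrow> P \<in> \<Q> \<Longrightarrow> P \<notin> \<R> \<Longrightarrow> (\<Sum>\<R>) (P x) = 0"
proof -
  have fin: "finite \<Q>" and sub: "\<Q> \<subseteq> PP" and orth: "\<And>P R x. P \<in> \<Q> \<Longrightarrow> R \<in> \<Q> \<Longrightarrow> P \<noteq> R \<Longrightarrow> P (R x) = 0"
    using assms by (auto simp: orth_family_def)
  show 0: "(\<Sum>\<R>) (P x) = 0" if "\<R> \<subseteq> \<Q>" "P \<in> \<Q>" "P \<notin> \<R>" for \<R> P x
  proof -
    have "(\<Sum>R\<in>\<R>. blinfun_apply R (P x)) = (\<Sum>R\<in>\<R>. 0)" using that orth by (intro sum.cong refl) blast
    then show ?thesis by (simp add: blinfun_sum_apply)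
  qed
  show "(\<Sum>\<Q>) (P x) = P x" if "P \<in> \<Q>"
  proof -
    have "\<Sum>\<Q> = P + \<Sum>(\<Q> - {P})" using fin that by (simp add: sum.remove)
    then show ?thesis using 0[of "\<Q> - {P}" P x] that sub by (simp add: blinfun.add_left subset_iff)
  qed
  have "\<R> \<subseteq> \<Q> \<longrightarrow> \<Sum>\<R> \<in> PP" if "finite \<R>" for \<R>
    using that
  proof (induction \<R> rule: finite_induct)
    case empty
    then show ?case by (simp add: PP_0)
  next
    case (insert P \<R>)
    show ?case
    proof
      assume i: "insert P \<R> \<subseteq> \<Q>"
      have "\<Sum>\<R> + P \<in> PP"
        using i insert sub by (intro PP_add 0) auto
      then show "\<Sum>(insert P \<R>) \<in> PP" using insert.hyps by (simp add: add.commute)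
    qed
  qed
  then show "\<Sum>\<Q> \<in> PP" using fin by blast
qed

end

context separable_masa_algebra
begin

text \<open>Having such a partition is preserved under orthogonal sums, which is what the partition
  principle asks for.\<close>

lemma finite_partition:
  assumes W: "finite W" "\<epsilon> > 0" and Q: "Q \<in> PP"
  shows "\<exists>\<Q>. orth_family \<Q> \<and> \<Sum>\<Q> = Q \<and> (\<forall>P\<in>\<Q>. rank_op P \<le> 1 \<or> (\<forall>w\<in>W. norm (blinfun_apply P w) < \<epsilon>))"
proof (rule partition_principle[OF W])
  let ?piece = "\<lambda>P. rank_op P \<le> 1 \<or> (\<forall>w\<in>W. norm (blinfun_apply P w) < \<epsilon>)"
  let ?\<Phi> = "\<lambda>Q. \<exists>\<Q>. orth_family \<Q> \<and> \<Sum>\<Q> = Q \<and> (\<forall>P\<in>\<Q>. ?piece P)"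
  have single: "?\<Phi> P" if "P \<in> PP" "?piece P" for P
    using that by (intro exI[of _ "{P}"]) (auto simp: orth_family_def)
  show "?\<Phi> P" if "P \<in> PP" "rank_op P \<le> 1" for P using single that by blast
  show "?\<Phi> P" if "P \<in> PP" "\<And>w. w \<in> W \<Longrightarrow> norm (P w) < \<epsilon>" for P using single that by blast
  fix P R assume P: "P \<in> PP" and R: "R \<in> PP" and PR: "\<And>x. P (R x) = 0" and \<Phi>: "?\<Phi> P" "?\<Phi> R"
  obtain \<A> where A: "orth_family \<A>" "\<Sum>\<A> = P" "\<forall>E\<in>\<A>. ?piece E" using \<Phi>(1) by blast
  obtain \<B> where B: "orth_family \<B>" "\<Sum>\<B> = R" "\<forall>E\<in>\<B>. ?piece E" using \<Phi>(2) by blast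
  have Apr: "E \<in> PP" "P (E x) = E x" if "E \<in> \<A>" for E x
    using A orth_family_sum(2)[OF A(1) that] that by (auto simp: orth_family_def)
  have Bpr: "E \<in> PP" "R (E x) = E x" if "E \<in> \<B>" for E x
    using B orth_family_sum(2)[OF B(1) that] that by (auto simp: orth_family_def)
  have orth: "E (G x) = 0" "G (E x) = 0" if E: "E \<in> \<A>" and G: "G \<in> \<B>" for E G x
  proof -
    have "E (G x) = P (E (G x))" using Apr(2)[OF E] by simp
    also have "\<dots> = E (P (G x))" using PP_commute[OF P Apr(1)[OF E]] .
    also have "P (G x) = 0" using PR[of "G x"] Bpr(2)[OF G] by simp
    finally show 1: "E (G x) = 0" by (simp add: blinfun.zero_right)
    then show "G (E x) = 0" using PP_commute[OF Apr(1)[OF E] Bpr(1)[OF G], of x] by simp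
  qed
  have "orth_family (\<A> \<union> \<B>)"
    unfolding orth_family_def
  proof (intro conjI ballI impI)
    show "finite (\<A> \<union> \<B>)" "\<A> \<union> \<B> \<subseteq> PP" using A(1) B(1) by (simp_all add: orth_family_def)
    show "\<forall>x. E (G x) = 0" if "E \<in> \<A> \<union> \<B>" "G \<in> \<A> \<union> \<B>" "E \<noteq> G" for E G
      using that orth A(1) B(1) by (elim UnE) (simp_all add: orth_family_def)
  qed
  moreover have "\<Sum>(\<A> \<union> \<B>) = P + R"
  proof -
    have "E = 0" if "E \<in> \<A> \<inter> \<B>" for E
    proof (rule blinfun_eqI)
      show "E x = (0 :: 'a \<Rightarrow>\<^sub>L 'a) x" for x
        using orth(1)[of E E x] that Apr(1)[of E] by (auto simp: blinfun.zero_left)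
    qed
    then have "\<Sum>(\<A> \<inter> \<B>) = 0" by (intro sum.neutral) auto
    then show ?thesis using sum.union_inter[of \<A> \<B> "\<lambda>E. E"] A B by (simp add: orth_family_def)
  qed
  ultimately show "?\<Phi> (P + R)" using A(3) B(3) by (intro exI[of _ "\<A> \<union> \<B>"]) auto
qed (rule Q)

text \<open>The ranges of \<open>A P\<close> for the pieces \<open>P\<close> of a fine partition of
  \<open>Q\<close> together span a space containing the range of \<open>A Q\<close>. Independent
  vectors taken from single such ranges show that \<open>k\<close> pieces carry rank
  \<open>k\<close>; these are sorted into those of rank at most one and the rest, which are
  small.\<close>

lemma select_pieces_right:
  assumes A: "A \<in> BH" and Q: "Q \<in> PP" and k: "enat k \<le> rank_op (A o\<^sub>L Q)" and W: "finite W" "\<epsilon> > 0"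
  shows "\<exists>P\<in>PP. \<exists>S\<in>PP. (\<forall>x. blinfun_apply P (blinfun_apply S x) = 0) \<and> below P Q \<and> below S Q \<and> rank_op P \<le> enat k \<and>
    ((\<forall>E\<in>PP. rank_op E \<le> 1 \<longrightarrow> E = 0) \<longrightarrow> P = 0) \<and>
    (\<forall>w\<in>W. norm (blinfun_apply S w) < \<epsilon>) \<and> enat k \<le> rank_op (A o\<^sub>L (P + S))"
proof -
  \<comment> \<open>At most \<open>k\<close> small pieces are added up, so together they stay below
    \<open>\<epsilon>\<close>.\<close>
  define \<delta> where "\<delta> = \<epsilon> / (real k + 1)"
  have \<delta>: "\<delta> > 0" using W by (simp add: \<delta>_def add_nonneg_pos)
  obtain \<Q> where \<Q>: "orth_family \<Q>" "\<Sum>\<Q> = Q" "\<forall>P\<in>\<Q>. rank_op P \<le> 1 \<or> (\<forall>w\<in>W. norm (blinfun_apply P w) < \<delta>)"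
    using finite_partition[OF W(1) \<delta> Q] by blast
  \<comment> \<open>The basis is chosen inside the union, not inside its span, so that each basis
    vector comes from a single piece.\<close>
  define U where "U = (\<Union>P\<in>\<Q>. range (blinfun_apply (A o\<^sub>L P)))"
  obtain C where C: "C \<subseteq> U" "complex_vector.independent C" "U \<subseteq> complex_vector.span C"
      "card C = complex_vector.dim U"
    using complex_vector.basis_exists[of U] by blast
  have rng: "range (blinfun_apply (A o\<^sub>L Q)) \<subseteq> complex_vector.span C"
  proof
    fix z assume "z \<in> range (blinfun_apply (A o\<^sub>L Q))"
    then obtain x where "z = A (Q x)" by auto
    then have "z = (\<Sum>P\<in>\<Q>. A (blinfun_apply P x))" by (simp add: blinfun_sum_apply blinfun.sum_right flip: \<Q>(2))
    moreover have "A (P x) \<in> complex_vector.span C" if "P \<in> \<Q>" for P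
      using C(3) that by (auto simp: U_def)
    ultimately show "z \<in> complex_vector.span C" by (simp add: complex_vector.span_sum)
  qed
  have "\<exists>S\<subseteq>C. finite S \<and> card S = k"
  proof (cases "finite C")
    case True
    then have "rank_op (A o\<^sub>L Q) \<le> enat (card C)" unfolding rank_op_le_iff using rng
      by (intro exI[of _ C]) simp
    from order_trans[OF k this] have "k \<le> card C" by simp
    then obtain S where "S \<subseteq> C" "card S = k" "finite S" by (rule obtain_subset_with_card_n)
    then show ?thesis by blast
  next
    case False
    from infinite_arbitrarily_large[OF this, of k] show ?thesis by blast
  qed
  then obtain C' where C': "C' \<subseteq> C" "finite C'" "card C' = k" by blast
  have "\<forall>c\<in>C'. \<exists>P. P \<in> \<Q> \<and> c \<in> range (blinfun_apply (A o\<^sub>L P))"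
  proof
    fix c assume "c \<in> C'"
    then have "c \<in> U" using C'(1) C(1) by (meson subsetD)
    then show "\<exists>P. P \<in> \<Q> \<and> c \<in> range (blinfun_apply (A o\<^sub>L P))" by (auto simp: U_def)
  qed
  from bchoice[OF this] obtain p where p: "\<forall>c\<in>C'. p c \<in> \<Q> \<and> c \<in> range (blinfun_apply (A o\<^sub>L p c))" ..
  define \<R> where "\<R> = p ` C'"
  define \<A> where "\<A> = {P \<in> \<R>. rank_op P \<le> 1}"
  have R: "\<R> \<subseteq> \<Q>" "finite \<R>" "card \<R> \<le> k"
    using p C'(2,3) card_image_le[OF C'(2), of p] by (auto simp: \<R>_def)
  have sub: "\<A> \<subseteq> \<Q>" "\<R> - \<A> \<subseteq> \<Q>" using R(1) by (auto simp: \<A>_def)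
  have cards: "card \<A> \<le> k" "card (\<R> - \<A>) \<le> k" "finite \<A>"
    using R card_mono[OF R(2), of \<A>] card_mono[OF R(2), of "\<R> - \<A>"] finite_subset[of \<A> \<R>]
    by (auto simp: \<A>_def)
  let ?P = "\<Sum>\<A>" and ?S = "\<Sum>(\<R> - \<A>)"
  have PPs: "?P \<in> PP" "?S \<in> PP"
    using orth_family_sum(1) orth_family_subset[OF \<Q>(1)] sub by blast+
  have PS: "?P + ?S = \<Sum>\<R>"
    using sum.subset_diff[of \<A> \<R> "\<lambda>E. E"] R(2) by (auto simp: \<A>_def add.commute)
  have disj: "?P (?S x) = 0" for x
  proof -
    have "?P (?S x) = (\<Sum>R\<in>\<R> - \<A>. ?P (blinfun_apply R x))" by (simp add: blinfun_sum_apply[of "\<R> - \<A>"] blinfun.sum_right)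
    also have "\<dots> = (\<Sum>R\<in>\<R> - \<A>. 0)"
      using orth_family_sum(3)[OF \<Q>(1) sub(1)] sub(2) by (intro sum.cong refl) blast
    finally show ?thesis by simp
  qed
  have belowQ: "below (\<Sum>\<B>) Q" if "\<B> \<subseteq> \<Q>" for \<B>
  proof -
    have "Q ((\<Sum>\<B>) x) = (\<Sum>P\<in>\<B>. Q (blinfun_apply P x))" for x by (simp add: blinfun_sum_apply blinfun.sum_right)
    moreover have "(\<Sum>P\<in>\<B>. Q (blinfun_apply P x)) = (\<Sum>P\<in>\<B>. blinfun_apply P x)" for x
      using orth_family_sum(2)[OF \<Q>(1)] \<Q>(2) that by (intro sum.cong refl) blast
    ultimately show ?thesis by (simp add: below_def blinfun_sum_apply)
  qed
  have small: "norm (?S w) < \<epsilon>" if w: "w \<in> W" for w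
  proof -
    have "norm (?S w) \<le> (\<Sum>P\<in>\<R> - \<A>. norm (blinfun_apply P w))"
      unfolding blinfun_sum_apply by (rule norm_sum)
    also have "\<dots> \<le> (\<Sum>P\<in>\<R> - \<A>. \<delta>)"
    proof (rule sum_mono)
      fix P assume "P \<in> \<R> - \<A>"
      then have "P \<in> \<Q>" "\<not> rank_op P \<le> 1" using R(1) by (auto simp: \<A>_def)
      then show "norm (P w) \<le> \<delta>" using \<Q>(3) w less_imp_le by blast
    qed
    also have "\<dots> \<le> real k * \<delta>" using cards(2) \<delta> by (simp add: mult_right_mono)
    also have "\<dots> < \<epsilon>" using W(2) by (simp add: \<delta>_def divide_less_eq field_simps)
    finally show ?thesis .
  qed
  have "C' \<subseteq> range (blinfun_apply (A o\<^sub>L (?P + ?S)))"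
  proof
    fix c assume c: "c \<in> C'"
    then obtain x where x: "c = A (p c x)" using p by auto
    \<comment> \<open>The partial sum acts as the identity on the range of the piece
      \<open>p c\<close>, so every chosen vector is still attained.\<close>
    have "p c \<in> \<R>" using c by (simp add: \<R>_def)
    then have "(\<Sum>\<R>) (p c x) = p c x" by (rule orth_family_sum(2)[OF orth_family_subset[OF \<Q>(1) R(1)]])
    then have "c = (A o\<^sub>L (?P + ?S)) (p c x)" using x by (simp add: PS)
    then show "c \<in> range (blinfun_apply (A o\<^sub>L (?P + ?S)))" by (rule range_eqI)
  qed
  then have "enat k \<le> rank_op (A o\<^sub>L (?P + ?S))"
    using independent_card_le_rank_op[OF complex_vector.independent_mono[OF C(2) C'(1)] C'(2)] C'(3) by simp
  moreover have "rank_op ?P \<le> enat k"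
  proof (rule order_trans)
    show "rank_op ?P \<le> enat (card \<A>)"
      by (rule rank_op_sum_le[OF cards(3)]) (simp add: \<A>_def)
    show "enat (card \<A>) \<le> enat k" using cards(1) by simp
  qed
  moreover have "?P = 0" if none: "\<forall>E\<in>PP. rank_op E \<le> 1 \<longrightarrow> E = 0"
  proof (intro sum.neutral ballI)
    fix E assume E: "E \<in> \<A>"
    then have "E \<in> PP" using sub(1) \<Q>(1) unfolding orth_family_def by (meson subsetD)
    moreover have "rank_op E \<le> 1" using E by (simp add: \<A>_def)
    ultimately show "E = 0" using none by simp
  qed
  ultimately show ?thesis
    by (intro bexI[OF _ PPs(1)] bexI[OF _ PPs(2)] conjI allI ballI impI disj small
        belowQ[OF sub(1)] belowQ[OF sub(2)])
qed

text \<open>Pieces on the left of \<open>A\<close> are pieces on the right of its adjoint.\<close>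

lemma select_pieces_left:
  assumes A: "A \<in> BH" and Q: "Q \<in> PP" and k: "enat k \<le> rank_op (Q o\<^sub>L A)" and W: "finite W" "\<epsilon> > 0"
  shows "\<exists>P\<in>PP. \<exists>S\<in>PP. (\<forall>x. blinfun_apply P (blinfun_apply S x) = 0) \<and> below P Q \<and> below S Q \<and> rank_op P \<le> enat k \<and>
    ((\<forall>E\<in>PP. rank_op E \<le> 1 \<longrightarrow> E = 0) \<longrightarrow> P = 0) \<and>
    (\<forall>w\<in>W. norm (blinfun_apply S w) < \<epsilon>) \<and> enat k \<le> rank_op ((P + S) o\<^sub>L A)"
proof -
  obtain B where B: "B \<in> BH" "is_adjoint B A" using adjoint_exists[OF A] by blast
  have adj: "is_adjoint (B o\<^sub>L R) (R o\<^sub>L A)" if "R \<in> PP" for R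
    using B(2) PP_csa[OF that] by (simp add: is_adjoint_def)
  have "enat k \<le> rank_op (B o\<^sub>L Q)" by (rule rank_op_adjoint_ge[OF adj[OF Q] k])
  from select_pieces_right[OF B(1) Q this W]
  obtain P S where PS: "P \<in> PP" "S \<in> PP" "\<forall>x. P (S x) = 0" "below P Q" "below S Q" "rank_op P \<le> enat k"
    "(\<forall>E\<in>PP. rank_op E \<le> 1 \<longrightarrow> E = 0) \<longrightarrow> P = 0"
    "\<forall>w\<in>W. norm (S w) < \<epsilon>" "enat k \<le> rank_op (B o\<^sub>L (P + S))" by blast
  have "P + S \<in> PP" using PP_add[OF PS(1,2)] PS(3) by blast
  then have "enat k \<le> rank_op ((P + S) o\<^sub>L A)"
    by (intro rank_op_adjoint_ge[OF is_adjoint_sym[OF adj] PS(9)])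
  then show ?thesis using PS by blast
qed

end

subsection \<open>The corner argument\<close>

lemma BH_sum: "(\<And>i. i \<in> I \<Longrightarrow> X i \<in> BH) \<Longrightarrow> (\<Sum>i\<in>I. X i) \<in> BH"
  by (induction I rule: infinite_finite_induct) (auto intro: BH_intros)

context masa_algebra
begin

context
  fixes T :: "'a \<Rightarrow>\<^sub>L 'a" and k :: nat
  assumes T: "T \<in> BH"
    and bound: "\<And>P. P \<in> PP \<Longrightarrow> rank_op ((id_blinfun - P) o\<^sub>L T o\<^sub>L P) \<le> enat k"
begin

text \<open>\<open>E\<close> lies under \<open>I - G\<close>, so the block is cut out of
  \<open>(I - G) T G\<close>.\<close>

lemma disjoint_rank:
  assumes E: "E \<in> PP" and G: "G \<in> PP" and EG: "\<And>x. E (G x) = 0"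
  shows "rank_op (E o\<^sub>L T o\<^sub>L G) \<le> enat k"
proof -
  have "E (G x) = 0" "G (E x) = 0" for x using EG PP_commute[OF E G] by simp_all
  then have "E o\<^sub>L T o\<^sub>L G = E o\<^sub>L ((id_blinfun - G) o\<^sub>L T o\<^sub>L G)"
    by (intro blinfun_eqI) (simp add: blinfun.bilinear_simps)
  then have "rank_op (E o\<^sub>L T o\<^sub>L G) \<le> rank_op ((id_blinfun - G) o\<^sub>L T o\<^sub>L G)"
    using rank_op_compose_left[OF PP_BH[OF E]] by simp
  also have "\<dots> \<le> enat k" by (rule bound[OF G])
  finally show ?thesis .
qed

text \<open>A block \<open>Q T P\<close> of maximal rank determines all blocks of \<open>T\<close> that can be added to
  it: the bordered block still has rank at most \<open>k\<close>.\<close>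

lemma maximal_block_determines:
  assumes P: "P \<in> PP" and Q: "Q \<in> PP" and QP: "\<And>x. Q (P x) = 0"
    and k: "enat k \<le> rank_op (Q o\<^sub>L T o\<^sub>L P)"
  shows "\<exists>K\<in>BH. rank_op K \<le> enat k \<and> (\<forall>E\<in>PP. \<forall>G\<in>PP. (\<forall>x. blinfun_apply E (blinfun_apply G x) = 0) \<longrightarrow>
    (\<forall>x. blinfun_apply E (P x) = 0) \<longrightarrow> (\<forall>x. blinfun_apply G (Q x) = 0) \<longrightarrow>
    (\<forall>x. blinfun_apply E (T (blinfun_apply G x)) = E (K (G x))))"
proof -
  obtain x0 y0 :: "nat \<Rightarrow> 'a" where xy0:
    "\<forall>i<k. \<forall>j<k. cinner ((Q o\<^sub>L T o\<^sub>L P) (x0 i)) (y0 j) = (if i = j then 1 else 0)"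
    using rank_op_ge_biorthogonal[OF k] by blast
  define x where "x i = P (x0 i)" for i
  define y where "y i = Q (y0 i)" for i
  have xy: "cinner (T (x i)) (y j) = (if i = j then 1 else 0)" if "i < k" "j < k" for i j
    using xy0 that by (simp add: x_def y_def PP_csa[OF Q])
  have "\<forall>i. \<exists>X\<in>BH. \<forall>z. blinfun_apply X z = cinner z (y i) *\<^sub>C T (x i)"
    using rank_one_operator_exists by blast
  from choice[OF this[unfolded Bex_def]] obtain X where
    X: "\<forall>i. X i \<in> BH \<and> (\<forall>z. blinfun_apply (X i) z = cinner z (y i) *\<^sub>C T (x i))" ..
  \<comment> \<open>The Schur formula \<open>T P (Q T P)^(-1) Q T\<close>, with the biorthogonal
    system standing for the inverse; it does not depend on the bordering \<open>E\<close>,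
    \<open>G\<close>.\<close>
  define K where "K = (\<Sum>i<k. X i) o\<^sub>L T"
  have K: "K h = (\<Sum>i<k. cinner (T h) (y i) *\<^sub>C T (x i))" for h
    using X by (simp add: K_def blinfun.sum_left)
  have KBH: "K \<in> BH" unfolding K_def using X by (intro BH_compose BH_sum T) blast
  have "rank_op K \<le> enat k"
    unfolding rank_op_le_iff
  proof (intro exI conjI)
    show "finite ((\<lambda>i. T (x i)) ` {..<k})" by simp
    show "card ((\<lambda>i. T (x i)) ` {..<k}) \<le> k" using card_image_le[of "{..<k}" "\<lambda>i. T (x i)"] by simp
    show "range (blinfun_apply K) \<subseteq> complex_vector.span ((\<lambda>i. T (x i)) ` {..<k})"
    proof
      fix u assume "u \<in> range (blinfun_apply K)"
      then obtain h where u: "u = K h" by auto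
      show "u \<in> complex_vector.span ((\<lambda>i. T (x i)) ` {..<k})"
        unfolding u K
        by (rule complex_vector.span_sum, rule complex_vector.span_scale, rule complex_vector.span_base) simp
    qed
  qed
  moreover have "E (T (G z)) = E (K (G z))" if E: "E \<in> PP" and G: "G \<in> PP" and EG: "\<And>x. E (G x) = 0"
    and EP: "\<And>x. E (P x) = 0" and GQ: "\<And>x. G (Q x) = 0"
    for E :: "'a \<Rightarrow>\<^sub>L 'a" and G :: "'a \<Rightarrow>\<^sub>L 'a" and z
  proof -
    have QG: "Q (G x) = 0" for x using GQ PP_commute[OF Q G] by simp
    \<comment> \<open>The joins of \<open>E\<close> with \<open>Q\<close> and of \<open>G\<close>
      with \<open>P\<close>. They are disjoint because the four products \<open>E G\<close>,
      \<open>E P\<close>, \<open>Q G\<close>, \<open>Q P\<close> vanish.\<close>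
    define E' where "E' = id_blinfun - ((id_blinfun - E) o\<^sub>L (id_blinfun - Q))"
    define G' where "G' = id_blinfun - ((id_blinfun - G) o\<^sub>L (id_blinfun - P))"
    have E': "E' \<in> PP" and G': "G' \<in> PP"
      unfolding E'_def G'_def by (intro PP_compl PP_compose E G P Q)+
    have E'x: "E' x = Q x + E (x - Q x)" and G'x: "G' x = P x + G (x - P x)" for x
      by (simp_all add: E'_def G'_def blinfun.bilinear_simps)
    have "E' (G' x) = 0" for x by (simp add: E'x G'x blinfun.bilinear_simps QP QG EG EP)
    then have rk: "rank_op (E' o\<^sub>L T o\<^sub>L G') \<le> enat k" by (rule disjoint_rank[OF E' G'])
    have E'y: "E' (y i) = y i" and G'xi: "G' (x i) = x i" and G'G: "G' (G z) = G z" for i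
      using Q P G PP_commute[OF P G, of z] PP_commute[OF P G]
      by (simp_all add: E'x G'x y_def x_def blinfun.bilinear_simps)
    have EE': "E (E' v) = E v" for v
      using E PP_commute[OF E Q] by (simp add: E'x blinfun.bilinear_simps)
    \<comment> \<open>\<open>G z\<close> is corrected so that \<open>T w\<close> is orthogonal to
      all \<open>y j\<close>; applying \<open>E T\<close> to \<open>w\<close> gives
      \<open>E (T - K) G z\<close>.\<close>
    define w where "w = G z - (\<Sum>i<k. cinner (T (G z)) (y i) *\<^sub>C x i)"
    have Tsum: "T (\<Sum>i<k. c i *\<^sub>C x i) = (\<Sum>i<k. c i *\<^sub>C T (x i))" for c
      by (simp add: blinfun.sum_right BH_scaleC[OF T])
    have G'w: "G' w = w"
      by (simp add: w_def blinfun.diff_right blinfun.sum_right BH_scaleC[OF PP_BH[OF G']] G'xi G'G)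
    define v where "v = E' (T w)"
    have vy: "cinner v (y j) = 0" if j: "j < k" for j
    proof -
      have "cinner v (y j) = cinner (T w) (y j)" by (simp add: v_def PP_csa[OF E'] E'y)
      also have "\<dots> = cinner (T (G z)) (y j) - (\<Sum>i<k. cinner (T (G z)) (y i) * cinner (T (x i)) (y j))"
        by (simp add: w_def blinfun.diff_right Tsum cinner_diff_left cinner_sum_left cinner_scaleC_left)
      also have "(\<Sum>i<k. cinner (T (G z)) (y i) * cinner (T (x i)) (y j)) =
          (\<Sum>i\<in>{j}. cinner (T (G z)) (y i) * cinner (T (x i)) (y j))"
        using j xy by (intro sum.mono_neutral_right) auto
      finally show ?thesis using xy[OF j j] by simp
    qed
    \<comment> \<open>Otherwise \<open>v\<close> would extend the certificate of the block to one of
      length \<open>k + 1\<close> for the bordered block.\<close>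
    have "v = 0"
    proof (rule ccontr)
      assume v0: "v \<noteq> 0"
      define b where "b i = E' (T (x i))" for i
      have b_y: "cinner (b i) (y j) = (if i = j then 1 else 0)" if "i < k" "j < k" for i j
        using xy[OF that] by (simp add: b_def PP_csa[OF E'] E'y)
      \<comment> \<open>Correction by the \<open>y j\<close> removes the pairing with the old
        vectors \<open>b i\<close>; the pairing with \<open>v\<close> is unaffected, since
        \<open>v\<close> is orthogonal to the \<open>y j\<close>, and is normalised to 1.\<close>
      define yk where "yk = (1 / cnj (cinner v v)) *\<^sub>C (v - (\<Sum>j<k. cnj (cinner (b j) v) *\<^sub>C y j))"
      define x' where "x' i = (if i < k then x i else w)" for i
      define y' where "y' i = (if i < k then y i else yk)" for i
      have sumr: "cinner u (\<Sum>j<k. cnj (c j) *\<^sub>C y j) = (\<Sum>j<k. c j * cinner u (y j))" for u c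
        using cinner_commute[of u "\<Sum>j<k. cnj (c j) *\<^sub>C y j"]
        by (simp add: cinner_sum_left cinner_scaleC_left cinner_commute[of "y _" u])
      have biv: "cinner (b i) yk = 0" if i: "i < k" for i
      proof -
        have "(\<Sum>j<k. cinner (b j) v * cinner (b i) (y j)) = (\<Sum>j\<in>{i}. cinner (b j) v * cinner (b i) (y j))"
          using i b_y by (intro sum.mono_neutral_right) auto
        then have "cinner (b i) (v - (\<Sum>j<k. cnj (cinner (b j) v) *\<^sub>C y j)) = 0"
          using b_y[OF i i] by (simp add: cinner_diff_right sumr)
        then show ?thesis by (simp only: yk_def cinner_scaleC_right) simp
      qed
      have "cinner v (v - (\<Sum>j<k. cnj (cinner (b j) v) *\<^sub>C y j)) = cinner v v"
        by (simp add: cinner_diff_right sumr vy)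
      then have vv: "cinner v yk = 1" using v0 by (simp only: yk_def cinner_scaleC_right) simp
      have "enat (Suc k) \<le> rank_op (E' o\<^sub>L T o\<^sub>L G')"
      proof (rule nearly_biorthogonal_rank_op_ge[of "Suc k" _ x' y'])
        fix i j assume ij: "i < Suc k" "j < Suc k"
        have "(E' o\<^sub>L T o\<^sub>L G') (x' i) = (if i < k then b i else v)"
          by (simp add: x'_def b_def v_def G'xi G'w)
        then have "cinner ((E' o\<^sub>L T o\<^sub>L G') (x' i)) (y' j) = (if i = j then 1 else 0)"
          using ij b_y vy biv vv by (auto simp: y'_def less_Suc_eq)
        then show "cmod (cinner ((E' o\<^sub>L T o\<^sub>L G') (x' i)) (y' j) - (if i = j then 1 else 0)) < 1 / (real (Suc k) + 1)"
          by simp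
      qed
      from order_trans[OF this rk] show False by simp
    qed
    then have "E (T w) = 0" using EE'[of "T w"] by (simp add: v_def blinfun.zero_right)
    then show ?thesis by (simp add: w_def blinfun.diff_right Tsum K)
  qed
  ultimately show ?thesis using KBH by (intro bexI[of _ K] conjI ballI allI impI) blast+
qed

text \<open>\<open>Y = T - K\<close> has zero blocks on all admissible pairs. The pairs
  \<open>M R\<close>, \<open>M (I - R)\<close>, in both orders, make the corner \<open>M Y M\<close>
  commute with every projection \<open>R\<close>. The pairs \<open>(Q, I - Q)\<close> and
  \<open>(I - P, P)\<close> give \<open>Q Y (I - Q) = 0\<close> and \<open>(I - P) Y P = 0\<close>,
  so that, once the corner is removed, the kernel of \<open>Q\<close> is sent into the range of
  \<open>P\<close>.\<close>

lemma corner_decomposition: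
  assumes P: "P \<in> PP" and Q: "Q \<in> PP" and QP: "\<And>x. Q (P x) = 0"
    and k: "enat k \<le> rank_op (Q o\<^sub>L T o\<^sub>L P)"
  shows "\<exists>K\<in>BH. \<exists>D\<in>\<D>. rank_op K \<le> enat k \<and>
    (\<forall>x. blinfun_apply D x = (id_blinfun - (P + Q)) ((T - K) ((id_blinfun - (P + Q)) x))) \<and>
    T - D = K + (P o\<^sub>L (T - K - D)) + ((id_blinfun - P) o\<^sub>L (T - K - D) o\<^sub>L Q)"
proof -
  have PQ: "P (Q x) = 0" for x using QP PP_commute[OF P Q] by simp
  obtain K where K: "K \<in> BH" "rank_op K \<le> enat k" and
    det: "\<forall>E\<in>PP. \<forall>G\<in>PP. (\<forall>x. blinfun_apply E (blinfun_apply G x) = 0) \<longrightarrow>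
    (\<forall>x. blinfun_apply E (P x) = 0) \<longrightarrow> (\<forall>x. blinfun_apply G (Q x) = 0) \<longrightarrow>
    (\<forall>x. blinfun_apply E (T (blinfun_apply G x)) = E (K (G x)))"
    using maximal_block_determines[OF P Q QP k] by blast
  define Y where "Y = T - K"
  have Y: "E (Y (G x)) = 0" if "E \<in> PP" "G \<in> PP" "\<And>x. E (G x) = 0" "\<And>x. E (P x) = 0" "\<And>x. G (Q x) = 0" for E G x
    using det[rule_format, OF that] by (simp add: Y_def blinfun.bilinear_simps)
  define M where "M = id_blinfun - (P + Q)"
  have M: "M \<in> PP" unfolding M_def by (intro PP_compl PP_add P Q PQ)
  have Mx: "M x = x - (P x + Q x)" for x by (simp add: M_def blinfun.bilinear_simps)
  have MP: "M (P x) = 0" and MQ: "M (Q x) = 0" and PM: "P (M x) = 0" and QM: "Q (M x) = 0" for x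
    using P Q by (simp_all add: Mx blinfun.bilinear_simps PQ QP)
  define D where "D = M o\<^sub>L Y o\<^sub>L M"
  have Dx: "D x = M (Y (M x))" for x by (simp add: D_def)
  have D: "D \<in> \<D>"
  proof (rule PP_commutant_in_D)
    show "D \<in> BH" unfolding D_def Y_def by (intro BH_intros PP_BH[OF M] T K(1))
    fix R x assume R: "R \<in> PP"
    let ?R' = "id_blinfun - R"
    have R': "?R' \<in> PP" by (rule PP_compl[OF R])
    have RR': "R (?R' x) = 0" "?R' (R x) = 0" for x using R by (simp_all add: blinfun.bilinear_simps)
    have z1: "(M o\<^sub>L R) (Y ((M o\<^sub>L ?R') x)) = 0"
    proof (rule Y[OF PP_compose[OF M R] PP_compose[OF M R']])
      fix x
      show "(M o\<^sub>L R) ((M o\<^sub>L ?R') x) = 0"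
        using PP_commute[OF R M, of "?R' x"] RR'(1)[of x] by (simp add: blinfun.zero_right)
      show "(M o\<^sub>L R) (P x) = 0" using PP_commute[OF R P, of x] MP by simp
      show "(M o\<^sub>L ?R') (Q x) = 0" using PP_commute[OF R' Q, of x] MQ by simp
    qed
    have z2: "(M o\<^sub>L ?R') (Y ((M o\<^sub>L R) x)) = 0"
    proof (rule Y[OF PP_compose[OF M R'] PP_compose[OF M R]])
      fix x
      show "(M o\<^sub>L ?R') ((M o\<^sub>L R) x) = 0"
        using PP_commute[OF R' M, of "R x"] RR'(2)[of x] by (simp add: blinfun.zero_right)
      show "(M o\<^sub>L ?R') (P x) = 0" using PP_commute[OF R' P, of x] MP by simp
      show "(M o\<^sub>L R) (Q x) = 0" using PP_commute[OF R Q, of x] MQ by simp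
    qed
    have "D (R x) = M (Y (M (R x)))" by (rule Dx)
    also have "\<dots> = M (R (Y (M (R x))))" using z2 by (simp add: blinfun.bilinear_simps)
    also have "\<dots> = M (R (Y (M x)))" using z1 by (simp add: blinfun.bilinear_simps)
    also have "\<dots> = R (D x)" unfolding Dx by (rule PP_commute[OF M R])
    finally show "D (R x) = R (D x)" .
  qed
  define X where "X = Y - D"
  have QYQ: "Q (Y (x - Q x)) = 0" for x
  proof -
    have "Q (Y ((id_blinfun - Q) x)) = 0"
      using Q QP by (intro Y[OF Q PP_compl[OF Q]]) (simp_all add: blinfun.bilinear_simps)
    then show ?thesis by (simp add: blinfun.bilinear_simps)
  qed
  have PYP: "Y (P x) = P (Y (P x))" for x
  proof -
    have "(id_blinfun - P) (Y (P x)) = 0"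
      using P PQ by (intro Y[OF PP_compl[OF P] P]) (simp_all add: blinfun.bilinear_simps)
    then show ?thesis by (simp add: blinfun.bilinear_simps)
  qed
  have DP: "D (P x) = 0" for x by (simp add: Dx MP blinfun.zero_right)
  \<comment> \<open>The kernel of \<open>Q\<close> is the sum of the ranges of \<open>P\<close> and
    \<open>M\<close>, which are treated separately.\<close>
  have key: "X (x - Q x) = P (X (x - Q x))" for x
  proof -
    have 1: "X (P x) = P (X (P x))" using PYP[of x] by (simp add: X_def blinfun.bilinear_simps DP)
    have Q0: "Q (Y (M x)) = 0" using QYQ[of "M x"] by (simp add: QM)
    have "M (Y (M x)) = Y (M x) - P (Y (M x))" using Q0 by (simp add: Mx[of "Y (M x)"])
    moreover have "D (M x) = M (Y (M x))" using M by (simp add: Dx)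
    ultimately have "X (M x) = P (Y (M x))" by (simp add: X_def blinfun.diff_left)
    then have 2: "X (M x) = P (X (M x))" using P by simp
    have split: "x - Q x = P x + M x" by (simp add: Mx)
    show ?thesis unfolding split blinfun.add_right using 1 2 by simp
  qed
  have "T - D = K + (P o\<^sub>L X) + ((id_blinfun - P) o\<^sub>L X o\<^sub>L Q)"
  proof (rule blinfun_eqI)
    fix x
    have "X x - X (Q x) = P (X x) - P (X (Q x))" using key[of x] by (simp add: blinfun.bilinear_simps)
    then show "(T - D) x = (K + (P o\<^sub>L X) + ((id_blinfun - P) o\<^sub>L X o\<^sub>L Q)) x"
      by (simp add: blinfun.bilinear_simps X_def Y_def algebra_simps)
  qed
  then show ?thesis
    using K D Dx unfolding X_def Y_def M_def
    by (intro bexI[OF _ K(1)] bexI[OF _ D] conjI allI) simp_all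
qed

end

end

subsection \<open>Rank estimates for the perturbation\<close>

lemma rank_op_sandwich: "A \<in> BH \<Longrightarrow> rank_op (A o\<^sub>L B o\<^sub>L C) \<le> rank_op B"
  by (rule order_trans[OF rank_op_compose_right rank_op_compose_left])

text \<open>Presents the span as an intersection of kernels of continuous functionals, from which
  closedness follows.\<close>

lemma span_eq_biorthogonal:
  assumes "finite B"
  shows "complex_vector.span B = (\<Inter>z\<in>{z. \<forall>b\<in>B. cinner b z = 0}. {x. cinner x z = 0})"
proof (intro equalityI subsetI)
  fix x assume x: "x \<in> complex_vector.span B"
  show "x \<in> (\<Inter>z\<in>{z. \<forall>b\<in>B. cinner b z = 0}. {x. cinner x z = 0})"
    using cinner_span_eq_0[OF _ x] by blast
next
  fix x assume x: "x \<in> (\<Inter>z\<in>{z. \<forall>b\<in>B. cinner b z = 0}. {x. cinner x z = 0})"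
  obtain p where p: "p \<in> complex_vector.span B" "\<forall>b\<in>B. cinner b (x - p) = 0"
    using finite_orthogonal_decomposition[OF assms] by blast
  have "cinner x (x - p) = 0" using x p(2) by blast
  moreover have "cinner p (x - p) = 0" by (rule cinner_span_eq_0[OF _ p(1)]) (use p(2) in blast)
  ultimately have "cinner (x - p) (x - p) = 0" by (simp only: cinner_diff_left diff_self)
  then have "x = p" by simp
  then show "x \<in> complex_vector.span B" using p(1) by simp
qed

lemma continuous_on_cinner_left: "continuous_on S (\<lambda>x. cinner x z)"
proof -
  have "cinner x z = complex_of_real (inner x z) + \<i> * complex_of_real (inner x (\<i> *\<^sub>C z))" for x
    by (simp add: complex_eq_iff inner_imaginary_right inner_eq_Re_cinner[of x z])
  then show ?thesis by (simp only:) (intro continuous_intros)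
qed

lemma closed_complex_span_finite: "finite B \<Longrightarrow> closed (complex_vector.span B)"
  unfolding span_eq_biorthogonal
  by (intro closed_INT ballI closed_Collect_eq continuous_on_const continuous_on_cinner_left)

context masa_algebra
begin

text \<open>Operator form of a normalised indicator function of an atom; it keeps the rank estimates
  free of measure theory.\<close>

definition point_vector :: "'a \<Rightarrow> bool"
  where "point_vector e \<longleftrightarrow> norm e = 1 \<and> (\<forall>P\<in>PP. P e = 0 \<or> P e = e)"

text \<open>A projection of the masa sends each point vector to 0 or to itself, so the span is
  invariant and its projection belongs to the masa.\<close>

lemma point_vector_span_projection:
  assumes B: "finite B" "\<And>b. b \<in> B \<Longrightarrow> point_vector b"
  shows "\<exists>A\<in>PP. (\<forall>x. A x \<in> complex_vector.span B) \<and> (\<forall>x\<in>complex_vector.span B. A x = x)"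
proof -
  obtain A where A: "orth_proj A" "range (blinfun_apply A) = complex_vector.span B"
      "\<forall>x. A x = x \<longleftrightarrow> x \<in> complex_vector.span B"
    using orth_proj_exists[OF complex_vector.subspace_span closed_complex_span_finite[OF B(1)]] by blast
  have "A \<in> PP"
  proof (rule orth_proj_in_PP[OF A(1)])
    fix P x assume P: "P \<in> PP" and x: "A x = x"
    interpret P: Vector_Spaces.linear "(*\<^sub>C)" "(*\<^sub>C)" "blinfun_apply P" by (rule BH_linear[OF PP_BH[OF P]])
    have "P b \<in> complex_vector.span B" if "b \<in> B" for b
      using B(2)[OF that] P that complex_vector.span_base[of b B] complex_vector.span_zero[of B]
      unfolding point_vector_def by metis
    then have "blinfun_apply P ` B \<subseteq> complex_vector.span B" by blast
    then have "complex_vector.span (blinfun_apply P ` B) \<subseteq> complex_vector.span B"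
      by (rule complex_vector.span_minimal[OF _ complex_vector.subspace_span])
    then have "P x \<in> complex_vector.span B" using x A(3) P.span_image[of B] by blast
    then show "A (P x) = P x" using A(3) by blast
  qed
  then show ?thesis using A by blast
qed

text \<open>The closed span of all point vectors is invariant under the masa projections. A nonzero
  complement would be a projection of the masa and fix another point vector, so the point vectors
  span a dense subspace.\<close>

lemma point_vectors_approximate:
  assumes atomic: "\<And>R. R \<in> PP \<Longrightarrow> R \<noteq> 0 \<Longrightarrow> \<exists>e. point_vector e \<and> R e = e"
    and W: "finite W" "\<epsilon> > 0"
  shows "\<exists>A\<in>PP. \<exists>B. finite B \<and> (\<forall>b\<in>B. point_vector b) \<and> (\<forall>x. A x \<in> complex_vector.span B) \<and>
    (\<forall>w\<in>W. norm (w - A w) < \<epsilon>)"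
proof -
  define E where "E = {e. point_vector e}"
  define V where "V = closure (complex_vector.span E)"
  have "complex_vector.subspace V"
    unfolding complex_vector.subspace_def
  proof (intro conjI ballI allI)
    show "0 \<in> V" unfolding V_def using closure_subset complex_vector.span_zero by blast
    show "x + y \<in> V" if "x \<in> V" "y \<in> V" for x y
    proof -
      obtain f g where f: "\<forall>n. f n \<in> complex_vector.span E" "f \<longlonglongrightarrow> x"
        and g: "\<forall>n. g n \<in> complex_vector.span E" "g \<longlonglongrightarrow> y"
        using \<open>x \<in> V\<close> \<open>y \<in> V\<close> unfolding V_def closure_sequential by blast
      show ?thesis unfolding V_def closure_sequential
        by (intro exI[of _ "\<lambda>n. f n + g n"] conjI allI tendsto_add f(2) g(2)
            complex_vector.span_add f(1)[rule_format] g(1)[rule_format])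
    qed
    show "c *\<^sub>C x \<in> V" if "x \<in> V" for c x
    proof -
      obtain f where f: "\<forall>n. f n \<in> complex_vector.span E" "f \<longlonglongrightarrow> x"
        using \<open>x \<in> V\<close> unfolding V_def closure_sequential by blast
      show ?thesis unfolding V_def closure_sequential
        by (intro exI[of _ "\<lambda>n. c *\<^sub>C f n"] conjI allI complex_vector.span_scale f(1)[rule_format]
            bounded_linear.tendsto[OF bounded_linear_scaleC f(2)])
    qed
  qed
  moreover have "closed V" by (simp add: V_def)
  ultimately obtain R where R: "orth_proj R" "range (blinfun_apply R) = V" "\<forall>x. R x = x \<longleftrightarrow> x \<in> V"
    using orth_proj_exists[of V] by blast
  have "R \<in> PP"
  proof (rule orth_proj_in_PP[OF R(1)])
    fix P x assume P: "P \<in> PP" and x: "R x = x"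
    interpret P: Vector_Spaces.linear "(*\<^sub>C)" "(*\<^sub>C)" "blinfun_apply P" by (rule BH_linear[OF PP_BH[OF P]])
    have "P b \<in> complex_vector.span E" if "b \<in> E" for b
      using P that complex_vector.span_base[of b E] complex_vector.span_zero[of E]
      unfolding E_def point_vector_def by fastforce
    then have "blinfun_apply P ` E \<subseteq> complex_vector.span E" by blast
    then have "complex_vector.span (blinfun_apply P ` E) \<subseteq> complex_vector.span E"
      by (rule complex_vector.span_minimal[OF _ complex_vector.subspace_span])
    then have PE: "P z \<in> complex_vector.span E" if "z \<in> complex_vector.span E" for z
      using that P.span_image[of E] by blast
    have "x \<in> V" using x R(3) by blast
    then obtain f where f: "\<forall>n. f n \<in> complex_vector.span E" "f \<longlonglongrightarrow> x"
      unfolding V_def closure_sequential by blast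
    have "P x \<in> V" unfolding V_def closure_sequential
      by (intro exI[of _ "\<lambda>n. P (f n)"] conjI allI PE f(1)[rule_format] blinfun.tendsto tendsto_const f(2))
    then show "R (P x) = P x" using R(3) by blast
  qed
  have "id_blinfun - R = 0"
  proof (rule ccontr)
    assume "id_blinfun - R \<noteq> 0"
    then obtain e where e: "point_vector e" "(id_blinfun - R) e = e"
      using atomic[OF PP_compl[OF \<open>R \<in> PP\<close>]] by blast
    have "e \<in> V" unfolding V_def using e(1) complex_vector.span_base[of e E] closure_subset[of "complex_vector.span E"]
      by (auto simp: E_def)
    then have "R e = e" using R(3) by blast
    then have "e = 0" using e(2) by (simp add: blinfun.bilinear_simps)
    then show False using e(1) by (simp add: point_vector_def)
  qed
  then have "R = id_blinfun" by simp
  then have "R x = x" for x by simp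
  then have VU: "x \<in> V" for x using R(3) by blast
  have "\<exists>B v. finite B \<and> B \<subseteq> E \<and> v \<in> complex_vector.span B \<and> norm (w - v) < \<epsilon>" for w
  proof -
    obtain v where v: "v \<in> complex_vector.span E" "dist v w < \<epsilon>"
      using VU[of w] W(2) unfolding V_def closure_approachable by blast
    obtain t r where t: "finite t" "t \<subseteq> E" "v = (\<Sum>a\<in>t. r a *\<^sub>C a)"
      using v(1) unfolding complex_vector.span_explicit by blast
    have "v \<in> complex_vector.span t"
      unfolding t(3) by (rule complex_vector.span_sum, rule complex_vector.span_scale, rule complex_vector.span_base)
    then show ?thesis using t(1,2) v(2) by (auto simp: dist_norm norm_minus_commute)
  qed
  then obtain b v where bv: "\<And>w. finite (b w) \<and> b w \<subseteq> E \<and> v w \<in> complex_vector.span (b w) \<and> norm (w - v w) < \<epsilon>"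
    by metis
  define B where "B = (\<Union>w\<in>W. b w)"
  have B: "finite B" "\<And>e. e \<in> B \<Longrightarrow> point_vector e"
    using W(1) bv by (auto simp: B_def E_def)
  obtain A where A: "A \<in> PP" "\<forall>x. A x \<in> complex_vector.span B" "\<forall>x\<in>complex_vector.span B. A x = x"
    using point_vector_span_projection[OF B] by blast
  have "norm (w - A w) < \<epsilon>" if w: "w \<in> W" for w
  proof -
    have "v w \<in> complex_vector.span B"
      using bv[of w] complex_vector.span_mono[of "b w" B] w by (auto simp: B_def)
    then have "A (v w) = v w" using A(3) by blast
    then have "norm (w - A w) = norm ((id_blinfun - A) (w - v w))" by (simp add: blinfun.bilinear_simps)
    also have "\<dots> \<le> norm (w - v w)" by (rule PP_norm_le[OF PP_compl[OF A(1)]])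
    also have "\<dots> < \<epsilon>" using bv by blast
    finally show ?thesis .
  qed
  then show ?thesis using A B by blast
qed

end

context separable_masa_algebra
begin

text \<open>If \<open>P\<close> is small on the test set, compression by \<open>I - P\<close> keeps
  the rank \<open>r\<close>, so the range of \<open>(I - P) D\<close> is all of the range of
  \<open>D\<close>, and \<open>P D = 0\<close>. As rank-one pieces vanish, the partition principle
  carries \<open>D P = 0\<close> to the identity.\<close>

lemma finite_rank_in_D_eq_0:
  assumes cont: "\<And>P. P \<in> PP \<Longrightarrow> rank_op P \<le> 1 \<Longrightarrow> P = 0"
    and D: "D \<in> \<D>" and fin: "rank_op D < \<infinity>"
  shows "D = 0"
proof -
  obtain r where r: "rank_op D = enat r" using fin by auto
  have "D = id_blinfun o\<^sub>L D o\<^sub>L id_blinfun" by (intro blinfun_eqI) simp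
  then have "enat r \<le> rank_op (id_blinfun o\<^sub>L D o\<^sub>L id_blinfun)" using r by simp
  from rank_op_compression_lsc[OF this] obtain W \<epsilon> where W: "finite W" "\<epsilon> > 0"
    "\<forall>E G. orth_proj E \<longrightarrow> (\<forall>w\<in>W. norm (blinfun_apply E w - id_blinfun w) < \<epsilon> \<and>
      norm (blinfun_apply G w - id_blinfun w) < \<epsilon>) \<longrightarrow> enat r \<le> rank_op (E o\<^sub>L D o\<^sub>L G)" by blast
  have "D o\<^sub>L id_blinfun = 0"
  proof (rule partition_principle[OF W(1,2), of "\<lambda>P. D o\<^sub>L P = 0"])
    show "D o\<^sub>L (P + Q) = 0" if "D o\<^sub>L P = 0" "D o\<^sub>L Q = 0" for P Q
      using that by (simp add: bounded_bilinear.add_right[OF bounded_bilinear_blinfun_compose])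
    show "D o\<^sub>L P = 0" if "P \<in> PP" "rank_op P \<le> 1" for P using cont[OF that] by simp
    show "D o\<^sub>L P = 0" if P: "P \<in> PP" "\<And>w. w \<in> W \<Longrightarrow> norm (P w) < \<epsilon>" for P
    proof -
      let ?M = "id_blinfun - P"
      have M: "?M \<in> PP" by (rule PP_compl[OF P(1)])
      have "enat r \<le> rank_op (?M o\<^sub>L D o\<^sub>L ?M)"
        by (rule W(3)[rule_format]) (use P M in \<open>auto simp: PP_orth_proj blinfun.bilinear_simps\<close>)
      also have "?M o\<^sub>L D o\<^sub>L ?M = ?M o\<^sub>L D"
        using M P(1) PP_D_commute[OF M D] by (intro blinfun_eqI) (metis PP_idem blinfun_apply_blinfun_compose)
      finally obtain C where C: "complex_vector.independent C" "finite C"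
          "C \<subseteq> range (blinfun_apply (?M o\<^sub>L D))" "card C = r"
        using rank_op_ge_independent by blast
      have rM: "range (blinfun_apply (?M o\<^sub>L D)) \<subseteq> range (blinfun_apply D)"
        using PP_D_commute[OF M D] by auto
      \<comment> \<open>\<open>C\<close> has \<open>r\<close> independent members inside the range
        of \<open>D\<close>, which leaves no room for another one.\<close>
      have "D x \<in> complex_vector.span C" for x
      proof (rule ccontr)
        assume n: "D x \<notin> complex_vector.span C"
        then have "complex_vector.independent (insert (D x) C)" "D x \<notin> C"
          using C(1) complex_vector.independent_insertI complex_vector.span_base by blast+
        then have "enat (card (insert (D x) C)) \<le> rank_op D"
          using C(2,3) rM by (intro independent_card_le_rank_op) auto
        then show False using \<open>D x \<notin> C\<close> C(2,4) r by simp
      qed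
      moreover have "complex_vector.span C \<subseteq> {y. P y = 0}"
      proof (rule complex_vector.span_minimal)
        show "C \<subseteq> {y. P y = 0}" using C(3) P(1) by (auto simp: blinfun.bilinear_simps)
        show "complex_vector.subspace {y. P y = 0}"
          by (auto simp: complex_vector.subspace_def blinfun.bilinear_simps BH_scaleC[OF PP_BH[OF P(1)]])
      qed
      ultimately have "P (D x) = 0" for x by blast
      then show ?thesis using PP_D_commute[OF P(1) D] by (intro blinfun_eqI) (simp add: blinfun.zero_left)
    qed
  qed (rule PP_id)
  then show ?thesis by (metis blinfun_apply_blinfun_compose blinfun_apply_id_blinfun blinfun_eqI)
qed

context
  fixes T :: "'a \<Rightarrow>\<^sub>L 'a" and k :: nat
  assumes T: "T \<in> BH"
    and bound: "\<And>P. P \<in> PP \<Longrightarrow> rank_op ((id_blinfun - P) o\<^sub>L T o\<^sub>L P) \<le> enat k"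
    and attained: "\<exists>P\<in>PP. enat k \<le> rank_op ((id_blinfun - P) o\<^sub>L T o\<^sub>L P)"
begin

text \<open>First the right factor is thinned out with \<open>Q T\<close> in front, then the left
  factor against the block already thinned on the right, so that rank \<open>k\<close> survives both
  selections.\<close>

lemma select_block:
  assumes P: "P \<in> PP" and Q: "Q \<in> PP" and k: "enat k \<le> rank_op (Q o\<^sub>L T o\<^sub>L P)"
    and W: "finite W" "\<epsilon> > 0"
  shows "\<exists>Pa\<in>PP. \<exists>Ps\<in>PP. \<exists>Qa\<in>PP. \<exists>Qs\<in>PP. (\<forall>x. blinfun_apply Pa (blinfun_apply Ps x) = 0) \<and> (\<forall>x. blinfun_apply Qa (blinfun_apply Qs x) = 0) \<and>
    below Pa P \<and> below Ps P \<and> below Qa Q \<and> below Qs Q \<and> rank_op Pa \<le> enat k \<and> rank_op Qa \<le> enat k \<and>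
    ((\<forall>E\<in>PP. rank_op E \<le> 1 \<longrightarrow> E = 0) \<longrightarrow> Pa = 0 \<and> Qa = 0) \<and>
    (\<forall>w\<in>W. norm (blinfun_apply Ps w) < \<epsilon>) \<and> (\<forall>w\<in>W. norm (blinfun_apply Qs w) < \<epsilon>) \<and>
    enat k \<le> rank_op ((Qa + Qs) o\<^sub>L T o\<^sub>L (Pa + Ps))"
proof -
  have 1: "Q o\<^sub>L T \<in> BH" by (intro BH_compose PP_BH Q T)
  obtain Pa Ps where Pp: "Pa \<in> PP" "Ps \<in> PP" "\<forall>x. Pa (Ps x) = 0" "below Pa P" "below Ps P" "rank_op Pa \<le> enat k"
    "(\<forall>E\<in>PP. rank_op E \<le> 1 \<longrightarrow> E = 0) \<longrightarrow> Pa = 0"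
    "\<forall>w\<in>W. norm (Ps w) < \<epsilon>" "enat k \<le> rank_op ((Q o\<^sub>L T) o\<^sub>L (Pa + Ps))"
    using select_pieces_right[OF 1 P k W] by blast
  have 2: "T o\<^sub>L (Pa + Ps) \<in> BH" by (intro BH_compose BH_add PP_BH Pp T)
  have "(Q o\<^sub>L T) o\<^sub>L (Pa + Ps) = Q o\<^sub>L (T o\<^sub>L (Pa + Ps))" by (intro blinfun_eqI) simp
  then have "enat k \<le> rank_op (Q o\<^sub>L (T o\<^sub>L (Pa + Ps)))" using Pp(9) by simp
  from select_pieces_left[OF 2 Q this W]
  obtain Qa Qs where Qp: "Qa \<in> PP" "Qs \<in> PP" "\<forall>x. Qa (Qs x) = 0" "below Qa Q" "below Qs Q" "rank_op Qa \<le> enat k"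
    "(\<forall>E\<in>PP. rank_op E \<le> 1 \<longrightarrow> E = 0) \<longrightarrow> Qa = 0"
    "\<forall>w\<in>W. norm (Qs w) < \<epsilon>" "enat k \<le> rank_op ((Qa + Qs) o\<^sub>L (T o\<^sub>L (Pa + Ps)))" by blast
  have "(Qa + Qs) o\<^sub>L (T o\<^sub>L (Pa + Ps)) = (Qa + Qs) o\<^sub>L T o\<^sub>L (Pa + Ps)" by (intro blinfun_eqI) simp
  then have fin: "enat k \<le> rank_op ((Qa + Qs) o\<^sub>L T o\<^sub>L (Pa + Ps))" using Qp(9) by simp
  show ?thesis
    by (rule bexI[OF _ Pp(1)], rule bexI[OF _ Pp(2)], rule bexI[OF _ Qp(1)], rule bexI[OF _ Qp(2)])
      (intro conjI impI Pp Qp fin; (rule mp[OF Pp(7)] mp[OF Qp(7)])?; assumption?)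
qed

lemma disjoint_below:
  assumes "P \<in> PP" "Q \<in> PP" "\<And>x. Q (P x) = 0" "A \<in> PP" "B \<in> PP" "below A P" "below B Q"
  shows "B (A x) = 0" "A (B x) = 0"
proof -
  have "B (A x) = Q (P (B (A x)))"
    using belowD[OF assms(7), of "A x"] belowD[OF assms(6), of "B x"] PP_commute[OF assms(4,5), of x] by simp
  then show "B (A x) = 0" using assms(3) by simp
  then show "A (B x) = 0" using PP_commute[OF assms(4,5)] by simp
qed

lemma general_rank_bound: "\<exists>D\<in>\<D>. rank_op (T - D) \<le> enat (6 * k)"
proof -
  obtain P where P: "P \<in> PP" and kP: "enat k \<le> rank_op ((id_blinfun - P) o\<^sub>L T o\<^sub>L P)"
    using attained by blast
  define Q where "Q = id_blinfun - P"
  have Q: "Q \<in> PP" unfolding Q_def by (rule PP_compl[OF P])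
  have QP: "Q (P x) = 0" for x using P by (simp add: Q_def blinfun.bilinear_simps)
  obtain W \<epsilon> where W: "finite W" "\<epsilon> > 0"
    "\<forall>E G. orth_proj E \<longrightarrow> (\<forall>w\<in>W. norm (blinfun_apply E w - Q w) < \<epsilon> \<and>
      norm (blinfun_apply G w - P w) < \<epsilon>) \<longrightarrow> enat k \<le> rank_op (E o\<^sub>L T o\<^sub>L G)"
    using rank_op_compression_lsc[OF kP[folded Q_def]] by blast
  obtain Pa Ps Qa Qs where PP: "Pa \<in> PP" "Ps \<in> PP" "Qa \<in> PP" "Qs \<in> PP" and
    or0: "\<forall>x. Pa (Ps x) = 0" "\<forall>x. Qa (Qs x) = 0" and
    bel: "below Pa P" "below Ps P" "below Qa Q" "below Qs Q" and
    rk: "rank_op Pa \<le> enat k" "rank_op Qa \<le> enat k" and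
    small: "\<forall>w\<in>W. norm (Ps w) < \<epsilon>" "\<forall>w\<in>W. norm (Qs w) < \<epsilon>" and
    kk: "enat k \<le> rank_op ((Qa + Qs) o\<^sub>L T o\<^sub>L (Pa + Ps))"
    using select_block[OF P Q kP[folded Q_def] W(1,2)] by blast
  have orth: "Pa (Ps x) = 0" "Ps (Pa x) = 0" "Qa (Qs x) = 0" "Qs (Qa x) = 0" for x
    using or0 PP_commute[OF PP(1,2)] PP_commute[OF PP(3,4)] by simp_all
  note cross = disjoint_below[OF P Q QP PP(1,3) bel(1,3)] disjoint_below[OF P Q QP PP(1,4) bel(1,4)]
    disjoint_below[OF P Q QP PP(2,3) bel(2,3)] disjoint_below[OF P Q QP PP(2,4) bel(2,4)]
  let ?P0 = "Pa + Ps" and ?Q0 = "Qa + Qs"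
  have P0: "?P0 \<in> PP" and Q0: "?Q0 \<in> PP" by (intro PP_add PP orth)+
  have Q0P0: "?Q0 (?P0 x) = 0" for x by (simp add: blinfun.bilinear_simps cross)
  obtain K D where K: "K \<in> BH" and D: "D \<in> \<D>" and rK: "rank_op K \<le> enat k" and
    Dx: "\<forall>x. D x = (id_blinfun - (?P0 + ?Q0)) ((T - K) ((id_blinfun - (?P0 + ?Q0)) x))" and
    TD: "T - D = K + (?P0 o\<^sub>L (T - K - D)) + ((id_blinfun - ?P0) o\<^sub>L (T - K - D) o\<^sub>L ?Q0)"
    using corner_decomposition[OF T bound P0 Q0 Q0P0 kk] by blast
  define X where "X = T - K - D"
  \<comment> \<open>\<open>S\<close> collects the parts of the pair without rank bound; compression
    by its complement \<open>R\<close> leaves only \<open>Pa\<close> and \<open>Qa\<close>.\<close>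
  define S where "S = Ps + Qs"
  have S: "S \<in> PP" unfolding S_def by (intro PP_add PP cross)
  define R where "R = id_blinfun - S"
  have R: "R \<in> PP" unfolding R_def by (rule PP_compl[OF S])
  \<comment> \<open>On \<open>W\<close> the new pair differs from the old one by less than
    \<open>\<epsilon>\<close>, which is what keeps the rank at \<open>k\<close>.\<close>
  let ?P1 = "P - Ps" and ?Q1 = "Q - Qs"
  have P1: "?P1 \<in> PP" and Q1: "?Q1 \<in> PP"
    by (rule PP_diff[OF P PP(2) belowD[OF bel(2)]], rule PP_diff[OF Q PP(4) belowD[OF bel(4)]])
  have Q1P1: "?Q1 (?P1 x) = 0" for x
  proof -
    have "Q (Ps x) = 0" using QP[of "Ps x"] belowD[OF bel(2), of x] by simp
    moreover have "Qs (P x) = 0"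
    proof -
      have "Qs (P x) = Qs (Q (P x))" using below_commute[OF PP(4) Q bel(4)] by simp
      then show ?thesis by (simp add: QP blinfun.zero_right)
    qed
    ultimately show ?thesis by (simp add: blinfun.bilinear_simps QP cross)
  qed
  have "enat k \<le> rank_op (?Q1 o\<^sub>L T o\<^sub>L ?P1)"
    by (rule W(3)[rule_format]) (use small PP_orth_proj[OF Q1] in \<open>auto simp: blinfun.bilinear_simps\<close>)
  then obtain K1 D1 where K1: "K1 \<in> BH" and D1: "D1 \<in> \<D>" and rK1: "rank_op K1 \<le> enat k" and
    D1x0: "\<forall>x. D1 x = (id_blinfun - (?P1 + ?Q1)) ((T - K1) ((id_blinfun - (?P1 + ?Q1)) x))"
    using corner_decomposition[OF T bound P1 Q1 Q1P1] by blast
  have "id_blinfun - (?P1 + ?Q1) = S" by (simp add: S_def Q_def)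
  then have D1x: "D1 x = S (T (S x)) - S (K1 (S x))" for x
    using D1x0 by (simp add: blinfun.bilinear_simps)
  have RP0: "R (?P0 x) = Pa x" for x
    using PP by (simp add: R_def S_def blinfun.bilinear_simps orth cross)
  have Q0R: "?Q0 (R x) = Qa x" for x
    using PP by (simp add: R_def S_def blinfun.bilinear_simps orth cross)
  have MS: "(id_blinfun - (?P0 + ?Q0)) (S x) = 0" "S ((id_blinfun - (?P0 + ?Q0)) x) = 0" for x
    using PP by (simp_all add: S_def blinfun.bilinear_simps orth cross)
  \<comment> \<open>\<open>D\<close> lives on the complement of \<open>?P0 + ?Q0\<close>, which is
    orthogonal to \<open>S\<close>, and \<open>D1\<close> lives on \<open>S\<close>; their sum
    serves both corners at once.\<close>
  have DS: "D (S x) = 0" "S (D x) = 0" for x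
    unfolding Dx[rule_format] MS by (simp_all add: blinfun.zero_right)
  \<comment> \<open>The first three terms are the corner of \<open>R\<close>, where
    \<open>R ?P0 = Pa\<close> and \<open>?Q0 R = Qa\<close>; then come the two off-diagonal blocks
    and the corner of \<open>S\<close>.\<close>
  have "T - (D + D1) = (R o\<^sub>L K o\<^sub>L R) + (Pa o\<^sub>L (X o\<^sub>L R)) + ((R o\<^sub>L (id_blinfun - ?P0) o\<^sub>L X) o\<^sub>L Qa)
    + (R o\<^sub>L T o\<^sub>L S) + (S o\<^sub>L T o\<^sub>L R) + (S o\<^sub>L K1 o\<^sub>L S)"
  proof (rule blinfun_eqI)
    fix x
    have TDx: "(T - D) y = K y + ?P0 (X y) + (id_blinfun - ?P0) (X (?Q0 y))" for y
      using arg_cong[OF TD[folded X_def], of "\<lambda>A. blinfun_apply A y"] by (simp only: blinfun.add_left blinfun_apply_blinfun_compose)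
    have "D x = D (R x)" by (simp add: R_def blinfun.bilinear_simps DS)
    moreover have "D (R x) = R (D (R x))" by (simp add: R_def blinfun.bilinear_simps DS)
    ultimately have Dx': "D x = R (D (R x))" by simp
    have "R (T (R x)) - D x = R ((T - D) (R x))" by (simp add: Dx' blinfun.bilinear_simps)
    also have "\<dots> = R (K (R x)) + Pa (X (R x)) + R ((id_blinfun - ?P0) (X (Qa x)))"
      unfolding TDx blinfun.add_right[of R] RP0 Q0R ..
    finally have 1: "R (T (R x)) - D x = R (K (R x)) + Pa (X (R x)) + R ((id_blinfun - ?P0) (X (Qa x)))" .
    have "T x = R (T (R x)) + R (T (S x)) + S (T (R x)) + S (T (S x))"
      by (simp add: R_def blinfun.bilinear_simps)
    then have "(T - (D + D1)) x = (R (T (R x)) - D x) + R (T (S x)) + S (T (R x)) + S (K1 (S x))"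
      by (simp add: blinfun.diff_left blinfun.add_left D1x)
    then show "(T - (D + D1)) x = ((R o\<^sub>L K o\<^sub>L R) + (Pa o\<^sub>L (X o\<^sub>L R)) + ((R o\<^sub>L (id_blinfun - ?P0) o\<^sub>L X) o\<^sub>L Qa)
      + (R o\<^sub>L T o\<^sub>L S) + (S o\<^sub>L T o\<^sub>L R) + (S o\<^sub>L K1 o\<^sub>L S)) x"
      unfolding 1 by (simp only: blinfun.add_left blinfun_apply_blinfun_compose)
  qed
  moreover have "rank_op ((R o\<^sub>L K o\<^sub>L R) + (Pa o\<^sub>L (X o\<^sub>L R)) + ((R o\<^sub>L (id_blinfun - ?P0) o\<^sub>L X) o\<^sub>L Qa)
    + (R o\<^sub>L T o\<^sub>L S) + (S o\<^sub>L T o\<^sub>L R) + (S o\<^sub>L K1 o\<^sub>L S)) \<le>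
    enat k + enat k + enat k + enat k + enat k + enat k"
  proof (intro order_trans[OF rank_op_add] add_mono)
    have XB: "X \<in> BH" unfolding X_def by (intro BH_diff T K D_BH[OF D])
    show "rank_op (R o\<^sub>L K o\<^sub>L R) \<le> enat k"
      by (rule order_trans[OF rank_op_sandwich[OF PP_BH[OF R]] rK])
    show "rank_op (Pa o\<^sub>L (X o\<^sub>L R)) \<le> enat k"
      by (rule order_trans[OF rank_op_compose_right rk(1)])
    show "rank_op ((R o\<^sub>L (id_blinfun - ?P0) o\<^sub>L X) o\<^sub>L Qa) \<le> enat k"
      by (rule order_trans[OF rank_op_compose_left rk(2)]) (intro BH_intros PP_BH R P0 XB)
    show "rank_op (R o\<^sub>L T o\<^sub>L S) \<le> enat k"
      unfolding R_def by (rule bound[OF S])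
    have "id_blinfun - R = S" by (simp add: R_def)
    then show "rank_op (S o\<^sub>L T o\<^sub>L R) \<le> enat k" using bound[OF R] by simp
    show "rank_op (S o\<^sub>L K1 o\<^sub>L S) \<le> enat k"
      by (rule order_trans[OF rank_op_sandwich[OF PP_BH[OF S]] rK1])
  qed
  moreover have "enat k + enat k + enat k + enat k + enat k + enat k = enat (6 * k)" by simp
  ultimately have "rank_op (T - (D + D1)) \<le> enat (6 * k)" by (simp only:)
  then show ?thesis using D_add[OF D D1] by blast
qed

text \<open>Compressing the pair to the span of finitely many point vectors keeps rank
  \<open>k\<close>. A projection of the masa has norm 0 or 1 at a point vector, so a part with norm
  below 1 at all of them vanishes on their span, and the small parts disappear.\<close>

lemma atomic_rank_bound:
  assumes atomic: "\<And>R. R \<in> PP \<Longrightarrow> R \<noteq> 0 \<Longrightarrow> \<exists>e. point_vector e \<and> R e = e"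
  shows "\<exists>D\<in>\<D>. rank_op (T - D) \<le> enat (3 * k)"
proof -
  obtain P where P: "P \<in> PP" and kP: "enat k \<le> rank_op ((id_blinfun - P) o\<^sub>L T o\<^sub>L P)"
    using attained by blast
  define Q where "Q = id_blinfun - P"
  have Q: "Q \<in> PP" unfolding Q_def by (rule PP_compl[OF P])
  have QP: "Q (P x) = 0" for x using P by (simp add: Q_def blinfun.bilinear_simps)
  obtain W \<epsilon> where W: "finite W" "\<epsilon> > 0"
    "\<forall>E G. orth_proj E \<longrightarrow> (\<forall>w\<in>W. norm (blinfun_apply E w - Q w) < \<epsilon> \<and>
      norm (blinfun_apply G w - P w) < \<epsilon>) \<longrightarrow> enat k \<le> rank_op (E o\<^sub>L T o\<^sub>L G)"
    using rank_op_compression_lsc[OF kP[folded Q_def]] by blast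
  obtain A B where A: "A \<in> PP" and B: "finite B" "\<forall>b\<in>B. point_vector b"
      "\<forall>x. A x \<in> complex_vector.span B" and AW: "\<forall>w\<in>W. norm (w - A w) < \<epsilon>"
    using point_vectors_approximate[OF atomic W(1,2)] by blast
  let ?P = "P o\<^sub>L A" and ?Q = "Q o\<^sub>L A"
  have PA: "?P \<in> PP" and QA: "?Q \<in> PP" by (intro PP_compose P Q A)+
  have QAPA: "?Q (?P x) = 0" for x using PP_commute[OF A P, of "A x"] A by (simp add: QP)
  have near: "norm ((E o\<^sub>L A) w - E w) < \<epsilon>" if "E \<in> PP" "w \<in> W" for E w
  proof -
    have "norm ((E o\<^sub>L A) w - E w) = norm (E (w - A w))" by (simp add: blinfun.bilinear_simps norm_minus_commute)
    also have "\<dots> \<le> norm (w - A w)" by (rule PP_norm_le[OF that(1)])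
    also have "\<dots> < \<epsilon>" using AW that(2) by blast
    finally show ?thesis .
  qed
  have "enat k \<le> rank_op (?Q o\<^sub>L T o\<^sub>L ?P)"
    by (rule W(3)[rule_format, OF PP_orth_proj[OF QA]]) (intro conjI near P Q)
  from select_block[OF PA QA this B(1) zero_less_one]
  obtain Pa Ps Qa Qs where PP: "Pa \<in> PP" "Ps \<in> PP" "Qa \<in> PP" "Qs \<in> PP" and
    bel: "below Pa ?P" "below Ps ?P" "below Qa ?Q" "below Qs ?Q" and
    rk: "rank_op Pa \<le> enat k" "rank_op Qa \<le> enat k" and
    small: "\<forall>w\<in>B. norm (Ps w) < 1" "\<forall>w\<in>B. norm (Qs w) < 1" and
    kk: "enat k \<le> rank_op ((Qa + Qs) o\<^sub>L T o\<^sub>L (Pa + Ps))"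
    by blast
  have vanish: "S = 0" if S: "S \<in> PP" "below S A" "\<forall>b\<in>B. norm (S b) < 1" for S
  proof (rule blinfun_eqI)
    fix x
    have "S b = 0" if "b \<in> B" for b
    proof -
      have "S b = 0 \<or> S b = b" "norm b = 1" using B(2) that S(1) by (auto simp: point_vector_def)
      then show ?thesis using S(3) that by auto
    qed
    then have "complex_vector.span B \<subseteq> {y. S y = 0}"
      by (intro complex_vector.span_minimal)
        (auto simp: complex_vector.subspace_def blinfun.bilinear_simps BH_scaleC[OF PP_BH[OF S(1)]])
    then have "S (A x) = 0" using B(3) by blast
    then show "S x = (0 :: 'a \<Rightarrow>\<^sub>L 'a) x" using below_commute[OF S(1) A S(2)] by (simp add: blinfun.zero_left)
  qed
  have PsA: "below Ps A" "below Qs A"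
    using below_trans[OF bel(2) below_compose_right[OF P A]] below_trans[OF bel(4) below_compose_right[OF Q A]] .
  have z: "Ps = 0" "Qs = 0" using vanish[OF PP(2) PsA(1) small(1)] vanish[OF PP(4) PsA(2) small(2)] by auto
  have kk': "enat k \<le> rank_op (Qa o\<^sub>L T o\<^sub>L Pa)" using kk by (simp add: z)
  obtain K D where K: "K \<in> BH" and D: "D \<in> \<D>" and rK: "rank_op K \<le> enat k" and
    TD: "T - D = K + (Pa o\<^sub>L (T - K - D)) + ((id_blinfun - Pa) o\<^sub>L (T - K - D) o\<^sub>L Qa)"
    using corner_decomposition[OF T bound PP(1,3) disjoint_below(1)[OF PA QA QAPA PP(1,3) bel(1,3)] kk'] by blast
  \<comment> \<open>One \<open>k\<close> each for \<open>K\<close>, \<open>Pa\<close> and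
    \<open>Qa\<close>.\<close>
  have "rank_op (K + (Pa o\<^sub>L (T - K - D)) + ((id_blinfun - Pa) o\<^sub>L (T - K - D) o\<^sub>L Qa)) \<le> enat k + enat k + enat k"
  proof (intro order_trans[OF rank_op_add] add_mono rK)
    show "rank_op (Pa o\<^sub>L (T - K - D)) \<le> enat k"
      by (rule order_trans[OF rank_op_compose_right rk(1)])
    show "rank_op ((id_blinfun - Pa) o\<^sub>L (T - K - D) o\<^sub>L Qa) \<le> enat k"
      by (rule order_trans[OF rank_op_compose_left rk(2)]) (intro BH_intros PP_BH PP T K D_BH[OF D])
  qed
  moreover have "enat k + enat k + enat k = enat (3 * k)" by simp
  ultimately have "rank_op (T - D) \<le> enat (3 * k)" unfolding TD by (simp only:)
  then show ?thesis using D by blast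
qed

text \<open>On the complement \<open>M\<close> of a pair of small projections, the corners of
  \<open>T - F\<close> and of \<open>T - K\<close> both lie in the masa; their difference has finite
  rank and is therefore 0, so \<open>M F M = M K M\<close>. As \<open>M\<close> is close to the
  identity on the test set, the rank of \<open>F\<close> is at most that of
  \<open>M F M\<close>.\<close>

lemma continuous_rank_bound:
  assumes cont: "\<And>P. P \<in> PP \<Longrightarrow> rank_op P \<le> 1 \<Longrightarrow> P = 0"
    and F: "F \<in> BH" "rank_op F < \<infinity>" and TF: "T - F \<in> \<D>"
  shows "rank_op F \<le> enat k"
proof -
  obtain r where r: "rank_op F = enat r" using F(2) by auto
  have "F = id_blinfun o\<^sub>L F o\<^sub>L id_blinfun" by (intro blinfun_eqI) simp
  then have "enat r \<le> rank_op (id_blinfun o\<^sub>L F o\<^sub>L id_blinfun)" using r by simp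
  from rank_op_compression_lsc[OF this] obtain W \<epsilon> where W: "finite W" "\<epsilon> > 0"
    "\<forall>E G. orth_proj E \<longrightarrow> (\<forall>w\<in>W. norm (blinfun_apply E w - id_blinfun w) < \<epsilon> \<and>
      norm (blinfun_apply G w - id_blinfun w) < \<epsilon>) \<longrightarrow> enat r \<le> rank_op (E o\<^sub>L F o\<^sub>L G)" by blast
  obtain P where P: "P \<in> PP" and kP: "enat k \<le> rank_op ((id_blinfun - P) o\<^sub>L T o\<^sub>L P)"
    using attained by blast
  define Q where "Q = id_blinfun - P"
  have Q: "Q \<in> PP" unfolding Q_def by (rule PP_compl[OF P])
  have QP: "Q (P x) = 0" for x using P by (simp add: Q_def blinfun.bilinear_simps)
  \<comment> \<open>Half the tolerance, because \<open>M\<close> misses the identity by the sum of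
    two small parts.\<close>
  have e2: "\<epsilon> / 2 > 0" using W(2) by simp
  obtain Pa Ps Qa Qs where PP: "Ps \<in> PP" "Qs \<in> PP" and bel: "below Ps P" "below Qs Q" and
    z: "(\<forall>E\<in>PP. rank_op E \<le> 1 \<longrightarrow> E = 0) \<longrightarrow> Pa = 0 \<and> Qa = 0" and
    small: "\<forall>w\<in>W. norm (Ps w) < \<epsilon> / 2" "\<forall>w\<in>W. norm (Qs w) < \<epsilon> / 2" and
    kk: "enat k \<le> rank_op ((Qa + Qs) o\<^sub>L T o\<^sub>L (Pa + Ps))"
    using select_block[OF P Q kP[folded Q_def] W(1) e2] by blast
  have kk': "enat k \<le> rank_op (Qs o\<^sub>L T o\<^sub>L Ps)" using kk z cont by simp
  have orth: "Qs (Ps x) = 0" "Ps (Qs x) = 0" for x by (rule disjoint_below[OF P Q QP PP bel])+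
  define M where "M = id_blinfun - (Ps + Qs)"
  have M: "M \<in> PP" unfolding M_def by (intro PP_compl PP_add PP orth)
  obtain K D where K: "K \<in> BH" and D: "D \<in> \<D>" and rK: "rank_op K \<le> enat k" and
    Dx: "\<forall>x. D x = M ((T - K) (M x))"
    using corner_decomposition[OF T bound PP(1,2) orth(1) kk'] unfolding M_def by blast
  define C where "C = D - ((T - F) o\<^sub>L M)"
  have C: "C \<in> \<D>" unfolding C_def by (intro diff_in_D compose_in_D D TF PP_in_D M)
  have Ceq: "C = (M o\<^sub>L F o\<^sub>L M) - (M o\<^sub>L K o\<^sub>L M)"
  proof (rule blinfun_eqI)
    fix x
    have "(T - F) (M x) = (T - F) (M (M x))" using M by simp
    also have "\<dots> = M ((T - F) (M x))" by (rule PP_D_commute[OF M TF, symmetric])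
    finally show "C x = ((M o\<^sub>L F o\<^sub>L M) - (M o\<^sub>L K o\<^sub>L M)) x"
      by (simp add: C_def Dx blinfun.diff_left blinfun.diff_right)
  qed
  have "rank_op C \<le> enat r + enat k"
    unfolding Ceq using order_trans[OF rank_op_sandwich[OF PP_BH[OF M]] rK] rank_op_sandwich[OF PP_BH[OF M], of F] r
    by (intro order_trans[OF rank_op_diff] add_mono) auto
  then have "rank_op C < \<infinity>" by (cases "rank_op C") auto
  then have "C = 0" using finite_rank_in_D_eq_0[OF cont C] by blast
  then have MFM: "M o\<^sub>L F o\<^sub>L M = M o\<^sub>L K o\<^sub>L M" using Ceq by simp
  have "enat r \<le> rank_op (M o\<^sub>L F o\<^sub>L M)"
  proof (rule W(3)[rule_format, OF PP_orth_proj[OF M]])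
    fix w assume w: "w \<in> W"
    have "M w - id_blinfun w = - (Ps w + Qs w)" by (simp add: M_def blinfun.bilinear_simps)
    then have "norm (M w - id_blinfun w) = norm (Ps w + Qs w)" by (simp only: norm_minus_cancel)
    also have "\<dots> \<le> norm (Ps w) + norm (Qs w)" by (rule norm_triangle_ineq)
    also have "\<dots> < \<epsilon>" using small w by fastforce
    finally show "norm (M w - id_blinfun w) < \<epsilon> \<and> norm (M w - id_blinfun w) < \<epsilon>" by simp
  qed
  also have "\<dots> \<le> enat k" unfolding MFM by (rule order_trans[OF rank_op_sandwich[OF PP_BH[OF M]] rK])
  finally show ?thesis using r by simp
qed

end

end

subsection \<open>Multiplication algebras\<close>

text \<open>Indicator functions belong to \<open>L2_fun\<close> only for sets of finite measure, so
  sets of positive measure have to be cut down.\<close>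

lemma (in sigma_finite_measure) finite_positive_subset:
  assumes "A \<in> sets M" "emeasure M A > 0"
  shows "\<exists>B\<in>sets M. B \<subseteq> A \<and> emeasure M B > 0 \<and> emeasure M B < \<infinity>"
proof -
  obtain F :: "nat \<Rightarrow> 'a set" where F: "range F \<subseteq> sets M" "(\<Union>i. F i) = space M" "\<And>i. emeasure M (F i) \<noteq> \<infinity>"
    using sigma_finite by metis
  have "\<exists>i. emeasure M (A \<inter> F i) \<noteq> 0"
  proof (rule ccontr)
    assume "\<nexists>i. emeasure M (A \<inter> F i) \<noteq> 0"
    then have "emeasure M (\<Union>i. A \<inter> F i) = 0"
      using assms(1) F(1) by (intro emeasure_UN_eq_0) auto
    moreover have "(\<Union>i. A \<inter> F i) = A" using F(2) sets.sets_into_space[OF assms(1)] by blast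
    ultimately show False using assms(2) by simp
  qed
  then obtain i where i: "emeasure M (A \<inter> F i) \<noteq> 0" by blast
  have "emeasure M (A \<inter> F i) \<le> emeasure M (F i)" using F(1) by (intro emeasure_mono) auto
  then have "emeasure M (A \<inter> F i) < \<infinity>" using F(3)[of i] by (simp add: less_top[symmetric] top_unique neq_top_trans)
  then show ?thesis using i assms(1) F(1)
    by (intro bexI[of _ "A \<inter> F i"]) (auto simp: zero_less_iff_neq_zero)
qed

section \<open>Square-integrable functions and the unitary model\<close>

lemma L2_fun_diff:
  assumes "f \<in> L2_fun \<mu>" "g \<in> L2_fun \<mu>"
  shows "(\<lambda>x. f x - g x) \<in> L2_fun \<mu>"
proof -
  have m: "f \<in> borel_measurable \<mu>" "g \<in> borel_measurable \<mu>" using assms by (auto simp: L2_fun_def)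
  have "integrable \<mu> (\<lambda>x. (norm (f x - g x))\<^sup>2)"
  proof (rule Bochner_Integration.integrable_bound)
    show "integrable \<mu> (\<lambda>x. 2 * (norm (f x))\<^sup>2 + 2 * (norm (g x))\<^sup>2)"
      using assms by (auto simp: L2_fun_def)
    show "(\<lambda>x. (norm (f x - g x))\<^sup>2) \<in> borel_measurable \<mu>" using m by measurable
    have "(norm (a - b))\<^sup>2 \<le> 2 * (norm a)\<^sup>2 + 2 * (norm b)\<^sup>2" for a b :: complex
    proof -
      have "(norm (a - b))\<^sup>2 \<le> (norm a + norm b)\<^sup>2" by (intro power_mono norm_triangle_ineq4) simp
      also have "\<dots> \<le> 2 * (norm a)\<^sup>2 + 2 * (norm b)\<^sup>2"
        using zero_le_power2[of "norm a - norm b"] by (simp add: power2_sum power2_diff)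
      finally show ?thesis .
    qed
    then show "AE x in \<mu>. norm ((norm (f x - g x))\<^sup>2) \<le> norm (2 * (norm (f x))\<^sup>2 + 2 * (norm (g x))\<^sup>2)"
      by (intro AE_I2) simp
  qed
  then show ?thesis using m by (auto simp: L2_fun_def)
qed

lemma L2_fun_mult:
  assumes "f \<in> Linf_fun \<mu>" "g \<in> L2_fun \<mu>"
  shows "(\<lambda>x. f x * g x) \<in> L2_fun \<mu>"
proof -
  have m: "f \<in> borel_measurable \<mu>" "g \<in> borel_measurable \<mu>"
    using assms by (auto simp: L2_fun_def Linf_fun_def)
  obtain C where C: "AE x in \<mu>. norm (f x) \<le> C" using assms by (auto simp: Linf_fun_def)
  have "integrable \<mu> (\<lambda>x. (norm (f x * g x))\<^sup>2)"
  proof (rule Bochner_Integration.integrable_bound)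
    show "integrable \<mu> (\<lambda>x. C\<^sup>2 * (norm (g x))\<^sup>2)" using assms(2) by (auto simp: L2_fun_def)
    show "(\<lambda>x. (norm (f x * g x))\<^sup>2) \<in> borel_measurable \<mu>" using m by measurable
    show "AE x in \<mu>. norm ((norm (f x * g x))\<^sup>2) \<le> norm (C\<^sup>2 * (norm (g x))\<^sup>2)"
      using C
    proof eventually_elim
      case (elim x)
      have "(norm (f x))\<^sup>2 \<le> C\<^sup>2" using elim by (intro power_mono) auto
      then show ?case by (simp add: norm_mult power_mult_distrib mult_right_mono)
    qed
  qed
  then show ?thesis using m by (auto simp: L2_fun_def)
qed

lemma L2_fun_indicator:
  assumes "B \<in> sets \<mu>" "emeasure \<mu> B < \<infinity>"
  shows "(\<lambda>x. indicator B x :: complex) \<in> L2_fun \<mu>"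
proof -
  have "(\<lambda>x. (norm (indicator B x :: complex))\<^sup>2) = (indicator B :: _ \<Rightarrow> real)"
    by (auto simp: indicator_def)
  then show ?thesis using assms by (auto simp: L2_fun_def)
qed

context
  fixes \<mu> :: "'x measure" and U :: "('x \<Rightarrow> complex) \<Rightarrow> 'a::chilbert_space"
  assumes unit: "unitary_from_L2 \<mu> U"
begin

lemma unitary_diff:
  assumes "f \<in> L2_fun \<mu>" "g \<in> L2_fun \<mu>"
  shows "U (\<lambda>x. f x - g x) = U f - U g"
proof -
  have "\<forall>f\<in>L2_fun \<mu>. \<forall>g\<in>L2_fun \<mu>. U (\<lambda>x. f x + g x) = U f + U g"
    using unit unfolding unitary_from_L2_def by (rule conjunct1)
  from this[rule_format, OF L2_fun_diff[OF assms] assms(2)] show ?thesis by simp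
qed

lemma unitary_cinner:
  "f \<in> L2_fun \<mu> \<Longrightarrow> g \<in> L2_fun \<mu> \<Longrightarrow> cinner (U f) (U g) = (\<integral>x. f x * cnj (g x) \<partial>\<mu>)"
  using unit unfolding unitary_from_L2_def by blast

lemma unitary_surj: "\<exists>g\<in>L2_fun \<mu>. v = U g"
  using unit unfolding unitary_from_L2_def by blast

lemma unitary_eq_0_iff:
  assumes f: "f \<in> L2_fun \<mu>"
  shows "U f = 0 \<longleftrightarrow> (AE x in \<mu>. f x = 0)"
proof -
  have "complex_of_real ((norm (U f))\<^sup>2) = (\<integral>x. f x * cnj (f x) \<partial>\<mu>)"
    using unitary_cinner[OF f f] by (simp only: cinner_self)
  also have "\<dots> = (\<integral>x. complex_of_real ((norm (f x))\<^sup>2) \<partial>\<mu>)"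
    by (simp only: complex_norm_square)
  also have "\<dots> = complex_of_real (\<integral>x. (norm (f x))\<^sup>2 \<partial>\<mu>)" by (rule integral_complex_of_real)
  finally have "(norm (U f))\<^sup>2 = (\<integral>x. (norm (f x))\<^sup>2 \<partial>\<mu>)" by (simp only: of_real_eq_iff)
  then have "U f = 0 \<longleftrightarrow> (\<integral>x. (norm (f x))\<^sup>2 \<partial>\<mu>) = 0" by (metis norm_eq_zero power2_eq_iff_nonneg zero_power2 norm_ge_zero order_refl)
  also have "\<dots> \<longleftrightarrow> (AE x in \<mu>. (norm (f x))\<^sup>2 = 0)"
    using f by (intro integral_nonneg_eq_0_iff_AE) (auto simp: L2_fun_def)
  finally show ?thesis by simp
qed

lemma unitary_eq_iff:
  assumes "f \<in> L2_fun \<mu>" "g \<in> L2_fun \<mu>"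
  shows "U f = U g \<longleftrightarrow> (AE x in \<mu>. f x = g x)"
  using unitary_eq_0_iff[OF L2_fun_diff[OF assms]] by (simp add: unitary_diff[OF assms])

text \<open>Idempotence tested on the indicator of \<open>B\<close> says
  \<open>f\<^sup>2 = f\<close> almost everywhere on \<open>B\<close>.\<close>

lemma projection_symbol:
  assumes P: "orth_proj P" and f: "f \<in> Linf_fun \<mu>"
    and Pf: "\<And>g. g \<in> L2_fun \<mu> \<Longrightarrow> blinfun_apply P (U g) = U (\<lambda>x. f x * g x)"
    and B: "B \<in> sets \<mu>" "emeasure \<mu> B < \<infinity>"
  shows "AE x in \<mu>. x \<in> B \<longrightarrow> f x = 0 \<or> f x = 1"
proof -
  let ?g = "\<lambda>x. indicator B x :: complex"
  have g: "?g \<in> L2_fun \<mu>" by (rule L2_fun_indicator[OF B])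
  note fg = L2_fun_mult[OF f g]
  have "U (\<lambda>x. f x * (f x * ?g x)) = P (P (U ?g))" by (simp only: Pf[OF g] Pf[OF fg])
  also have "\<dots> = P (U ?g)" by (rule orth_projD[OF P])
  also have "\<dots> = U (\<lambda>x. f x * ?g x)" by (rule Pf[OF g])
  finally have "AE x in \<mu>. f x * (f x * ?g x) = f x * ?g x"
    by (rule iffD1[OF unitary_eq_iff[OF L2_fun_mult[OF f fg] fg]])
  then show ?thesis by eventually_elim (auto simp: indicator_def)
qed

lemma support_positive:
  assumes f: "f \<in> Linf_fun \<mu>" and Pf: "\<And>g. g \<in> L2_fun \<mu> \<Longrightarrow> blinfun_apply P (U g) = U (\<lambda>x. f x * g x)"
    and P0: "P \<noteq> 0"
  shows "{x \<in> space \<mu>. f x \<noteq> 0} \<in> sets \<mu>" "emeasure \<mu> {x \<in> space \<mu>. f x \<noteq> 0} > 0"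
proof -
  have [measurable]: "f \<in> borel_measurable \<mu>" using f by (simp add: Linf_fun_def)
  show s: "{x \<in> space \<mu>. f x \<noteq> 0} \<in> sets \<mu>" by measurable
  show "emeasure \<mu> {x \<in> space \<mu>. f x \<noteq> 0} > 0"
  proof (rule ccontr)
    assume "\<not> emeasure \<mu> {x \<in> space \<mu>. f x \<noteq> 0} > 0"
    then have "emeasure \<mu> {x \<in> space \<mu>. f x \<noteq> 0} = 0" by simp
    then have "AE x in \<mu>. f x = 0" by (intro AE_I[OF _ _ s]) auto
    then have z: "U (\<lambda>x. f x * g x) = 0" if g: "g \<in> L2_fun \<mu>" for g
      by (subst unitary_eq_0_iff[OF L2_fun_mult[OF f g]]) auto
    have "P v = 0" for v using unitary_surj[of v] Pf z by metis
    then have "P = 0" by (intro blinfun_eqI) (simp add: blinfun.zero_left)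
    then show False using P0 by simp
  qed
qed

end

context masa_algebra
begin

text \<open>Inside the support of the symbol of \<open>R\<close> there is an atom, cut down to
  finite measure. Symbols of projections take almost everywhere only the values 0 and 1 there, so
  each is constant on the atom up to a null set and the projection kills or fixes its indicator;
  \<open>R\<close> fixes it, since its symbol does not vanish.\<close>

lemma atomic_point_vectors:
  fixes \<mu> :: "'x measure"
  assumes sf: "sigma_finite_measure \<mu>" and at: "purely_atomic \<mu>"
    and eq: "unitarily_equiv_mult_algebra \<D> \<mu>" and R: "R \<in> PP" "R \<noteq> 0"
  shows "\<exists>e. point_vector e \<and> R e = e"
proof -
  obtain U where U: "unitary_from_L2 \<mu> U"
    "\<D> = {T \<in> BH. \<exists>f\<in>Linf_fun \<mu>. \<forall>g\<in>L2_fun \<mu>. blinfun_apply T (U g) = U (\<lambda>x. f x * g x)}"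
    using eq unfolding unitarily_equiv_mult_algebra_def by blast
  have sym: "\<exists>f\<in>Linf_fun \<mu>. \<forall>g\<in>L2_fun \<mu>. blinfun_apply P (U g) = U (\<lambda>x. f x * g x)" if "P \<in> PP" for P
    using PP_in_D[OF that] unfolding U(2) by blast
  obtain f where f: "f \<in> Linf_fun \<mu>" "\<forall>g\<in>L2_fun \<mu>. R (U g) = U (\<lambda>x. f x * g x)"
    using sym[OF R(1)] by blast
  note supp = support_positive[OF U(1) f(1) f(2)[rule_format] R(2)]
  obtain B0 where B0: "B0 \<subseteq> {x \<in> space \<mu>. f x \<noteq> 0}" "measure_atom \<mu> B0"
    using at supp unfolding purely_atomic_def by blast
  have B0s: "B0 \<in> sets \<mu>" "emeasure \<mu> B0 > 0" using B0(2) by (auto simp: measure_atom_def)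
  obtain B where B: "B \<in> sets \<mu>" "B \<subseteq> B0" "emeasure \<mu> B > 0" "emeasure \<mu> B < \<infinity>"
    using sigma_finite_measure.finite_positive_subset[OF sf B0s] by blast
  have atom: "emeasure \<mu> C = 0 \<or> emeasure \<mu> (B - C) = 0" if C: "C \<in> sets \<mu>" "C \<subseteq> B" for C
  proof -
    have "emeasure \<mu> C = 0 \<or> emeasure \<mu> (B0 - C) = 0"
      using B0(2) C B(2) unfolding measure_atom_def by blast
    moreover have "emeasure \<mu> (B - C) \<le> emeasure \<mu> (B0 - C)"
      using B(1,2) C(1) B0s by (intro emeasure_mono) auto
    ultimately show ?thesis by auto
  qed
  let ?g = "\<lambda>x. indicator B x :: complex"
  have g: "?g \<in> L2_fun \<mu>" by (rule L2_fun_indicator[OF B(1,4)])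
  have nz: "U ?g \<noteq> 0"
  proof
    assume "U ?g = 0"
    then have "AE x in \<mu>. ?g x = 0" using unitary_eq_0_iff[OF U(1) g] by blast
    then have "AE x in \<mu>. x \<notin> B" by eventually_elim (auto simp: indicator_def)
    then have "emeasure \<mu> B = 0" using B(1) by (simp add: AE_iff_measurable[OF B(1)] AE_iff_null_sets null_setsD1)
    then show False using B(3) by simp
  qed
  have act: "P (U ?g) = 0 \<or> P (U ?g) = U ?g" if P: "P \<in> PP" for P
  proof -
    obtain p where p: "p \<in> Linf_fun \<mu>" "\<forall>g\<in>L2_fun \<mu>. P (U g) = U (\<lambda>x. p x * g x)"
      using sym[OF P] by blast
    have [measurable]: "p \<in> borel_measurable \<mu>" using p(1) by (simp add: Linf_fun_def)
    have p01: "AE x in \<mu>. x \<in> B \<longrightarrow> p x = 0 \<or> p x = 1"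
      by (rule projection_symbol[OF U(1) PP_orth_proj[OF P] p(1) p(2)[rule_format] B(1,4)])
    define C where "C = {x \<in> space \<mu>. p x \<noteq> 0} \<inter> B"
    have C: "C \<in> sets \<mu>" "C \<subseteq> B" using B(1) by (auto simp: C_def)
    have pg: "P (U ?g) = U (\<lambda>x. p x * ?g x)" using p(2) g by blast
    show ?thesis
      using atom[OF C]
    proof
      assume "emeasure \<mu> C = 0"
      then have "AE x in \<mu>. x \<notin> C" using C(1) by (intro AE_not_in) auto
      then have "AE x in \<mu>. p x * ?g x = 0"
        using AE_space by eventually_elim (auto simp: C_def indicator_def)
      then have "U (\<lambda>x. p x * ?g x) = 0" using unitary_eq_0_iff[OF U(1) L2_fun_mult[OF p(1) g]] by blast
      then show ?thesis using pg by simp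
    next
      assume "emeasure \<mu> (B - C) = 0"
      then have "AE x in \<mu>. x \<notin> B - C" using C(1) B(1) by (intro AE_not_in) auto
      then have "AE x in \<mu>. p x * ?g x = ?g x"
        using p01 by eventually_elim (auto simp: C_def indicator_def)
      then have "U (\<lambda>x. p x * ?g x) = U ?g" using unitary_eq_iff[OF U(1) L2_fun_mult[OF p(1) g] g] by blast
      then show ?thesis using pg by simp
    qed
  qed
  have "R (U ?g) \<noteq> 0"
  proof
    assume "R (U ?g) = 0"
    then have "U (\<lambda>x. f x * ?g x) = 0" using f(2) g by simp
    then have "AE x in \<mu>. f x * ?g x = 0" using unitary_eq_0_iff[OF U(1) L2_fun_mult[OF f(1) g]] by blast
    then have "AE x in \<mu>. ?g x = 0"
      by eventually_elim (use B(2) B0(1) in \<open>auto simp: indicator_def\<close>)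
    then have "U ?g = 0" using unitary_eq_0_iff[OF U(1) g] by blast
    then show False using nz by simp
  qed
  then have Rg: "R (U ?g) = U ?g" using act[OF R(1)] by blast
  define e where "e = complex_of_real (1 / norm (U ?g)) *\<^sub>C U ?g"
  have "norm e = 1" using nz by (simp add: e_def norm_scaleC norm_divide)
  moreover have "P e = 0 \<or> P e = e" if "P \<in> PP" for P
    using act[OF that] by (auto simp: e_def BH_scaleC[OF PP_BH[OF that]])
  moreover have "R e = e" using Rg by (simp add: e_def BH_scaleC[OF PP_BH[OF R(1)]])
  ultimately show ?thesis by (auto simp: point_vector_def)
qed

text \<open>The support of the symbol is not an atom, so it contains two disjoint sets of positive
  finite measure; the images of their indicators are nonzero and orthogonal, which forces rank at
  least 2.\<close>

lemma atomless_no_rank_one: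
  fixes \<mu> :: "'x measure"
  assumes sf: "sigma_finite_measure \<mu>" and at: "atomless \<mu>"
    and eq: "unitarily_equiv_mult_algebra \<D> \<mu>" and P: "P \<in> PP" "rank_op P \<le> 1"
  shows "P = 0"
proof (rule ccontr)
  assume P0: "P \<noteq> 0"
  obtain U where U: "unitary_from_L2 \<mu> U"
    "\<D> = {T \<in> BH. \<exists>f\<in>Linf_fun \<mu>. \<forall>g\<in>L2_fun \<mu>. blinfun_apply T (U g) = U (\<lambda>x. f x * g x)}"
    using eq unfolding unitarily_equiv_mult_algebra_def by blast
  obtain f where f: "f \<in> Linf_fun \<mu>" "\<forall>g\<in>L2_fun \<mu>. P (U g) = U (\<lambda>x. f x * g x)"
    using PP_in_D[OF P(1)] unfolding U(2) by blast
  define A where "A = {x \<in> space \<mu>. f x \<noteq> 0}"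
  have A: "A \<in> sets \<mu>" "emeasure \<mu> A > 0"
    using support_positive[OF U(1) f(1) f(2)[rule_format] P0] by (simp_all add: A_def)
  have "\<not> measure_atom \<mu> A" using at by (simp add: atomless_def)
  then obtain B where B: "B \<in> sets \<mu>" "B \<subseteq> A" "emeasure \<mu> B > 0" "emeasure \<mu> (A - B) > 0"
    using A unfolding measure_atom_def by (auto simp: zero_less_iff_neq_zero)
  have nonzero: "P (U (\<lambda>x. indicator C x)) \<noteq> 0"
    if C: "C \<in> sets \<mu>" "C \<subseteq> A" "emeasure \<mu> C > 0" "emeasure \<mu> C < \<infinity>" for C
  proof
    let ?g = "\<lambda>x. indicator C x :: complex"
    have g: "?g \<in> L2_fun \<mu>" by (rule L2_fun_indicator[OF C(1,4)])
    assume "P (U ?g) = 0"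
    then have "U (\<lambda>x. f x * ?g x) = 0" using f(2) g by simp
    then have "AE x in \<mu>. f x * ?g x = 0" using unitary_eq_0_iff[OF U(1) L2_fun_mult[OF f(1) g]] by blast
    then have "AE x in \<mu>. x \<notin> C"
      by eventually_elim (use C(2) in \<open>auto simp: indicator_def A_def\<close>)
    then have "emeasure \<mu> C = 0" using C(1) by (simp add: AE_iff_null_sets null_setsD1)
    then show False using C(3) by simp
  qed
  obtain C1 where C1: "C1 \<in> sets \<mu>" "C1 \<subseteq> B" "emeasure \<mu> C1 > 0" "emeasure \<mu> C1 < \<infinity>"
    using sigma_finite_measure.finite_positive_subset[OF sf B(1,3)] by blast
  have "A - B \<in> sets \<mu>" using A B by auto
  then obtain C2 where C2: "C2 \<in> sets \<mu>" "C2 \<subseteq> A - B" "emeasure \<mu> C2 > 0" "emeasure \<mu> C2 < \<infinity>"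
    using sigma_finite_measure.finite_positive_subset[OF sf _ B(4)] by blast
  define u v where "u = U (\<lambda>x. indicator C1 x)" and "v = U (\<lambda>x. indicator C2 x)"
  have "P u \<noteq> 0" "P v \<noteq> 0"
    using nonzero[of C1] nonzero[of C2] C1 C2 B(2) by (auto simp: u_def v_def)
  have g1: "(\<lambda>x. indicator C1 x :: complex) \<in> L2_fun \<mu>" and g2: "(\<lambda>x. indicator C2 x :: complex) \<in> L2_fun \<mu>"
    using L2_fun_indicator C1 C2 by blast+
  have "cinner (P u) (P v) = (\<integral>x. (f x * indicator C1 x) * cnj (f x * indicator C2 x) \<partial>\<mu>)"
    using f(2) g1 g2 unitary_cinner[OF U(1) L2_fun_mult[OF f(1) g1] L2_fun_mult[OF f(1) g2]]
    by (simp add: u_def v_def)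
  also have "(\<lambda>x. (f x * indicator C1 x) * cnj (f x * indicator C2 x)) = (\<lambda>x. 0)"
  proof
    fix x
    show "(f x * indicator C1 x) * cnj (f x * indicator C2 x) = 0"
      using C1(2) C2(2) by (cases "x \<in> C1"; cases "x \<in> C2") auto
  qed
  finally have uv: "cinner (P u) (P v) = 0" by simp
  then have vu: "cinner (P v) (P u) = 0" using cinner_commute[of "P v" "P u"] by simp
  define x where "x i = (if i = 0 then u else v)" for i :: nat
  define y where "y i = (1 / cnj (cinner (P (x i)) (P (x i)))) *\<^sub>C P (x i)" for i :: nat
  have "enat 2 \<le> rank_op P"
  proof (rule nearly_biorthogonal_rank_op_ge[of 2 P x y])
    fix i j :: nat assume ij: "i < 2" "j < 2"
    have "cinner (P (x i)) (y j) = (if i = j then 1 else 0)"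
      using ij uv vu \<open>P u \<noteq> 0\<close> \<open>P v \<noteq> 0\<close>
      by (auto simp: less_2_cases_iff x_def y_def cinner_scaleC_right)
    then show "cmod (cinner (P (x i)) (y j) - (if i = j then 1 else 0)) < 1 / (real 2 + 1)" by simp
  qed
  then have "enat 2 \<le> 1" using P(2) by (rule order_trans)
  then show False by (simp add: one_enat_def)
qed

end

subsection \<open>Almost-invariant ranges\<close>

context separable_masa_algebra
begin

text \<open>\<open>I - P\<close> kills the part of the image inside the range of \<open>P\<close>
  and leaves the image of a finite-dimensional space.\<close>

lemma almost_invariant_finite_rank:
  assumes P: "P \<in> PP" and inv: "almost_invariant T (range (blinfun_apply P))"
  shows "rank_op ((id_blinfun - P) o\<^sub>L T o\<^sub>L P) < \<infinity>"
proof -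
  let ?Q = "id_blinfun - P"
  interpret Q: Vector_Spaces.linear "(*\<^sub>C)" "(*\<^sub>C)" "blinfun_apply ?Q"
    by (rule BH_linear[OF PP_BH[OF PP_compl[OF P]]])
  obtain M where M: "complex_finite_dim M"
    "blinfun_apply T ` range (blinfun_apply P) \<subseteq> {y + m | y m. y \<in> range (blinfun_apply P) \<and> m \<in> M}"
    using inv by (auto simp: almost_invariant_def)
  obtain B where B: "finite B" "M \<subseteq> complex_vector.span B" using M(1) by (auto simp: complex_finite_dim_def)
  have "(?Q o\<^sub>L T o\<^sub>L P) x \<in> complex_vector.span (blinfun_apply ?Q ` B)" for x
  proof -
    have "T (P x) \<in> {y + m | y m. y \<in> range (blinfun_apply P) \<and> m \<in> M}" using M(2) by blast
    then obtain z m where zm: "T (P x) = P z + m" "m \<in> M" by auto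
    have "?Q (P z) = 0" using P by (simp add: blinfun.bilinear_simps)
    then have "(?Q o\<^sub>L T o\<^sub>L P) x = ?Q m" by (simp add: zm(1) blinfun.add_right)
    then show ?thesis using zm(2) B(2) Q.span_image[of B] by auto
  qed
  then have "complex_finite_dim (range (blinfun_apply (?Q o\<^sub>L T o\<^sub>L P)))"
    unfolding complex_finite_dim_def using B(1) by (intro exI[of _ "blinfun_apply ?Q ` B"]) auto
  then show ?thesis by (simp only: rank_op_finite_iff)
qed

context
  fixes T :: "'a \<Rightarrow>\<^sub>L 'a"
  assumes T: "T \<in> BH"
    and inv: "\<And>P. P \<in> PP \<Longrightarrow> almost_invariant T (range (blinfun_apply P))"
begin

text \<open>Finite blocks for \<open>P\<close> and \<open>I - P\<close> make every commutator rank
  finite, hence uniformly bounded; the bound passes back to the blocks. A finite supremum of values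
  in \<open>enat\<close> is attained.\<close>

lemma off_diagonal_rank_attained:
  assumes \<kappa>: "\<kappa> = (SUP P\<in>PP. rank_op ((id_blinfun - P) o\<^sub>L T o\<^sub>L P))"
  shows "\<exists>k. \<kappa> = enat k \<and> (\<forall>P\<in>PP. rank_op ((id_blinfun - P) o\<^sub>L T o\<^sub>L P) \<le> enat k) \<and>
    (\<exists>P\<in>PP. enat k \<le> rank_op ((id_blinfun - P) o\<^sub>L T o\<^sub>L P))"
proof -
  let ?g = "\<lambda>P. rank_op ((id_blinfun - P) o\<^sub>L T o\<^sub>L P)"
  have "commutator_rank T P < \<infinity>" if P: "P \<in> PP" for P
  proof -
    let ?Q = "id_blinfun - P"
    have "(P o\<^sub>L T) - (T o\<^sub>L P) = ((id_blinfun - ?Q) o\<^sub>L T o\<^sub>L ?Q) - (?Q o\<^sub>L T o\<^sub>L P)"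
      by (rule blinfun_eqI) (simp add: blinfun.bilinear_simps)
    then have "commutator_rank T P \<le> ?g ?Q + ?g P"
      unfolding commutator_rank_def by (simp only: rank_op_diff)
    also have "\<dots> < \<infinity>"
      using almost_invariant_finite_rank[OF P inv[OF P]]
        almost_invariant_finite_rank[OF PP_compl[OF P] inv[OF PP_compl[OF P]]]
      by auto
    finally show ?thesis .
  qed
  then obtain n where n: "\<forall>P\<in>PP. commutator_rank T P \<le> enat n"
    using commutator_rank_bounded[OF T] by blast
  have "?g P \<le> enat n" if P: "P \<in> PP" for P
  proof -
    let ?Q = "id_blinfun - P" and ?C = "(P o\<^sub>L T) - (T o\<^sub>L P)"
    have "?Q o\<^sub>L T o\<^sub>L P = 0 - (?Q o\<^sub>L ?C o\<^sub>L P)"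
      using P by (intro blinfun_eqI) (simp add: blinfun.bilinear_simps)
    then have "?g P \<le> 0 + rank_op (?Q o\<^sub>L ?C o\<^sub>L P)"
      using rank_op_diff[of 0 "?Q o\<^sub>L ?C o\<^sub>L P"] by (simp only: rank_op_0)
    also have "\<dots> \<le> commutator_rank T P"
      unfolding commutator_rank_def using rank_op_sandwich[OF PP_BH[OF PP_compl[OF P]]] by simp
    also have "\<dots> \<le> enat n" using n P by blast
    finally show ?thesis .
  qed
  then have "\<kappa> \<le> enat n" unfolding \<kappa> by (rule SUP_least)
  then obtain k where k: "\<kappa> = enat k" by (cases \<kappa>) auto
  have "\<exists>P\<in>PP. enat k \<le> ?g P"
  proof (cases k)
    case 0
    then show ?thesis using PP_id by (auto simp: zero_enat_def[symmetric])
  next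
    case (Suc l)
    then have "enat l < (SUP P\<in>PP. ?g P)" using k \<kappa> by simp
    then obtain P where "P \<in> PP" "enat l < ?g P" by (auto simp: less_SUP_iff)
    then show ?thesis using Suc by (auto simp: Suc_ile_eq)
  qed
  moreover have "?g P \<le> enat k" if "P \<in> PP" for P
    unfolding k[symmetric] \<kappa> using that by (rule SUP_upper)
  ultimately show ?thesis using k by blast
qed

end

end

lemma FH_iff: "F \<in> FH \<longleftrightarrow> F \<in> BH \<and> rank_op F < \<infinity>"
  by (simp only: FH_def rank_op_finite_iff mem_Collect_eq)

theorem theorem4p7:
  fixes \<D> :: "('a::chilbert_space \<Rightarrow>\<^sub>L 'a) set"
    and T :: "'a \<Rightarrow>\<^sub>L 'a"
    and \<kappa> :: enat
  assumes "separable_space (euclidean :: 'a topology)"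
    and "masa \<D>"
    and "T \<in> BH"
    and "\<And>P. P \<in> projections_in \<D> \<Longrightarrow> almost_invariant T (range (blinfun_apply P))"
    and "\<kappa> = (SUP P\<in>projections_in \<D>. rank_op ((id_blinfun - P) o\<^sub>L T o\<^sub>L P))"
  shows "(\<exists>F\<in>FH. \<exists>D\<in>\<D>. T = D + F) \<and>
    \<kappa> < \<infinity> \<and>
    (atomic_masa TYPE('x) \<D> \<longrightarrow>
       (\<exists>F\<in>FH. \<exists>D\<in>\<D>. T = D + F \<and> rank_op F \<le> 3 * \<kappa>)) \<and>
    (continuous_masa TYPE('x) \<D> \<longrightarrow>
       (\<exists>!F. F \<in> FH \<and> T - F \<in> \<D>) \<and>
       (\<forall>F\<in>FH. T - F \<in> \<D> \<longrightarrow> rank_op F \<le> \<kappa>)) \<and>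
    (\<exists>F\<in>FH. \<exists>D\<in>\<D>. T = D + F \<and> rank_op F \<le> 6 * \<kappa>)"
proof -
  interpret separable_masa_algebra \<D> using assms(1,2) by unfold_locales
  obtain k where k: "\<kappa> = enat k"
    and bound: "\<And>P. P \<in> PP \<Longrightarrow> rank_op ((id_blinfun - P) o\<^sub>L T o\<^sub>L P) \<le> enat k"
    and attained: "\<exists>P\<in>PP. enat k \<le> rank_op ((id_blinfun - P) o\<^sub>L T o\<^sub>L P)"
    using off_diagonal_rank_attained[OF assms(3-5)] by blast
  have decomp: "\<exists>F\<in>FH. \<exists>D\<in>\<D>. T = D + F \<and> rank_op F \<le> enat n" if ex: "\<exists>D\<in>\<D>. rank_op (T - D) \<le> enat n" for n
  proof -
    obtain D where D: "D \<in> \<D>" "rank_op (T - D) \<le> enat n" using ex by blast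
    have "rank_op (T - D) < \<infinity>" using D(2) by (cases "rank_op (T - D)") auto
    then have "T - D \<in> FH" unfolding FH_iff using BH_diff[OF assms(3) D_BH[OF D(1)]] by blast
    then show ?thesis using D by (intro bexI[of _ "T - D"] bexI[of _ D]) auto
  qed
  have six: "\<exists>F\<in>FH. \<exists>D\<in>\<D>. T = D + F \<and> rank_op F \<le> 6 * \<kappa>"
    using decomp[OF general_rank_bound[OF assms(3) bound attained]] by (simp add: k numeral_eq_enat)
  have three: "\<exists>F\<in>FH. \<exists>D\<in>\<D>. T = D + F \<and> rank_op F \<le> 3 * \<kappa>" if "atomic_masa TYPE('x) \<D>"
  proof -
    obtain \<mu> :: "'x measure" where "sigma_finite_measure \<mu>" "purely_atomic \<mu>" "unitarily_equiv_mult_algebra \<D> \<mu>"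
      using \<open>atomic_masa TYPE('x) \<D>\<close> unfolding atomic_masa_def by blast
    note at = atomic_point_vectors[OF this]
    show ?thesis
      using decomp[OF atomic_rank_bound[OF assms(3) bound attained at]] by (simp add: k numeral_eq_enat)
  qed
  have one: "(\<exists>!F. F \<in> FH \<and> T - F \<in> \<D>) \<and> (\<forall>F\<in>FH. T - F \<in> \<D> \<longrightarrow> rank_op F \<le> \<kappa>)"
    if "continuous_masa TYPE('x) \<D>"
  proof -
    obtain \<mu> :: "'x measure" where "sigma_finite_measure \<mu>" "atomless \<mu>" "unitarily_equiv_mult_algebra \<D> \<mu>"
      using \<open>continuous_masa TYPE('x) \<D>\<close> unfolding continuous_masa_def by blast
    note cont = atomless_no_rank_one[OF this]
    \<comment> \<open>Existence is taken from the general bound; the sharper rank estimate is proved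
      separately for every such \<open>F\<close>.\<close>
    obtain F D where F: "F \<in> FH" "D \<in> \<D>" "T = D + F" using six by blast
    then have TF: "T - F \<in> \<D>" by simp
    have "G = F" if G: "G \<in> FH" "T - G \<in> \<D>" for G
    proof -
      \<comment> \<open>Two choices differ by a finite-rank member of the masa, which is 0 in the
        absence of rank-one projections.\<close>
      have "F - G = (T - G) - (T - F)" by simp
      then have "F - G \<in> \<D>" using diff_in_D[OF G(2) TF] by simp
      moreover have "rank_op (F - G) < \<infinity>"
        using rank_op_diff[of F G] F(1) G(1) unfolding FH_iff by (cases "rank_op (F - G)") auto
      ultimately have "F - G = 0" using finite_rank_in_D_eq_0[OF cont] by blast
      then show ?thesis by simp
    qed
    then have "\<exists>!F. F \<in> FH \<and> T - F \<in> \<D>" using F(1) TF by blast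
    moreover have "rank_op F \<le> \<kappa>" if "F \<in> FH" "T - F \<in> \<D>" for F
      unfolding k using that continuous_rank_bound[OF assms(3) bound attained cont] by (simp add: FH_iff)
    ultimately show ?thesis by blast
  qed
  show ?thesis using six three one k by auto
qed

end
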